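(* Let $\Omega\subset\mathbb{C}^N$ be a domain of class $L^{2,\infty}$ which is a domain of holomorphy, and let $a\in\partial\Omega$ be an edge point of $\partial\Omega$ for which there exists an edge $M_a$ at $a$ that is not a complex hypersurface in any neighborhood of $a$. Then the tangent cone $T_a\Omega$ of $\Omega$ at $a$ is convex.
   Context: $\mathbb{C}^N$ is identified with $\mathbb{R}^n$, $n=2N$. Class $L^{2,\infty}$: for an open subset $U\subset\mathbb{R}^m$ ($m\ge 1$), $L^{2,\infty}(U)$ is the space of real continuous functions $h$ on $U$ that are twice continuously differentiable with bounded derivatives (of orders up to two) on an open dense subset of $U$. A domain $\Omega\subset\mathbb{R}^n$ is of class $L^{2,\infty}$ if for every $a\in\partial\Omega$ there exist a system of local $C^2$-smooth coordinates $(x_1,\ldots,x_n)=(x',x_n)\in\mathbb{R}^{n-1}\times\mathbb{R}$ in a neighborhood $U=U'\times I$ of $a$ and a function $h\in L^{2,\infty}(U')$ such that $\Omega\cap U=\{(x',x_n)\in U: x_n>h(x')\}$. Regular and edge points: given $A\subset\mathbb{R}^n$, a point $a\in A$ is regular if $A\cap U_a$ is a smooth hypersurface of class $C^2$ for some neighborhood $U_a\subset\mathbb{R}^n$ of $a$. If $a\in A$ is not regular, it is called an edge point if there exist a neighborhood $U_a$ of $a$ and a connected closed $(n-2)$-dimensional submanifold $M_a\subset A\cap U_a$ of class $C^1$, called an edge at $a$, that contains all nonregular points of $A\cap U_a$. These notions are applied to $A=\partial\Omega$. The condition on $M_a$ means that for no neighborhood $V$ of $a$ is $M_a\cap V$ a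 complex hypersurface (a complex submanifold of complex codimension one). Tangent cone: the tangent cone $T_a\Omega$ of $\Omega\subset\mathbb{C}^N$ at $a\in\partial\Omega$ is the set of all possible limits of $t_k(a_k-a)\in\mathbb{C}^N$, where $a_k\in\Omega$ and $t_k\in\mathbb{R}_+$ are sequences with $a_k\to a$ as $k\to\infty$. *)

theory Defs
  imports "HOL-Analysis.Analysis"
begin

section \<open>Functions of class \<open>C\<^sup>k\<close>\<close>

text \<open>Meant for open sets \<open>S\<close>. In finite dimension, continuity of all iterated directional
  derivatives is continuity of the iterated Frechet derivatives.\<close>

primrec Ck_on :: "nat \<Rightarrow> ('a::euclidean_space \<Rightarrow> 'b::euclidean_space) \<Rightarrow> 'a set \<Rightarrow> bool" where
  "Ck_on 0 f S \<longleftrightarrow> continuous_on S f"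
| "Ck_on (Suc k) f S \<longleftrightarrow>
     (\<forall>x\<in>S. f differentiable (at x)) \<and> (\<forall>v. Ck_on k (\<lambda>x. frechet_derivative f (at x) v) S)"

definition Ck_diffeo ::
    "nat \<Rightarrow> ('a::euclidean_space \<Rightarrow> 'b::euclidean_space) \<Rightarrow> 'a set \<Rightarrow> 'b set \<Rightarrow> bool" where
  "Ck_diffeo k \<phi> W V \<longleftrightarrow>
     open W \<and> open V \<and> bij_betw \<phi> W V \<and> Ck_on k \<phi> W \<and> Ck_on k (inv_into W \<phi>) V"

text \<open>Embedded submanifolds of dimension \<open>d\<close> and class \<open>C\<^sup>k\<close>, described by local coordinate
  changes of the ambient space that flatten \<open>M\<close>.\<close>

definition Ck_submanifold :: "nat \<Rightarrow> nat \<Rightarrow> 'a::euclidean_space set \<Rightarrow> bool" where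
  "Ck_submanifold k d M \<longleftrightarrow>
     (\<forall>p\<in>M. \<exists>W V (\<phi> :: 'a \<Rightarrow> 'a) L.
        p \<in> W \<and> Ck_diffeo k \<phi> W V \<and> subspace L \<and> dim L = d \<and> \<phi> ` (M \<inter> W) = V \<inter> L)"

section \<open>The class \<open>L\<^sup>2\<^sup>,\<^sup>\<infinity>\<close>\<close>

text \<open>The bounds concern the first and second derivatives. Bounding \<open>h\<close> as well would not change
  the class of domains below, since the coordinate neighbourhood can be shrunk.\<close>

definition L2inf :: "(real ^ 'm) set \<Rightarrow> (real ^ 'm \<Rightarrow> real) \<Rightarrow> bool" where
  "L2inf U h \<longleftrightarrow>
     continuous_on U h \<and>
     (\<exists>V. open V \<and> V \<subseteq> U \<and> U \<subseteq> closure V \<and> Ck_on 2 h V \<and>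
        (\<forall>v. bounded ((\<lambda>x. frechet_derivative h (at x) v) ` V)) \<and>
        (\<forall>v w. bounded
          ((\<lambda>x. frechet_derivative (\<lambda>y. frechet_derivative h (at y) v) (at x) w) ` V)))"

text \<open>An index type with \<open>2 N - 1\<close> elements, where \<open>N = CARD('N)\<close>, so that
  \<open>real ^ 'N hyp_index\<close> is the space of the first \<open>n - 1\<close> of the \<open>n = 2 N\<close> real coordinates.\<close>

typedef (overloaded) ('N::finite) hyp_index = "{..<2 * CARD('N) - 1}"
proof
  have "0 < CARD('N)" by simp
  then show "0 \<in> {..<2 * CARD('N) - 1}" unfolding lessThan_iff by linarith
qed

instance hyp_index :: (finite) finite
proof
  have "finite (Abs_hyp_index ` {..<2 * CARD('a) - 1} :: 'a hyp_index set)"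
    by blast
  then show "finite (UNIV :: 'a hyp_index set)"
    by (simp only: type_definition.Abs_image[OF type_definition_hyp_index])
qed

lemma CARD_hyp_index: "CARD('N::finite hyp_index) = 2 * CARD('N) - 1"
  by (subst type_definition.card[OF type_definition_hyp_index]) simp

definition is_domain :: "'a::topological_space set \<Rightarrow> bool" where
  "is_domain \<Omega> \<longleftrightarrow> open \<Omega> \<and> connected \<Omega> \<and> \<Omega> \<noteq> {}"

text \<open>The local coordinates near \<open>a\<close> are \<open>\<phi>\<close>, defined on the neighbourhood \<open>W\<close> of \<open>a\<close>,
  which they identify with \<open>U' \<times> I\<close>.\<close>

definition class_L2inf :: "(complex ^ 'N) set \<Rightarrow> bool" where
  "class_L2inf \<Omega> \<longleftrightarrow>
     (\<forall>a\<in>frontier \<Omega>. \<exists>W U' I (\<phi> :: complex ^ 'N \<Rightarrow> (real ^ 'N hyp_index) \<times> real) h.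
        a \<in> W \<and> open U' \<and> open I \<and> is_interval I \<and> Ck_diffeo 2 \<phi> W (U' \<times> I) \<and>
        L2inf U' h \<and> \<phi> ` (\<Omega> \<inter> W) = {(x', xn). x' \<in> U' \<and> xn \<in> I \<and> xn > h x'})"

section \<open>Regular points, edge points, edges\<close>

definition regular_point :: "'a::euclidean_space set \<Rightarrow> 'a \<Rightarrow> bool" where
  "regular_point A a \<longleftrightarrow>
     a \<in> A \<and> (\<exists>U. open U \<and> a \<in> U \<and> Ck_submanifold 2 (DIM('a) - 1) (A \<inter> U))"

definition edge_at :: "'a::euclidean_space set \<Rightarrow> 'a \<Rightarrow> 'a set \<Rightarrow> bool" where
  "edge_at A a M \<longleftrightarrow>
     (\<exists>U. open U \<and> a \<in> U \<and> connected M \<and> closedin (top_of_set (A \<inter> U)) M \<and>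
        Ck_submanifold 1 (DIM('a) - 2) M \<and> {p \<in> A \<inter> U. \<not> regular_point A p} \<subseteq> M)"

definition edge_point :: "'a::euclidean_space set \<Rightarrow> 'a \<Rightarrow> bool" where
  "edge_point A a \<longleftrightarrow> a \<in> A \<and> \<not> regular_point A a \<and> (\<exists>M. edge_at A a M)"

section \<open>Several complex variables\<close>

definition holomorphic_fun_on :: "(complex ^ 'N \<Rightarrow> complex) \<Rightarrow> (complex ^ 'N) set \<Rightarrow> bool" where
  "holomorphic_fun_on f S \<longleftrightarrow>
     (\<forall>z\<in>S. \<exists>D. (f has_derivative D) (at z) \<and> (\<forall>c v. D (c *s v) = c * D v))"

definition holomorphic_map_on ::
    "(complex ^ 'N \<Rightarrow> complex ^ 'M) \<Rightarrow> (complex ^ 'N) set \<Rightarrow> bool" where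
  "holomorphic_map_on f S \<longleftrightarrow> (\<forall>j. holomorphic_fun_on (\<lambda>z. f z $ j) S)"

definition biholomorphic ::
    "(complex ^ 'N \<Rightarrow> complex ^ 'N) \<Rightarrow> (complex ^ 'N) set \<Rightarrow> (complex ^ 'N) set \<Rightarrow> bool" where
  "biholomorphic \<phi> W V \<longleftrightarrow>
     open W \<and> open V \<and> bij_betw \<phi> W V \<and>
     holomorphic_map_on \<phi> W \<and> holomorphic_map_on (inv_into W \<phi>) V"

definition complex_hypersurface :: "(complex ^ 'N) set \<Rightarrow> bool" where
  "complex_hypersurface S \<longleftrightarrow>
     (\<forall>p\<in>S. \<exists>W V \<phi> j. p \<in> W \<and> biholomorphic \<phi> W V \<and> \<phi> ` (S \<inter> W) = V \<inter> {z. z $ j = 0})"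

text \<open>No connected open set \<open>\<Omega>\<^sub>2\<close> sticking out of \<open>\<Omega>\<close> receives holomorphic continuations,
  across a fixed \<open>\<Omega>\<^sub>1 \<subseteq> \<Omega> \<inter> \<Omega>\<^sub>2\<close>, of all functions holomorphic on \<open>\<Omega>\<close>. Agreement is required
  only on \<open>\<Omega>\<^sub>1\<close>, since \<open>\<Omega> \<inter> \<Omega>\<^sub>2\<close> may be disconnected and continuations multivalued.\<close>

definition domain_of_holomorphy :: "(complex ^ 'N) set \<Rightarrow> bool" where
  "domain_of_holomorphy \<Omega> \<longleftrightarrow>
     is_domain \<Omega> \<and>
     \<not> (\<exists>\<Omega>\<^sub>1 \<Omega>\<^sub>2. open \<Omega>\<^sub>1 \<and> \<Omega>\<^sub>1 \<noteq> {} \<and> \<Omega>\<^sub>1 \<subseteq> \<Omega> \<inter> \<Omega>\<^sub>2 \<and>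
          open \<Omega>\<^sub>2 \<and> connected \<Omega>\<^sub>2 \<and> \<not> \<Omega>\<^sub>2 \<subseteq> \<Omega> \<and>
          (\<forall>f. holomorphic_fun_on f \<Omega> \<longrightarrow>
             (\<exists>g. holomorphic_fun_on g \<Omega>\<^sub>2 \<and> (\<forall>z\<in>\<Omega>\<^sub>1. g z = f z))))"

section \<open>Tangent cone\<close>

definition tangent_cone :: "'a::real_normed_vector set \<Rightarrow> 'a \<Rightarrow> 'a set" where
  "tangent_cone \<Omega> a =
     {v. \<exists>x t. (\<forall>k::nat. x k \<in> \<Omega> \<and> (t k :: real) > 0) \<and>
           x \<longlonglongrightarrow> a \<and> (\<lambda>k. t k *\<^sub>R (x k - a)) \<longlonglongrightarrow> v}"

end

theory Submission imports Defs "HOL-Complex_Analysis.Complex_Analysis" begin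

text \<open>In the chart of class \<open>L\<^sup>2\<^sup>,\<^sup>\<infinity>\<close> the boundary is a graph \<open>x\<^sub>n = h(x')\<close>, and the edge projects to a
  hypersurface \<open>E\<close> in the space of the \<open>x'\<close> which cuts it locally into two sides. On each side \<open>h\<close>
  is \<open>C\<^sup>2\<close> with bounded second derivatives, so its gradient is Lipschitz there and extends to \<open>E\<close>.
  Hence at every edge point near \<open>a\<close> the function \<open>h\<close> has two one-sided derivatives, which agree
  along \<open>E\<close>, and the tangent cone is bounded by two half-hyperplanes with a common edge. It is
  either the intersection of two half-spaces, and then convex, or a proper union of two half-spaces.

  In the second case the jump of the gradient has the concave sign at \<open>a\<close>, hence by
  continuity at all edge points \<open>p\<close> near \<open>a\<close>: the complement of \<open>\<Omega>\<close> is, to first order, contained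
  in a wedge \<open>{\<lambda>\<^sub>1 \<le> 0, \<lambda>\<^sub>2 \<le> 0}\<close> with linearly independent real forms (this alternative is
  \<open>convex_or_concave_wedges\<close>). Write \<open>\<lambda>\<^sub>i = Re f\<^sub>i\<close> with complex linear \<open>f\<^sub>i\<close>.
  If \<open>f\<^sub>1, f\<^sub>2\<close> are independent over the complex numbers, then they serve as coordinates
  \<open>z\<^sub>1, z\<^sub>2\<close>, and the discs \<open>z\<^sub>2 = - z\<^sub>1 - z\<^sub>1\<^sup>2/(2r) + s\<close>, \<open>\<bar>z\<^sub>1\<bar> \<le> r\<close>, have for small \<open>r\<close> their boundaries in
  \<open>\<Omega>\<close> for all \<open>s \<in> [0, r]\<close>, lie in \<open>\<Omega>\<close> for \<open>s = r\<close> and contain \<open>p\<close> for \<open>s = 0\<close>. Cauchy's integral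
  over their boundaries continues every holomorphic function across \<open>p\<close>, so \<open>\<Omega>\<close> is no domain of
  holomorphy (\<open>not_domain_of_holomorphy_if_concave_edge\<close>). Therefore \<open>f\<^sub>1, f\<^sub>2\<close> are proportional, and the tangent
  space of \<open>M\<close>, on which \<open>\<lambda>\<^sub>1\<close> and \<open>\<lambda>\<^sub>2\<close> vanish, is the complex hyperplane \<open>{f\<^sub>1 = 0}\<close>. A \<open>C\<^sup>1\<close> submanifold
  all of whose tangent spaces are complex hyperplanes is a complex hypersurface, since the function whose
  graph it is has complex linear derivatives (\<open>complex_hypersurface_if_tangents_complex\<close>).
  This contradicts the assumption on \<open>M\<close>.

  Two points need care. First, \<open>h\<close> is only assumed to be \<open>C\<^sup>2\<close> with bounded derivatives on some open
  dense set; that it is so off \<open>E\<close> follows from the regularity of the boundary there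
  (\<open>Ck_on_2_if_implicit\<close>). Secondly, a continuous function with bounded derivative on an open dense set
  need not be Lipschitz, as the Cantor function shows. Here it is, because the edge has codimension two:
  on almost every line the function \<open>h\<close> maps the points of \<open>E\<close> to a null set (\<open>lipschitz_across_thin_set\<close>).
  This makes the edge nowhere vertical, so that \<open>E\<close> is indeed a hypersurface.\<close>

section \<open>Calculus of functions of class \<open>C\<^sup>k\<close>\<close>

lemma Ck_on_subset: "Ck_on k f S \<Longrightarrow> T \<subseteq> S \<Longrightarrow> Ck_on k f T"
  by (induction k arbitrary: f) (auto intro: continuous_on_subset)

text \<open>The last assumption is proved by induction in \<open>Ck_on_cong\<close>, which itself needs this rule; \<open>Ck_on_I\<close>
  below is the rule without it.\<close>

lemma Ck_on_SucI:
  assumes S: "open S" and der: "\<And>x. x \<in> S \<Longrightarrow> (f has_derivative f' x) (at x)"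
    and C: "\<And>v. Ck_on k (\<lambda>x. f' x v) S"
    and cong: "\<And>f g. (\<And>x. x \<in> S \<Longrightarrow> f x = g x) \<Longrightarrow> Ck_on k f S \<Longrightarrow> Ck_on k (g :: _ \<Rightarrow> 'b::euclidean_space) S"
  shows "Ck_on (Suc k) (f :: 'a::euclidean_space \<Rightarrow> 'b) S"
proof -
  have "frechet_derivative f (at x) = f' x" if "x \<in> S" for x
    using frechet_derivative_at[OF der[OF that]] by simp
  then have "Ck_on k (\<lambda>x. frechet_derivative f (at x) v) S" for v
    by (intro cong[OF _ C[of v]]) simp
  moreover have "\<forall>x\<in>S. f differentiable (at x)"
    using der differentiable_def by blast
  ultimately show ?thesis by simp
qed

lemma Ck_on_cong:
  assumes "open S" "\<And>x. x \<in> S \<Longrightarrow> f x = g x" "Ck_on k f S"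
  shows "Ck_on k g S"
  using assms(2,3)
proof (induction k arbitrary: f g)
  case 0
  then show ?case by (simp cong: continuous_on_cong)
next
  case (Suc k)
  show ?case
  proof (rule Ck_on_SucI[OF assms(1)])
    fix x assume x: "x \<in> S"
    then have "(f has_derivative frechet_derivative f (at x)) (at x)"
      using Suc.prems(2) by (simp add: frechet_derivative_works)
    then show "(g has_derivative frechet_derivative f (at x)) (at x)"
      by (rule has_derivative_transform_within_open[OF _ assms(1) x]) (use Suc.prems(1) in auto)
  next
    show "Ck_on k (\<lambda>x. frechet_derivative f (at x) v) S" for v
      using Suc.prems(2) by simp
  qed (rule Suc.IH)
qed

lemma Ck_on_has_derivative:
  "Ck_on (Suc k) f S \<Longrightarrow> x \<in> S \<Longrightarrow> (f has_derivative frechet_derivative f (at x)) (at x)"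
  by (simp add: frechet_derivative_works)

lemma Ck_on_I:
  fixes f :: "'a::euclidean_space \<Rightarrow> 'b::euclidean_space"
  assumes "open S" "\<And>x. x \<in> S \<Longrightarrow> (f has_derivative f' x) (at x)" "\<And>v. Ck_on k (\<lambda>x. f' x v) S"
  shows "Ck_on (Suc k) f S"
proof (rule Ck_on_SucI[OF assms(1)])
  fix g g' :: "'a \<Rightarrow> 'b" assume "\<And>x. x \<in> S \<Longrightarrow> g x = g' x" "Ck_on k g S"
  from Ck_on_cong[OF assms(1) this] show "Ck_on k g' S" .
qed (use assms(2,3) in auto)

lemma Ck_on_Suc_imp: "Ck_on (Suc k) f S \<Longrightarrow> Ck_on k f S"
proof (induction k arbitrary: f)
  case 0
  then show ?case by (simp add: continuous_at_imp_continuous_on differentiable_imp_continuous_within)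
next
  case (Suc k)
  have 1: "\<forall>x\<in>S. f differentiable (at x)"
    using Suc.prems unfolding Ck_on.simps(2)[of "Suc k"] by blast
  have "Ck_on (Suc k) (\<lambda>x. frechet_derivative f (at x) v) S" for v
    using Suc.prems unfolding Ck_on.simps(2)[of "Suc k"] by blast
  from Suc.IH[OF this] 1 show ?case
    unfolding Ck_on.simps(2)[of k] by simp
qed

lemma Ck_on_imp_continuous: "Ck_on k f S \<Longrightarrow> continuous_on S f"
proof (induction k)
  case (Suc k)
  from Suc.IH[OF Ck_on_Suc_imp[OF Suc.prems]] show ?case .
qed simp

lemma Ck_on_const: "open S \<Longrightarrow> Ck_on k (\<lambda>x. c) S"
proof (induction k arbitrary: c)
  case (Suc k)
  show ?case by (rule Ck_on_I[where f'="\<lambda>x v. 0"]) (use Suc in auto)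
qed auto

lemma Ck_on_linear:
  assumes "open S" "bounded_linear l"
  shows "Ck_on k l S"
proof (cases k)
  case 0 then show ?thesis using assms by (simp add: linear_continuous_on)
next
  case (Suc k)
  show ?thesis unfolding Suc
    by (rule Ck_on_I[where f'="\<lambda>x. l"]) (use assms Ck_on_const bounded_linear_imp_has_derivative in auto)
qed

lemma Ck_on_linear_compose:
  assumes "open S" "bounded_linear l" "Ck_on k f S"
  shows "Ck_on k (\<lambda>x. l (f x)) S"
  using assms(3)
proof (induction k arbitrary: f)
  case 0
  then show ?case using assms(2) by (simp add: bounded_linear.continuous_on)
next
  case (Suc k)
  show ?case
  proof (rule Ck_on_I[OF assms(1)])
    fix x assume "x \<in> S"
    from bounded_linear.has_derivative[OF assms(2) Ck_on_has_derivative[OF Suc.prems this]]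
    show "((\<lambda>x. l (f x)) has_derivative (\<lambda>v. l (frechet_derivative f (at x) v))) (at x)" .
  next
    show "Ck_on k (\<lambda>x. l (frechet_derivative f (at x) v)) S" for v
      using Suc by simp
  qed
qed

lemma Ck_on_add:
  assumes "open S" "Ck_on k f S" "Ck_on k g S"
  shows "Ck_on k (\<lambda>x. f x + g x) S"
  using assms(2,3)
proof (induction k arbitrary: f g)
  case 0
  then show ?case by (simp add: continuous_on_add)
next
  case (Suc k)
  show ?case
  proof (rule Ck_on_I[OF assms(1)])
    fix x assume "x \<in> S"
    then show "((\<lambda>x. f x + g x) has_derivative (\<lambda>v. frechet_derivative f (at x) v + frechet_derivative g (at x) v)) (at x)"
      using Suc.prems by (intro has_derivative_add Ck_on_has_derivative) auto
  next
    show "Ck_on k (\<lambda>x. frechet_derivative f (at x) v + frechet_derivative g (at x) v) S" for v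
      using Suc by simp
  qed
qed

lemma Ck_on_sum:
  assumes "open S" "\<And>i. i \<in> A \<Longrightarrow> Ck_on k (f i) S"
  shows "Ck_on k (\<lambda>x. \<Sum>i\<in>A. f i x) S"
  using assms(2)
  by (induction A rule: infinite_finite_induct) (auto intro: Ck_on_const Ck_on_add assms(1))

lemma Ck_on_scaleR:
  assumes "open S" "Ck_on k f S" "Ck_on k g S"
  shows "Ck_on k (\<lambda>x. f x *\<^sub>R g x) S"
  using assms(2,3)
proof (induction k arbitrary: f g)
  case 0
  then show ?case by (simp add: continuous_on_scaleR)
next
  case (Suc k)
  note fg = Ck_on_Suc_imp[OF Suc.prems(1)] Ck_on_Suc_imp[OF Suc.prems(2)]
  show ?case
  proof (rule Ck_on_I[OF assms(1)])
    fix x assume "x \<in> S"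
    then show "((\<lambda>x. f x *\<^sub>R g x) has_derivative (\<lambda>v. f x *\<^sub>R frechet_derivative g (at x) v + frechet_derivative f (at x) v *\<^sub>R g x)) (at x)"
      by (intro has_derivative_scaleR Ck_on_has_derivative[OF Suc.prems(1)] Ck_on_has_derivative[OF Suc.prems(2)])
  next
    fix v
    have "Ck_on k (\<lambda>x. frechet_derivative f (at x) v) S" "Ck_on k (\<lambda>x. frechet_derivative g (at x) v) S"
      using Suc.prems by simp_all
    then show "Ck_on k (\<lambda>x. f x *\<^sub>R frechet_derivative g (at x) v + frechet_derivative f (at x) v *\<^sub>R g x) S"
      by (rule Ck_on_add[OF assms(1) Suc.IH[OF fg(1)] Suc.IH[OF _ fg(2)], rotated])
  qed
qed

lemma Ck_on_inverse:
  fixes f :: "'a::euclidean_space \<Rightarrow> real"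
  assumes "open S" "Ck_on k f S" "\<And>x. x \<in> S \<Longrightarrow> f x \<noteq> 0"
  shows "Ck_on k (\<lambda>x. inverse (f x)) S"
  using assms(2)
proof (induction k)
  case 0
  then show ?case using assms(3) by (auto intro: continuous_on_inverse)
next
  case (Suc k)
  note f = Ck_on_Suc_imp[OF Suc.prems]
  note mult = Ck_on_scaleR[OF assms(1), where 'b=real, unfolded real_scaleR_def]
  show ?case
  proof (rule Ck_on_I[OF assms(1)])
    fix x assume "x \<in> S"
    then show "((\<lambda>x. inverse (f x)) has_derivative (\<lambda>v. - 1 * (inverse (f x) * frechet_derivative f (at x) v * inverse (f x)))) (at x)"
      using Deriv.has_derivative_inverse[OF assms(3) Ck_on_has_derivative[OF Suc.prems]] by simp
  next
    show "Ck_on k (\<lambda>x. - 1 * (inverse (f x) * frechet_derivative f (at x) v * inverse (f x))) S" for v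
    proof -
      have "Ck_on k (\<lambda>x. frechet_derivative f (at x) v) S" using Suc.prems by simp
      then show ?thesis by (intro mult Ck_on_const assms(1) Suc.IH[OF f])
    qed
  qed
qed

text \<open>The chain rule, written in coordinates: this makes the derivative of \<open>f \<circ> g\<close> a sum of products of
  functions of class \<open>C\<^sup>k\<close>, to which the induction hypothesis applies.\<close>

lemma Ck_on_compose:
  fixes g :: "'a::euclidean_space \<Rightarrow> 'b::euclidean_space"
  assumes "open S" "Ck_on k g S" "open T" "Ck_on k f T" "g ` S \<subseteq> T"
  shows "Ck_on k (\<lambda>x. f (g x)) S"
  using assms(2,4)
proof (induction k arbitrary: f)
  case 0
  then show ?case using continuous_on_compose2[of T f S g] assms(5) by simp
next
  case (Suc k)
  note g = Ck_on_Suc_imp[OF Suc.prems(1)]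
  let ?D = "\<lambda>x v. \<Sum>b\<in>Basis. (frechet_derivative g (at x) v \<bullet> b) *\<^sub>R frechet_derivative f (at (g x)) b"
  show ?case
  proof (rule Ck_on_I[OF assms(1), where f'="?D"])
    fix x assume x: "x \<in> S"
    have f': "(f has_derivative frechet_derivative f (at (g x))) (at (g x))"
      by (rule Ck_on_has_derivative[OF Suc.prems(2)]) (use x assms(5) in auto)
    from has_derivative_compose[OF Ck_on_has_derivative[OF Suc.prems(1) x] this]
    have *: "((\<lambda>x. f (g x)) has_derivative (\<lambda>v. frechet_derivative f (at (g x)) (frechet_derivative g (at x) v))) (at x)" .
    have "frechet_derivative f (at (g x)) w = (\<Sum>b\<in>Basis. (w \<bullet> b) *\<^sub>R frechet_derivative f (at (g x)) b)" for w
    proof -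
      have "frechet_derivative f (at (g x)) w = frechet_derivative f (at (g x)) (\<Sum>b\<in>Basis. (w \<bullet> b) *\<^sub>R b)"
        by (simp only: euclidean_representation)
      also have "\<dots> = (\<Sum>b\<in>Basis. (w \<bullet> b) *\<^sub>R frechet_derivative f (at (g x)) b)"
        by (simp only: linear_sum[OF has_derivative_linear[OF f']] linear_scale[OF has_derivative_linear[OF f']])
      finally show ?thesis .
    qed
    then have "(\<lambda>v. frechet_derivative f (at (g x)) (frechet_derivative g (at x) v)) = ?D x"
      by (intro ext)
    then show "((\<lambda>x. f (g x)) has_derivative ?D x) (at x)" using * by (simp only:)
  next
    show "Ck_on k (\<lambda>x. ?D x v) S" for v
    proof (intro Ck_on_sum Ck_on_scaleR assms(1))
      show "Ck_on k (\<lambda>x. frechet_derivative g (at x) v \<bullet> b) S" for b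
        by (rule Ck_on_linear_compose[OF assms(1) bounded_linear_inner_left]) (use Suc.prems in simp)
      show "Ck_on k (\<lambda>x. frechet_derivative f (at (g x)) b) S" for b
        by (rule Suc.IH[OF g]) (use Suc.prems in simp)
    qed
  qed
qed

lemma Ck_on_Pair:
  assumes "open S" "Ck_on k f S" "Ck_on k g S"
  shows "Ck_on k (\<lambda>x. (f x, g x)) S"
proof -
  have "Ck_on k (\<lambda>x. (f x, 0) + (0, g x)) S"
    by (intro Ck_on_add Ck_on_linear_compose[of S "\<lambda>y. (y,0)"] Ck_on_linear_compose[of S "\<lambda>y. (0,y)"] assms
      bounded_linear_Pair bounded_linear_ident bounded_linear_zero)
  then show ?thesis by simp
qed

lemma Ck_on_1_blinfun:
  fixes f :: "'a::euclidean_space \<Rightarrow> 'b::euclidean_space"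
  assumes "Ck_on 1 f S"
  obtains f' where "\<And>x. x \<in> S \<Longrightarrow> (f has_derivative blinfun_apply (f' x)) (at x)"
    "\<And>x. x \<in> S \<Longrightarrow> blinfun_apply (f' x) = frechet_derivative f (at x)" "continuous_on S f'"
proof -
  define f' where "f' x = Blinfun (frechet_derivative f (at x))" for x
  have der: "(f has_derivative frechet_derivative f (at x)) (at x)" if "x \<in> S" for x
    using Ck_on_has_derivative[of 0] assms that by simp
  have ap: "blinfun_apply (f' x) = frechet_derivative f (at x)" if "x \<in> S" for x
    unfolding f'_def by (metis der[OF that] bounded_linear_Blinfun_apply has_derivative_bounded_linear)
  have "continuous_on S f'"
  proof (rule continuous_on_blinfun_componentwise)
    fix i :: 'a
    have "continuous_on S (\<lambda>x. frechet_derivative f (at x) i)" using assms by simp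
    then show "continuous_on S (\<lambda>x. blinfun_apply (f' x) i)"
      by (rule continuous_on_eq) (simp add: ap)
  qed
  then show thesis using that[of f'] der ap by simp
qed

lemma Ck_diffeo_derivatives:
  assumes "Ck_diffeo (Suc k) \<phi> W V" "p \<in> W"
  defines "D \<equiv> frechet_derivative \<phi> (at p)" and "E \<equiv> frechet_derivative (inv_into W \<phi>) (at (\<phi> p))"
  shows "(\<phi> has_derivative D) (at p)" "(inv_into W \<phi> has_derivative E) (at (\<phi> p))"
    "E (D v) = v" "D (E w) = w"
proof -
  have a: "open W" "open V" "bij_betw \<phi> W V" "Ck_on (Suc k) \<phi> W" "Ck_on (Suc k) (inv_into W \<phi>) V"
    using assms(1) by (auto simp: Ck_diffeo_def)
  then have pV: "\<phi> p \<in> V" using assms(2) bij_betwE by blast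
  show D: "(\<phi> has_derivative D) (at p)" and E: "(inv_into W \<phi> has_derivative E) (at (\<phi> p))"
    unfolding D_def E_def using a pV assms(2) Ck_on_has_derivative by blast+
  have inv: "inv_into W \<phi> (\<phi> p) = p" using a(3) assms(2) by (simp add: bij_betw_inv_into_left)
  have "((\<lambda>x. inv_into W \<phi> (\<phi> x)) has_derivative (\<lambda>v. E (D v))) (at p)"
    using has_derivative_compose[OF D E] .
  then have "((\<lambda>x. x) has_derivative (\<lambda>v. E (D v))) (at p)"
    by (rule has_derivative_transform_within_open[OF _ a(1) assms(2)]) (use a(3) in \<open>simp add: bij_betw_inv_into_left\<close>)
  then have "(\<lambda>v. E (D v)) = (\<lambda>v. v)"
    using has_derivative_unique has_derivative_ident by blast
  then show "E (D v) = v" by metis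
  have "(\<phi> has_derivative D) (at (inv_into W \<phi> (\<phi> p)))" using D inv by simp
  from has_derivative_compose[OF E this]
  have "((\<lambda>x. \<phi> (inv_into W \<phi> x)) has_derivative (\<lambda>v. D (E v))) (at (\<phi> p))" .
  then have "((\<lambda>x. x) has_derivative (\<lambda>v. D (E v))) (at (\<phi> p))"
    by (rule has_derivative_transform_within_open[OF _ a(2) pV]) (use a(3) in \<open>simp add: bij_betw_inv_into_right\<close>)
  then have "(\<lambda>v. D (E v)) = (\<lambda>v. v)"
    using has_derivative_unique has_derivative_ident by blast
  then show "D (E w) = w" by metis
qed

lemma Ck_on_local:
  assumes "\<And>x. x \<in> S \<Longrightarrow> \<exists>X. open X \<and> x \<in> X \<and> Ck_on k f X"
  shows "Ck_on k f S"
  using assms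
proof (induction k arbitrary: f)
  case 0
  have "isCont f x" if "x \<in> S" for x
  proof -
    obtain X where "open X" "x \<in> X" "continuous_on X f" using 0[OF \<open>x \<in> S\<close>] by auto
    then show ?thesis using continuous_on_eq_continuous_at by blast
  qed
  then show ?case by (simp add: continuous_at_imp_continuous_on)
next
  case (Suc k)
  show ?case unfolding Ck_on.simps
  proof (intro conjI ballI allI)
    fix x assume "x \<in> S"
    from Suc.prems[OF this] show "f differentiable (at x)" by auto
  next
    fix v
    show "Ck_on k (\<lambda>x. frechet_derivative f (at x) v) S"
    proof (rule Suc.IH)
      fix x assume "x \<in> S"
      from Suc.prems[OF this] show "\<exists>X. open X \<and> x \<in> X \<and> Ck_on k (\<lambda>x. frechet_derivative f (at x) v) X"
        by (auto simp del: One_nat_def)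
    qed
  qed
qed

section \<open>Tangent spaces of submanifolds\<close>

lemma tendsto_scaled_difference:
  fixes x :: "nat \<Rightarrow> 'a::real_normed_vector" and \<theta> :: "'a \<Rightarrow> 'b::real_normed_vector"
  assumes \<theta>: "(\<theta> has_derivative \<theta>') (at p)" and x: "x \<longlonglongrightarrow> p" and t: "\<And>k. t k > 0"
    and v: "(\<lambda>k. t k *\<^sub>R (x k - p)) \<longlonglongrightarrow> v"
  shows "(\<lambda>k. t k *\<^sub>R (\<theta> (x k) - \<theta> p)) \<longlonglongrightarrow> \<theta>' v"
proof -
  have lin: "bounded_linear \<theta>'" using \<theta> by (rule has_derivative_bounded_linear)
  have 1: "(\<lambda>k. \<theta>' (t k *\<^sub>R (x k - p))) \<longlonglongrightarrow> \<theta>' v"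
    using bounded_linear.tendsto[OF lin v] .
  obtain B where B: "B > 0" "\<And>k. norm (t k *\<^sub>R (x k - p)) \<le> B"
    using convergent_imp_Bseq[OF convergentI[OF v]] by (auto simp: Bseq_def)
  have "(\<lambda>k. t k *\<^sub>R (\<theta> (x k) - \<theta> p) - \<theta>' (t k *\<^sub>R (x k - p))) \<longlonglongrightarrow> 0"
    unfolding tendsto_iff
  proof (intro allI impI)
    fix e :: real assume e: "e > 0"
    then have "e / (2 * B) > 0" using B by simp
    then obtain d where d: "d > 0" "\<And>y. norm (y - p) < d \<Longrightarrow> norm (\<theta> y - \<theta> p - \<theta>' (y - p)) \<le> e / (2 * B) * norm (y - p)"
      using \<theta> unfolding has_derivative_at_alt by blast
    have "eventually (\<lambda>k. norm (x k - p) < d) sequentially"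
      using x d(1) by (simp add: tendsto_iff dist_norm)
    then show "eventually (\<lambda>k. dist (t k *\<^sub>R (\<theta> (x k) - \<theta> p) - \<theta>' (t k *\<^sub>R (x k - p))) 0 < e) sequentially"
    proof eventually_elim
      case (elim k)
      have "t k *\<^sub>R (\<theta> (x k) - \<theta> p) - \<theta>' (t k *\<^sub>R (x k - p)) = t k *\<^sub>R (\<theta> (x k) - \<theta> p - \<theta>' (x k - p))"
        unfolding linear_cmul[OF bounded_linear.linear[OF lin]] by (simp add: scaleR_diff_right)
      then have "norm (t k *\<^sub>R (\<theta> (x k) - \<theta> p) - \<theta>' (t k *\<^sub>R (x k - p))) = t k * norm (\<theta> (x k) - \<theta> p - \<theta>' (x k - p))"
        using t[of k] by simp
      also have "\<dots> \<le> t k * (e / (2 * B) * norm (x k - p))"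
        using d(2)[OF elim] t[of k] by (intro mult_left_mono) auto
      also have "\<dots> = e / (2 * B) * norm (t k *\<^sub>R (x k - p))" using t[of k] by simp
      also have "\<dots> \<le> e / (2 * B) * B" using B e by (intro mult_left_mono) auto
      also have "\<dots> < e" using B e by simp
      finally show ?case by simp
    qed
  qed
  from tendsto_add[OF this 1] show ?thesis by simp
qed

text \<open>The sequence \<open>\<sigma> (k + v / n)\<close> approaches \<open>\<sigma> k\<close> in the direction \<open>\<Sigma> v\<close>; finitely many of its terms,
  for which \<open>k + v / n\<close> may leave \<open>B\<close>, are skipped.\<close>

lemma derivative_in_tangent_cone:
  fixes \<sigma> :: "'b::real_normed_vector \<Rightarrow> 'a::real_normed_vector"
  assumes \<sigma>: "(\<sigma> has_derivative \<Sigma>) (at k)" and B: "open B" "k \<in> B"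
    and M: "\<And>s. s > 0 \<Longrightarrow> k + s *\<^sub>R v \<in> B \<Longrightarrow> \<sigma> (k + s *\<^sub>R v) \<in> M"
  shows "\<Sigma> v \<in> tangent_cone M (\<sigma> k)"
proof -
  obtain e where e: "e > 0" "ball k e \<subseteq> B" using B open_contains_ball by blast
  obtain n0 :: nat where n0: "norm v / e < real n0" using reals_Archimedean2 by blast
  define t where "t n = real (Suc (n + n0))" for n
  define y where "y n = k + inverse (t n) *\<^sub>R v" for n
  have t: "t n > 0" "t n > norm v / e" for n using n0 by (auto simp: t_def)
  have yB: "y n \<in> B" for n
  proof -
    have "norm v < t n * e" using t(2)[of n] e by (simp add: field_simps)
    then have "inverse (t n) * norm v < e" using t(1)[of n] by (simp add: field_simps)
    then show "y n \<in> B" using t(1)[of n] by (intro subsetD[OF e(2)]) (simp add: y_def dist_norm)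
  qed
  have \<sigma>M: "\<sigma> (y n) \<in> M" for n
    using M[of "inverse (t n)"] yB[of n] t(1)[of n] by (simp add: y_def)
  have "(\<lambda>n. inverse (t n)) \<longlonglongrightarrow> 0"
    unfolding t_def by (rule LIMSEQ_ignore_initial_segment[OF LIMSEQ_inverse_real_of_nat])
  then have "(\<lambda>n. k + inverse (t n) *\<^sub>R v) \<longlonglongrightarrow> k + 0 *\<^sub>R v" by (intro tendsto_intros)
  then have y: "y \<longlonglongrightarrow> k" by (simp add: y_def[abs_def])
  have "t n *\<^sub>R (y n - k) = v" for n
    using t(1)[of n] by (simp add: y_def)
  then have ty: "(\<lambda>n. t n *\<^sub>R (y n - k)) \<longlonglongrightarrow> v" by simp
  have 1: "(\<lambda>n. t n *\<^sub>R (\<sigma> (y n) - \<sigma> k)) \<longlonglongrightarrow> \<Sigma> v"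
    by (rule tendsto_scaled_difference[OF \<sigma> y t(1) ty])
  have 2: "(\<lambda>n. \<sigma> (y n)) \<longlonglongrightarrow> \<sigma> k"
    using isCont_tendsto_compose[OF has_derivative_continuous[OF \<sigma>] y] .
  show ?thesis
    unfolding tangent_cone_def using \<sigma>M t(1) 1 2
    by (intro CollectI exI[of _ "\<lambda>n. \<sigma> (y n)"] exI[of _ t]) blast
qed

text \<open>For a submanifold the tangent cone of sequences is the usual tangent space; this makes the
  latter independent of the chart.\<close>

lemma tangent_cone_submanifold:
  fixes M :: "'a::euclidean_space set"
  assumes p: "p \<in> M" "p \<in> W" and \<psi>: "Ck_diffeo (Suc k) \<psi> W V" and L: "subspace L"
    and flat: "\<psi> ` (M \<inter> W) = V \<inter> L"
  shows "tangent_cone M p = {v. frechet_derivative \<psi> (at p) v \<in> L}"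
proof -
  note D = Ck_diffeo_derivatives[OF \<psi> p(2)]
  let ?D = "frechet_derivative \<psi> (at p)" and ?\<xi> = "inv_into W \<psi>"
    and ?E = "frechet_derivative (inv_into W \<psi>) (at (\<psi> p))"
  have a: "open W" "open V" "bij_betw \<psi> W V" using \<psi> by (auto simp: Ck_diffeo_def)
  have \<psi>p: "\<psi> p \<in> V \<inter> L" using flat p by blast
  show ?thesis
  proof (intro equalityI subsetI CollectI; (drule CollectD)?)
    fix v assume "v \<in> tangent_cone M p"
    then obtain x t where x: "\<And>k. x k \<in> M" "\<And>k. (t k::real) > 0" "x \<longlonglongrightarrow> p" "(\<lambda>k. t k *\<^sub>R (x k - p)) \<longlonglongrightarrow> v"
      by (auto simp: tangent_cone_def)
    have "(\<lambda>k. t k *\<^sub>R (\<psi> (x k) - \<psi> p)) \<longlonglongrightarrow> ?D v"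
      by (rule tendsto_scaled_difference[OF D(1) x(3,2,4)])
    moreover have "eventually (\<lambda>k. x k \<in> W) sequentially"
      using x(3) a(1) p(2) by (auto simp: tendsto_def)
    then have "eventually (\<lambda>k. t k *\<^sub>R (\<psi> (x k) - \<psi> p) \<in> L) sequentially"
    proof eventually_elim
      case (elim k)
      then have "\<psi> (x k) \<in> L" using x(1) flat by blast
      then show ?case using L \<psi>p by (simp add: subspace_diff subspace_scale)
    qed
    ultimately show "?D v \<in> L"
      using Lim_in_closed_set[OF closed_subspace[OF L]] by force
  next
    fix v assume v: "?D v \<in> L"
    have \<xi>p: "?\<xi> (\<psi> p) = p" using a(3) p(2) by (simp add: bij_betw_inv_into_left)
    have "?E (?D v) \<in> tangent_cone M (?\<xi> (\<psi> p))"
    proof (rule derivative_in_tangent_cone[OF D(2) a(2)])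
      show "\<psi> p \<in> V" using \<psi>p by blast
      fix s :: real assume "\<psi> p + s *\<^sub>R ?D v \<in> V"
      moreover have "\<psi> p + s *\<^sub>R ?D v \<in> L" using v L \<psi>p by (simp add: subspace_add subspace_scale)
      ultimately have "\<psi> p + s *\<^sub>R ?D v \<in> \<psi> ` (M \<inter> W)" using flat by blast
      then obtain z where "z \<in> M" "z \<in> W" "\<psi> p + s *\<^sub>R ?D v = \<psi> z" by blast
      then show "?\<xi> (\<psi> p + s *\<^sub>R ?D v) \<in> M" using a(3) by (simp add: bij_betw_inv_into_left)
    qed
    then show "v \<in> tangent_cone M p" by (simp add: D(3) \<xi>p)
  qed
qed

lemma tangent_cone_submanifold_subspace:
  fixes M :: "'a::euclidean_space set"
  assumes M: "Ck_submanifold 1 d M" "p \<in> M"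
  shows "subspace (tangent_cone M p)" "dim (tangent_cone M p) = d"
proof -
  obtain W V L and \<psi> :: "'a \<Rightarrow> 'a" where \<psi>: "p \<in> W" "Ck_diffeo 1 \<psi> W V" "subspace L" "dim L = d" and flat: "\<psi> ` (M \<inter> W) = V \<inter> L"
    using bspec[OF M(1)[unfolded Ck_submanifold_def] M(2)] by blast
  note D = Ck_diffeo_derivatives[OF \<psi>(2)[unfolded One_nat_def] \<psi>(1)]
  let ?D = "frechet_derivative \<psi> (at p)" and ?E = "frechet_derivative (inv_into W \<psi>) (at (\<psi> p))"
  have T: "tangent_cone M p = {v. ?D v \<in> L}"
    by (rule tangent_cone_submanifold[OF M(2) \<psi>(1) \<psi>(2)[unfolded One_nat_def] \<psi>(3) flat])
  have linE: "linear ?E" using D(2) by (rule has_derivative_linear)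
  have TE: "tangent_cone M p = ?E ` L"
  proof (intro equalityI subsetI)
    fix v assume "v \<in> tangent_cone M p"
    then have "?D v \<in> L" by (simp add: T)
    then show "v \<in> ?E ` L" using D(3)[of v] by (metis imageI)
  next
    fix v assume "v \<in> ?E ` L"
    then obtain l where "l \<in> L" "v = ?E l" by blast
    then show "v \<in> tangent_cone M p" by (simp add: T D(4))
  qed
  show "subspace (tangent_cone M p)" unfolding TE by (rule linear_subspace_image[OF linE \<psi>(3)])
  have "inj_on ?E (span L)" by (rule inj_on_inverseI[of _ ?D]) (simp add: D(4))
  from dim_image_eq[OF linE this] show "dim (tangent_cone M p) = d" unfolding TE using \<psi>(4) by simp
qed

text \<open>If \<open>\<theta>\<close> maps the tangent space of \<open>M\<close> isomorphically onto the range of a projection \<open>\<pi>\<close>, then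
  \<open>\<theta> ` M\<close> is the image of that subspace under a local \<open>C\<^sup>1\<close> diffeomorphism \<open>\<Psi>\<close> which acts as a
  translation in the complementary directions. Here \<open>c\<close> parametrizes \<open>M\<close> by the range of \<open>\<pi>\<close> so
  that \<open>\<theta> \<circ> c\<close> has derivative \<open>\<pi>\<close> at \<open>0\<close>; then \<open>\<Psi> x = \<theta> (c x) + (x - \<pi> x)\<close> has derivative the
  identity, and the inverse function theorem applies. The lemma is used twice, for the projection
  of the edge to the space of the \<open>x'\<close> and for the projection of \<open>M\<close> to a complex coordinate hyperplane.\<close>

lemma submanifold_straighten:
  fixes M :: "'a::euclidean_space set" and \<theta> :: "'a \<Rightarrow> 'b::euclidean_space"
  assumes M: "Ck_submanifold 1 d M" "p \<in> M" and N: "open N" "p \<in> N" "Ck_on 1 \<theta> N"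
    and \<pi>: "linear \<pi>" "\<And>x. \<pi> (\<pi> x) = \<pi> x" "dim (range \<pi>) = d"
    and inK: "\<And>v. v \<in> tangent_cone M p \<Longrightarrow> \<pi> (frechet_derivative \<theta> (at p) v) = frechet_derivative \<theta> (at p) v"
    and inj: "\<And>v. v \<in> tangent_cone M p \<Longrightarrow> frechet_derivative \<theta> (at p) v = 0 \<Longrightarrow> v = 0"
  obtains A B Q \<Psi> \<Psi>' c where
    "open A" "0 \<in> A" "open B" "homeomorphism A B \<Psi> \<Psi>'" "Ck_on 1 \<Psi> A"
    "\<And>y. y \<in> B \<Longrightarrow> \<exists>E. (\<Psi>' has_derivative E) (at y) \<and>
        (\<forall>v. E (frechet_derivative \<Psi> (at (\<Psi>' y)) v) = v) \<and> (\<forall>v. frechet_derivative \<Psi> (at (\<Psi>' y)) (E v) = v)"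
    "Ck_on 1 c A" "c 0 = p" "c ` A \<subseteq> N"
    "\<And>x. x \<in> A \<Longrightarrow> \<Psi> x = \<theta> (c x) + (x - \<pi> x)"
    "\<And>x. x \<in> A \<Longrightarrow> \<pi> x = x \<Longrightarrow> c x \<in> M"
    "open Q" "p \<in> Q" "\<And>q. q \<in> M \<inter> Q \<Longrightarrow> \<exists>x\<in>A. \<pi> x = x \<and> c x = q"
proof -
  obtain W V L and \<psi> :: "'a \<Rightarrow> 'a" where \<psi>: "p \<in> W" "Ck_diffeo 1 \<psi> W V" "subspace L" "dim L = d" and flat: "\<psi> ` (M \<inter> W) = V \<inter> L"
    using bspec[OF M(1)[unfolded Ck_submanifold_def] M(2)] by blast
  define \<xi> where "\<xi> = inv_into W \<psi>"
  define D where "D = frechet_derivative \<psi> (at p)"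
  define E where "E = frechet_derivative \<xi> (at (\<psi> p))"
  define \<theta>' where "\<theta>' = frechet_derivative \<theta> (at p)"
  have a: "open W" "open V" "bij_betw \<psi> W V" "Ck_on 1 \<psi> W" "Ck_on 1 \<xi> V"
    using \<psi>(2) by (auto simp: Ck_diffeo_def \<xi>_def)
  note DE = Ck_diffeo_derivatives[OF \<psi>(2)[unfolded One_nat_def] \<psi>(1), folded \<xi>_def, folded D_def E_def]
  have T: "tangent_cone M p = {v. D v \<in> L}"
    unfolding D_def using tangent_cone_submanifold[OF M(2) \<psi>(1) \<psi>(2)[unfolded One_nat_def] \<psi>(3) flat] .
  have \<theta>': "(\<theta> has_derivative \<theta>') (at p)"
    unfolding \<theta>'_def using Ck_on_has_derivative[of 0] N by simp
  have linE: "linear E" using DE(2) by (rule has_derivative_linear)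
  have linD: "linear D" using DE(1) by (rule has_derivative_linear)
  have lin\<theta>': "linear \<theta>'" using \<theta>' by (rule has_derivative_linear)
  define J where "J = \<theta>' \<circ> E"
  have linJ: "linear J" unfolding J_def by (intro linear_compose linE lin\<theta>')
  have ET: "E l \<in> tangent_cone M p" if "l \<in> L" for l using that by (simp add: T DE(4))
  have J0: "l = 0" if "l \<in> L" "J l = 0" for l
  proof -
    have "E l = 0" using inj[OF ET[OF that(1)]] that(2) by (simp add: J_def \<theta>'_def)
    then have "D (E l) = 0" using linear_0[OF linD] by simp
    then show ?thesis by (simp add: DE(4))
  qed
  have injJ: "inj_on J L"
    using linear_inj_on_iff_eq_0[OF linJ \<psi>(3)] J0 by blast
  have spanL: "span L = L" using \<psi>(3) by (simp add: span_eq_iff)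
  obtain g where g: "range g \<subseteq> L" "linear g" "\<And>l. l \<in> L \<Longrightarrow> g (J l) = l"
    using linear_exists_left_inverse_on[OF linJ \<psi>(3) injJ] by blast
  have rangeJ: "J ` L = range \<pi>"
  proof (rule subspace_dim_equal)
    show "subspace (J ` L)" using linJ \<psi>(3) by (rule linear_subspace_image)
    show "subspace (range \<pi>)" using \<pi>(1) by (rule linear_subspace_image) simp
    show "J ` L \<subseteq> range \<pi>"
    proof (rule image_subsetI)
      fix l assume "l \<in> L"
      then have "\<pi> (J l) = J l" using inK[OF ET] by (simp add: J_def \<theta>'_def)
      then show "J l \<in> range \<pi>" using rangeI[of \<pi> "J l"] by (simp only:)
    qed
    have "dim (J ` L) = dim L" using dim_image_eq[OF linJ, of L] injJ by (simp only: spanL)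
    then show "dim (range \<pi>) \<le> dim (J ` L)" using \<pi>(3) \<psi>(4) by simp
  qed
  define S where "S = g \<circ> \<pi>"
  have linS: "linear S" unfolding S_def by (intro linear_compose \<pi> g)
  have bS: "bounded_linear S" using linS by (simp add: linear_conv_bounded_linear)
  have SL: "S x \<in> L" for x using g(1) by (auto simp: S_def)
  have JS: "J (S x) = \<pi> x" for x
  proof -
    have "\<pi> x \<in> J ` L" using rangeJ by blast
    then show ?thesis using g(3) by (auto simp: S_def)
  qed
  have \<psi>p: "\<psi> p \<in> V \<inter> L" using flat \<psi>(1) M(2) by blast
  have \<xi>\<psi>: "\<xi> (\<psi> q) = q" if "q \<in> W" for q
    unfolding \<xi>_def using a(3) that by (simp add: bij_betw_inv_into_left)
  \<comment> \<open>The linear map \<open>S\<close> inverts \<open>J\<close> on the range of \<open>\<pi>\<close> and vanishes on the kernel of \<open>\<pi>\<close>.\<close>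
  define aff where "aff x = \<psi> p + S x" for x
  have aff1: "Ck_on 1 aff U" if "open U" for U
    unfolding aff_def by (intro Ck_on_add Ck_on_const Ck_on_linear bS that)
  define c where "c x = \<xi> (aff x)" for x
  define U1 where "U1 = aff -` V"
  have U1: "open U1"
    unfolding U1_def by (intro open_vimage a) (use Ck_on_imp_continuous[OF aff1] in auto)
  have cU1: "Ck_on 1 c U1"
    unfolding c_def by (rule Ck_on_compose[OF U1 aff1[OF U1] a(2,5)]) (auto simp: U1_def)
  define U2 where "U2 = U1 \<inter> c -` N"
  have U2: "open U2"
    unfolding U2_def by (rule continuous_open_preimage[OF Ck_on_imp_continuous[OF cU1] U1 N(1)])
  have cU2: "Ck_on 1 c U2" by (rule Ck_on_subset[OF cU1]) (simp add: U2_def)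
  have aff0: "aff 0 = \<psi> p" using linear_0[OF linS] by (simp add: aff_def)
  have c0: "c 0 = p" by (simp add: c_def aff0 \<xi>\<psi> \<psi>(1))
  have zU2: "0 \<in> U2" using c0 N(2) \<psi>p by (simp add: U2_def U1_def aff0)
  define \<Psi> where "\<Psi> x = \<theta> (c x) + (x - \<pi> x)" for x
  have b\<pi>: "bounded_linear (\<lambda>x. x - \<pi> x)"
    using \<pi>(1) by (intro bounded_linear_sub bounded_linear_ident) (simp add: linear_conv_bounded_linear)
  have \<Psi>1: "Ck_on 1 \<Psi> U2"
    unfolding \<Psi>_def by (intro Ck_on_add Ck_on_compose[OF U2 cU2 N(1,3)] Ck_on_linear[OF _ b\<pi>] U2) (auto simp: U2_def)
  obtain f' where f': "\<And>x. x \<in> U2 \<Longrightarrow> (\<Psi> has_derivative blinfun_apply (f' x)) (at x)"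
      "\<And>x. x \<in> U2 \<Longrightarrow> blinfun_apply (f' x) = frechet_derivative \<Psi> (at x)" "continuous_on U2 f'"
    using Ck_on_1_blinfun[OF \<Psi>1] by blast
  have "(\<Psi> has_derivative (\<lambda>v. v)) (at 0)"
  proof -
    have "(aff has_derivative (\<lambda>v. 0 + S v)) (at 0)"
      unfolding aff_def by (intro has_derivative_add has_derivative_const bounded_linear_imp_has_derivative bS)
    then have "(aff has_derivative S) (at 0)" by simp
    from has_derivative_compose[OF this, of \<xi> E] DE(2)
    have "(c has_derivative (\<lambda>v. E (S v))) (at 0)" by (simp add: c_def[abs_def] aff0)
    from has_derivative_compose[OF this, of \<theta> \<theta>'] \<theta>'
    have "((\<lambda>x. \<theta> (c x)) has_derivative (\<lambda>v. J (S v))) (at 0)" by (simp add: c0 J_def)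
    then have "(\<Psi> has_derivative (\<lambda>v. J (S v) + (v - \<pi> v))) (at 0)"
      unfolding \<Psi>_def by (intro has_derivative_add bounded_linear_imp_has_derivative b\<pi>)
    then show ?thesis by (simp add: JS)
  qed
  with f'(1)[OF zU2] have "blinfun_apply (f' 0) = (\<lambda>v. v)" by (rule has_derivative_unique)
  then have "id_blinfun o\<^sub>L f' 0 = id_blinfun" by (auto intro!: blinfun_eqI)
  from inverse_function_theorem[OF U2 f'(1,3) zU2 this]
  obtain A B \<Psi>' g' where AB: "open A" "A \<subseteq> U2" "0 \<in> A" "open B" "homeomorphism A B \<Psi> \<Psi>'"
    and g': "\<And>y. y \<in> B \<Longrightarrow> (\<Psi>' has_derivative (g' y)) (at y)"
     "\<And>y. y \<in> B \<Longrightarrow> g' y = inv (blinfun_apply (f'(\<Psi>' y)))" "\<And>y. y \<in> B \<Longrightarrow> bij (blinfun_apply (f'(\<Psi>' y)))"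
    by metis
  define \<kappa> where "\<kappa> q = J (\<psi> q - \<psi> p)" for q
  have "continuous_on W \<kappa>"
    unfolding \<kappa>_def using Ck_on_imp_continuous[OF a(4)] linJ
    by (intro continuous_on_compose2[OF linear_continuous_on[of J UNIV]] continuous_intros) (auto simp: linear_conv_bounded_linear)
  then have Q: "open (W \<inter> \<kappa> -` A)" using a(1) AB(1) by (rule continuous_open_preimage)
  show thesis
  proof (rule that[of A B \<Psi> \<Psi>' c "W \<inter> \<kappa> -` A"])
    fix y assume y: "y \<in> B"
    then have "\<Psi>' y \<in> U2" using AB unfolding homeomorphism_def by blast
    then show "\<exists>E. (\<Psi>' has_derivative E) (at y) \<and>
        (\<forall>v. E (frechet_derivative \<Psi> (at (\<Psi>' y)) v) = v) \<and> (\<forall>v. frechet_derivative \<Psi> (at (\<Psi>' y)) (E v) = v)"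
      using g'[OF y] f'(2)[of "\<Psi>' y"] by (intro exI[of _ "g' y"]) (simp add: bij_is_inj bij_is_surj surj_f_inv_f)
  next
    show "c ` A \<subseteq> N" using AB(2) by (auto simp: U2_def)
    show "Ck_on 1 \<Psi> A" using \<Psi>1 AB(2) by (rule Ck_on_subset)
    show "Ck_on 1 c A" using cU2 AB(2) by (rule Ck_on_subset)
    show "p \<in> W \<inter> \<kappa> -` A" using \<psi>(1) AB(3) linear_0[OF linJ] by (simp add: \<kappa>_def)
    fix x assume x: "x \<in> A" "\<pi> x = x"
    then have "aff x \<in> V \<inter> L" using AB(2) \<psi>p SL \<psi>(3) by (auto simp: U2_def U1_def aff_def subspace_add)
    then have "aff x \<in> \<psi> ` (M \<inter> W)" using flat by simp
    then show "c x \<in> M" unfolding c_def using \<xi>\<psi> by auto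
  next
    fix q assume q: "q \<in> M \<inter> (W \<inter> \<kappa> -` A)"
    then have "\<psi> q \<in> L" using flat by blast
    then have l: "\<psi> q - \<psi> p \<in> L" using \<psi>p \<psi>(3) by (simp add: subspace_diff)
    then have "\<kappa> q \<in> range \<pi>" unfolding \<kappa>_def using rangeJ by blast
    then have 1: "\<pi> (\<kappa> q) = \<kappa> q" using \<pi>(2) by auto
    then have "S (\<kappa> q) = \<psi> q - \<psi> p" using g(3)[OF l] by (simp add: S_def \<kappa>_def)
    then have "c (\<kappa> q) = q" using q by (simp add: c_def aff_def \<xi>\<psi>)
    then show "\<exists>x\<in>A. \<pi> x = x \<and> c x = q" using 1 q by blast
  qed (use AB c0 Q \<Psi>_def in auto)
qed

section \<open>Holomorphic functions of several variables\<close>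

definition complex_linear :: "(complex ^ 'N \<Rightarrow> complex) \<Rightarrow> bool" where
  "complex_linear f \<longleftrightarrow> linear f \<and> (\<forall>c v. f (c *s v) = c * f v)"

lemma bounded_linear_smult_left: "bounded_linear (\<lambda>c::complex. c *s (e::complex^'N))"
  apply (simp add: linear_conv_bounded_linear[symmetric])
  apply (rule linearI)
   apply (auto simp: vec_eq_iff algebra_simps)
  done

lemma holomorphic_fun_onI:
  assumes "\<And>z. z \<in> S \<Longrightarrow> \<exists>D. (f has_derivative D) (at z) \<and> (\<forall>c v. D (c *s v) = c * D v)"
  shows "holomorphic_fun_on f S"
  using assms by (simp add: holomorphic_fun_on_def)

lemma holomorphic_fun_on_line:
  assumes "holomorphic_fun_on f S" "z \<in> S"
  shows "((\<lambda>u. f (z + u *s v)) has_field_derivative frechet_derivative f (at z) v) (at 0)"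
proof -
  obtain D where D: "(f has_derivative D) (at z)" "\<And>c v. D (c *s v) = c * D v"
    using assms by (auto simp: holomorphic_fun_on_def)
  have "((\<lambda>u. z + u *s v) has_derivative (\<lambda>u. 0 + u *s v)) (at 0)"
    by (intro derivative_intros bounded_linear_imp_has_derivative bounded_linear_smult_left)
  then have "((\<lambda>u. f (z + u *s v)) has_derivative (\<lambda>u. D (u *s v))) (at 0)"
    using has_derivative_compose[of "\<lambda>u. z + u *s v" "\<lambda>u. 0 + u *s v" 0 UNIV f D] D(1)
    by simp
  moreover have "D = frechet_derivative f (at z)"
    using D(1) frechet_derivative_at by blast
  moreover have "(\<lambda>u. D (u *s v)) = (*) (D v)"
    by (simp add: fun_eq_iff D(2) mult.commute)
  ultimately show ?thesis
    by (simp add: has_field_derivative_def)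
qed

lemma frechet_derivative_holomorphic_smult:
  assumes "holomorphic_fun_on f S" "z \<in> S"
  shows "f differentiable (at z)" "frechet_derivative f (at z) (c *s v) = c * frechet_derivative f (at z) v"
  using assms frechet_derivative_at unfolding holomorphic_fun_on_def differentiable_def by metis+

lemma holomorphic_on_line:
  assumes "holomorphic_fun_on f S" "\<And>u. u \<in> A \<Longrightarrow> z + u *s v \<in> S"
  shows "(\<lambda>u. f (z + u *s v)) holomorphic_on A"
proof -
  have "\<exists>d. ((\<lambda>u. f (z + u *s v)) has_field_derivative d) (at u)" if "u \<in> A" for u
  proof -
    have "((\<lambda>h. f ((z + u *s v) + h *s v)) has_field_derivative frechet_derivative f (at (z + u *s v)) v) (at 0)"
      by (rule holomorphic_fun_on_line[OF assms(1)]) (use assms that in auto)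
    then have "((\<lambda>h. f (z + (h + u) *s v)) has_field_derivative frechet_derivative f (at (z + u *s v)) v) (at 0)"
      by (simp add: algebra_simps vec.scale_left_distrib)
    then show ?thesis
      using DERIV_shift[of "\<lambda>h. f (z + h *s v)" _ 0 u] by auto
  qed
  then show ?thesis
    unfolding holomorphic_on_def field_differentiable_def
    by (meson has_field_derivative_at_within)
qed

lemma norm_smult: "norm (c *s (v::complex^'N)) = norm c * norm v"
  by (simp add: norm_vec_def L2_set_def norm_mult power_mult_distrib real_sqrt_mult flip: sum_distrib_left)

text \<open>By Cauchy's inequality a directional derivative is controlled by the values of the function on a small
  disc, and these depend uniformly continuously on the point and the parameter.\<close>

lemma continuous_on_partial_derivative:
  fixes k :: "complex^'N \<Rightarrow> 'p::metric_space \<Rightarrow> complex"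
  assumes S: "open S" and T: "compact T"
    and hol: "\<And>t. t \<in> T \<Longrightarrow> holomorphic_fun_on (\<lambda>z. k z t) S"
    and cont: "continuous_on (S \<times> T) (\<lambda>(z,t). k z t)"
  shows "continuous_on (S \<times> T) (\<lambda>(z,t). frechet_derivative (\<lambda>z. k z t) (at z) v)"
  unfolding continuous_on_iff
proof (intro ballI allI impI)
  fix x and e :: real assume "x \<in> S \<times> T" and e: "e > 0"
  then obtain z t where x: "x = (z, t)" and z: "z \<in> S" and t: "t \<in> T" by blast
  obtain R where R: "R > 0" "cball z R \<subseteq> S"
    using S z open_contains_cball by blast
  define r where "r = R / (2 * (norm v + 1))"
  have r: "r > 0" "r * norm v \<le> R / 2"
  proof -
    have "norm v + 1 > 0" by (smt (verit) norm_ge_zero)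
    then show "r > 0" "r * norm v \<le> R / 2"
      using R by (auto simp: r_def field_simps)
  qed
  have "compact (cball z R \<times> T)" using T by (simp add: compact_Times)
  moreover have "continuous_on (cball z R \<times> T) (\<lambda>(z,t). k z t)"
    by (rule continuous_on_subset[OF cont]) (use R in auto)
  ultimately have "uniformly_continuous_on (cball z R \<times> T) (\<lambda>(z,t). k z t)"
    using compact_uniformly_continuous by blast
  then obtain d where d: "d > 0"
    "\<And>x y. x \<in> cball z R \<times> T \<Longrightarrow> y \<in> cball z R \<times> T \<Longrightarrow> dist y x < d \<Longrightarrow>
      dist ((\<lambda>(z,t). k z t) y) ((\<lambda>(z,t). k z t) x) < e * r / 2"
    unfolding uniformly_continuous_on_def using e r by (metis half_gt_zero mult_pos_pos)
  show "\<exists>d>0. \<forall>x'\<in>S \<times> T. dist x' x < d \<longrightarrow>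
      dist (case x' of (z, t) \<Rightarrow> frechet_derivative (\<lambda>z. k z t) (at z) v)
           (case x of (z, t) \<Rightarrow> frechet_derivative (\<lambda>z. k z t) (at z) v) < e"
    unfolding x
  proof (intro exI[of _ "min d (R/2)"] conjI ballI impI; clarsimp simp: d R)
    fix z' t' assume z': "z' \<in> S" and t': "t' \<in> T" and dd: "dist (z', t') (z, t) < d"
      "dist (z', t') (z, t) * 2 < R"
    have dz: "dist z' z < R / 2"
      using dd(2) dist_fst_le[of "(z',t')" "(z,t)"] by simp
    have in1: "z + u *s v \<in> cball z R" and in2: "z' + u *s v \<in> cball z R" if "norm u \<le> r" for u
    proof -
      have *: "norm (u *s v) \<le> R / 2"
        using mult_right_mono[OF that norm_ge_zero[of v]] r(2) unfolding norm_smult by linarith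
      then show "z + u *s v \<in> cball z R" using R by (simp add: dist_norm)
      have "dist z (z' + u *s v) \<le> dist z z' + dist z' (z' + u *s v)"
        by (rule dist_triangle)
      also have "dist z' (z' + u *s v) = norm (u *s v)" by (simp add: dist_norm)
      finally show "z' + u *s v \<in> cball z R" using * dz by (simp add: dist_commute)
    qed
    define F where "F u = k (z' + u *s v) t' - k (z + u *s v) t" for u
    have ho1: "(\<lambda>u. k (z' + u *s v) t') holomorphic_on cball 0 r"
      by (rule holomorphic_on_line[OF hol[OF t']], rule subsetD[OF R(2)], rule in2) simp
    have ho2: "(\<lambda>u. k (z + u *s v) t) holomorphic_on cball 0 r"
      by (rule holomorphic_on_line[OF hol[OF t]], rule subsetD[OF R(2)], rule in1) simp
    have hF: "F holomorphic_on cball 0 r"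
      unfolding F_def by (intro holomorphic_on_diff ho1 ho2)
    have "norm ((deriv ^^ 1) F 0) \<le> fact 1 * (e * r / 2) / r ^ 1"
    proof (rule Cauchy_inequality)
      show "F holomorphic_on ball 0 r" using hF holomorphic_on_subset ball_subset_cball by blast
      show "continuous_on (cball 0 r) F" using hF holomorphic_on_imp_continuous_on by blast
      show "0 < r" by fact
      fix u :: complex assume "norm (0 - u) = r"
      then have u: "norm u \<le> r" by simp
      have "dist (z' + u *s v, t') (z + u *s v, t) = dist (z',t') (z,t)"
        by (simp add: dist_Pair_Pair)
      then show "norm (F u) \<le> e * r / 2"
        using d(2)[of "(z + u *s v, t)" "(z' + u *s v, t')"] in1[OF u] in2[OF u] t t' dd
        by (simp add: F_def dist_norm)
    qed
    moreover have "(F has_field_derivative (frechet_derivative (\<lambda>z. k z t') (at z') v - frechet_derivative (\<lambda>z. k z t) (at z) v)) (at 0)"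
      unfolding F_def
      using holomorphic_fun_on_line[OF hol[OF t'] z'] holomorphic_fun_on_line[OF hol[OF t] z]
      by (intro derivative_intros) auto
    ultimately have "norm (frechet_derivative (\<lambda>z. k z t') (at z') v - frechet_derivative (\<lambda>z. k z t) (at z) v) \<le> e / 2"
      using r by (simp add: DERIV_imp_deriv)
    then show "dist (frechet_derivative (\<lambda>z. k z t') (at z') v) (frechet_derivative (\<lambda>z. k z t) (at z) v) < e"
      using e by (simp add: dist_norm)
  qed
qed

text \<open>Differentiation under the integral sign is legitimate because the derivative of the integrand
  is jointly continuous, and it preserves complex linearity of the derivative.\<close>

lemma holomorphic_integral:
  fixes k :: "complex^'N \<Rightarrow> real \<Rightarrow> complex"
  assumes S: "open S" 
    and hol: "\<And>t. t \<in> {0..1} \<Longrightarrow> holomorphic_fun_on (\<lambda>z. k z t) S"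
    and cont: "continuous_on (S \<times> {0..1}) (\<lambda>(z,t). k z t)"
  shows "holomorphic_fun_on (\<lambda>z. integral {0..1} (k z)) S"
proof (rule holomorphic_fun_onI)
  fix z assume z: "z \<in> S"
  obtain R where R: "R > 0" "ball z R \<subseteq> S"
    using S z open_contains_ball by blast
  define K where "K z t = Blinfun (frechet_derivative (\<lambda>z. k z t) (at z))" for z t
  have der: "((\<lambda>z. k z t) has_derivative blinfun_apply (K z t)) (at z)" if "z \<in> S" "t \<in> {0..1}" for z t
  proof -
    have "((\<lambda>z. k z t) has_derivative frechet_derivative (\<lambda>z. k z t) (at z)) (at z)"
      using frechet_derivative_holomorphic_smult(1)[OF hol[OF that(2)] that(1)]
      by (simp add: frechet_derivative_works)
    then show ?thesis
      unfolding K_def by (metis bounded_linear_Blinfun_apply has_derivative_bounded_linear)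
  qed
  have Kap: "blinfun_apply (K z t) = frechet_derivative (\<lambda>z. k z t) (at z)" if "z \<in> S" "t \<in> {0..1}" for z t
    using der[OF that] frechet_derivative_at by blast
  have contK: "continuous_on (S \<times> {0..1}) (\<lambda>(z,t). K z t)"
  proof (rule continuous_on_blinfun_componentwise)
    fix i :: "complex^'N"
    have "continuous_on (S \<times> {0..1}) (\<lambda>(z,t). frechet_derivative (\<lambda>z. k z t) (at z) i)"
      by (rule continuous_on_partial_derivative[OF S _ hol cont]) auto
    then show "continuous_on (S \<times> {0..1}) (\<lambda>x. blinfun_apply (case x of (z, t) \<Rightarrow> K z t) i)"
      by (rule continuous_on_eq) (auto simp: Kap)
  qed
  have "((\<lambda>x. integral (cbox 0 1) (k x)) has_derivative integral (cbox 0 1) (K z)) (at z within ball z R)"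
  proof (rule leibniz_rule)
    fix x and t :: real assume "x \<in> ball z R" "t \<in> cbox 0 1"
    then show "((\<lambda>x. k x t) has_derivative blinfun_apply (K x t)) (at x within ball z R)"
      using R by (intro has_derivative_at_withinI[OF der]) auto
  next
    fix x assume "x \<in> ball z R"
    then show "k x integrable_on cbox 0 1"
      by (intro integrable_continuous continuous_on_compose2[OF cont, where f="\<lambda>t. (x,t)", simplified] continuous_intros)
        (use R in auto)
  next
    show "continuous_on (ball z R \<times> cbox 0 1) (\<lambda>(x, t). K x t)"
      by (rule continuous_on_subset[OF contK]) (use R in auto)
  qed (use R(1) in simp_all)
  then have "((\<lambda>x. integral {0..1} (k x)) has_derivative integral {0..1} (K z)) (at z)"
    using at_within_open[of z "ball z R"] R(1) by (metis box_real(2) centre_in_ball open_ball)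
  moreover have "blinfun_apply (integral {0..1} (K z)) v = integral {0..1} (\<lambda>t. frechet_derivative (\<lambda>z. k z t) (at z) v)" for v
  proof -
    have "K z integrable_on {0..1}"
      by (intro integrable_continuous_real continuous_on_compose2[OF contK, where f="\<lambda>t. (z,t)", simplified] continuous_intros)
       (use z in auto)
    then have "blinfun_apply (integral {0..1} (K z)) v = integral {0..1} (\<lambda>t. blinfun_apply (K z t) v)"
      by (rule blinfun_apply_integral)
    also have "\<dots> = integral {0..1} (\<lambda>t. frechet_derivative (\<lambda>z. k z t) (at z) v)"
      by (rule integral_cong) (simp add: Kap z)
    finally show ?thesis .
  qed
  moreover have "integral {0..1} (\<lambda>t. frechet_derivative (\<lambda>z. k z t) (at z) (c *s v)) =
    c * integral {0..1} (\<lambda>t. frechet_derivative (\<lambda>z. k z t) (at z) v)" for c v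
  proof -
    have "integral {0..1} (\<lambda>t. frechet_derivative (\<lambda>z. k z t) (at z) (c *s v)) =
       integral {0..1} (\<lambda>t. c * frechet_derivative (\<lambda>z. k z t) (at z) v)"
      by (rule integral_cong) (use frechet_derivative_holomorphic_smult(2)[OF hol z] in auto)
    then show ?thesis by simp
  qed
  ultimately show "\<exists>D. ((\<lambda>z. integral {0..1} (k z)) has_derivative D) (at z) \<and> (\<forall>c v. D (c *s v) = c * D v)"
    by (intro exI[of _ "blinfun_apply (integral {0..1} (K z))"]) auto
qed

lemma holomorphic_fun_on_cong:
  assumes "open S" "\<And>z. z \<in> S \<Longrightarrow> f z = g z" "holomorphic_fun_on f S"
  shows "holomorphic_fun_on g S"
proof (rule holomorphic_fun_onI)
  fix z assume z: "z \<in> S"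
  from bspec[OF assms(3)[unfolded holomorphic_fun_on_def] this]
  obtain D where D: "(f has_derivative D) (at z)" "\<forall>c v. D (c *s v) = c * D v"
    by blast
  have "(g has_derivative D) (at z)"
    by (rule has_derivative_transform_within_open[OF D(1) assms(1) z assms(2)])
  with D(2) show "\<exists>D. (g has_derivative D) (at z) \<and> (\<forall>c v. D (c *s v) = c * D v)" by blast
qed

section \<open>Holomorphic continuation at a concave edge\<close>

text \<open>To first order at \<open>p\<close>, the complement of \<open>\<Omega>\<close> lies in \<open>{l1 \<le> 0} \<inter> {l2 \<le> 0}\<close>. For linearly
  independent \<open>l1\<close> and \<open>l2\<close> this says that \<open>\<Omega>\<close> has a concave edge at \<open>p\<close>.\<close>

definition outer_wedge :: "'a::real_normed_vector set \<Rightarrow> 'a \<Rightarrow> ('a \<Rightarrow> real) \<Rightarrow> ('a \<Rightarrow> real) \<Rightarrow> bool" where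
  "outer_wedge \<Omega> p l1 l2 \<longleftrightarrow>
     (\<forall>\<eta>>0. \<exists>\<delta>>0. \<forall>z. norm (z - p) < \<delta> \<and> z \<notin> \<Omega> \<longrightarrow>
        l1 (z - p) \<le> \<eta> * norm (z - p) \<and> l2 (z - p) \<le> \<eta> * norm (z - p))"

text \<open>The set \<open>M\<close> lies in the complement of \<open>\<Omega>\<close>, so its tangent vectors satisfy the limiting inequalities.\<close>

lemma outer_wedge_tangent:
  fixes l1 l2 :: "'a::euclidean_space \<Rightarrow> real"
  assumes w: "outer_wedge \<Omega> p l1 l2" and l: "linear l1" "linear l2"
    and M: "M \<inter> \<Omega> = {}" and v: "v \<in> tangent_cone M p"
  shows "l1 v \<le> 0" "l2 v \<le> 0"
proof -
  obtain x t where x: "\<And>k. x k \<in> M" "\<And>k. (t k::real) > 0" "x \<longlonglongrightarrow> p" "(\<lambda>k. t k *\<^sub>R (x k - p)) \<longlonglongrightarrow> v"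
    using v by (auto simp: tangent_cone_def)
  have main: "l v \<le> 0" if l: "linear l" and
    w: "\<And>\<eta>. \<eta> > 0 \<Longrightarrow> \<exists>\<delta>>0. \<forall>z. norm (z - p) < \<delta> \<and> z \<notin> \<Omega> \<longrightarrow> l (z - p) \<le> \<eta> * norm (z - p)" for l
  proof (rule ccontr)
    assume "\<not> l v \<le> 0"
    then have pos: "l v > 0" by simp
    have nv: "norm v + 1 > 0" by (simp add: add_nonneg_pos)
    define \<eta> where "\<eta> = l v / (2 * (norm v + 1))"
    have \<eta>: "\<eta> > 0" using pos nv by (simp add: \<eta>_def)
    obtain \<delta> where \<delta>: "\<delta> > 0" "\<And>z. norm (z - p) < \<delta> \<and> z \<notin> \<Omega> \<Longrightarrow> l (z - p) \<le> \<eta> * norm (z - p)"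
      using w[OF \<eta>] by blast
    have "eventually (\<lambda>k. dist (x k) p < \<delta>) sequentially" by (rule tendstoD[OF x(3) \<delta>(1)])
    then have ev: "eventually (\<lambda>k. l (t k *\<^sub>R (x k - p)) \<le> \<eta> * norm (t k *\<^sub>R (x k - p))) sequentially"
    proof eventually_elim
      case (elim k)
      have "x k \<notin> \<Omega>" using M x(1)[of k] by blast
      then have "l (x k - p) \<le> \<eta> * norm (x k - p)" using \<delta>(2)[of "x k"] elim by (simp add: dist_norm)
      then have "t k * l (x k - p) \<le> t k * (\<eta> * norm (x k - p))" using x(2)[of k] by (intro mult_left_mono) auto
      then show ?case
        unfolding linear_scale[OF l] norm_scaleR using x(2)[of k] by (simp add: mult.left_commute)
    qed
    have "bounded_linear l" using l by (simp add: linear_conv_bounded_linear)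
    then have l1: "(\<lambda>k. l (t k *\<^sub>R (x k - p))) \<longlonglongrightarrow> l v" by (rule bounded_linear.tendsto[OF _ x(4)])
    have l2: "(\<lambda>k. \<eta> * norm (t k *\<^sub>R (x k - p))) \<longlonglongrightarrow> \<eta> * norm v"
      by (intro tendsto_mult tendsto_const tendsto_norm x(4))
    have "l v \<le> \<eta> * norm v" by (rule tendsto_le[OF sequentially_bot l2 l1 ev])
    also have "\<dots> \<le> \<eta> * (norm v + 1)" using \<eta> by simp
    also have "\<dots> = l v / 2"
    proof -
      have "X / (2 * N) * N = X / 2" if "N > 0" for X N :: real using that by simp
      from this[OF nv] show ?thesis unfolding \<eta>_def .
    qed
    finally show False using pos by simp
  qed
  show "l1 v \<le> 0" by (rule main[OF l(1)]) (use w in \<open>unfold outer_wedge_def, blast\<close>)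
  show "l2 v \<le> 0" by (rule main[OF l(2)]) (use w in \<open>unfold outer_wedge_def, blast\<close>)
qed

text \<open>The complement is the projection of a closed set along the compact factor \<open>K\<close>.\<close>

lemma open_Collect_ball_compact:
  fixes F :: "'a::euclidean_space \<Rightarrow> 'b::euclidean_space \<Rightarrow> 'c::euclidean_space"
  assumes "compact K" "open S" "continuous_on (K \<times> UNIV) (\<lambda>(x,z). F x z)"
  shows "open {z. \<forall>x\<in>K. F x z \<in> S}"
proof -
  have "closedin (top_of_set (K \<times> UNIV)) ((K \<times> UNIV) \<inter> (\<lambda>(x,z). F x z) -` (- S))"
    using assms by (intro continuous_closedin_preimage) auto
  from closedin_compact_projection[OF assms(1) this]
  have "closedin (top_of_set UNIV) {z. \<exists>x. x \<in> K \<and> (x, z) \<in> (K \<times> UNIV) \<inter> (\<lambda>(x,z). F x z) -` (- S)}" .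
  moreover have "{z. \<exists>x. x \<in> K \<and> (x, z) \<in> (K \<times> UNIV) \<inter> (\<lambda>(x,z). F x z) -` (- S)} = - {z. \<forall>x\<in>K. F x z \<in> S}"
    by auto
  ultimately show ?thesis
    by (simp add: closed_def)
qed

lemma holomorphic_fun_on_compose:
  assumes f: "holomorphic_fun_on f S" and z: "\<Phi> z \<in> S"
    and \<Phi>: "(\<Phi> has_derivative L) (at z)" "\<And>c v. L (c *s v) = c *s L v"
  shows "\<exists>D. ((\<lambda>z. f (\<Phi> z)) has_derivative D) (at z) \<and> (\<forall>c v. D (c *s v) = c * D v)"
proof -
  obtain D where D: "(f has_derivative D) (at (\<Phi> z))" "\<And>c v. D (c *s v) = c * D v"
    using f z by (auto simp: holomorphic_fun_on_def)
  then have "((\<lambda>z. f (\<Phi> z)) has_derivative (\<lambda>v. D (L v))) (at z)"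
    using has_derivative_compose[of \<Phi> L z UNIV f D] \<Phi> by simp
  then show ?thesis using D \<Phi> by auto
qed

lemma holomorphic_fun_on_mult:
  assumes "holomorphic_fun_on f S" "holomorphic_fun_on g S"
  shows "holomorphic_fun_on (\<lambda>z. f z * g z) S"
proof (rule holomorphic_fun_onI)
  fix z assume "z \<in> S"
  then obtain D E where "(f has_derivative D) (at z)" "\<And>c v. D (c *s v) = c * D v"
    "(g has_derivative E) (at z)" "\<And>c v. E (c *s v) = c * E v"
    using assms by (auto simp: holomorphic_fun_on_def) metis
  then show "\<exists>D. ((\<lambda>z. f z * g z) has_derivative D) (at z) \<and> (\<forall>c v. D (c *s v) = c * D v)"
    by (intro exI[of _ "\<lambda>h. f z * E h + D h * g z"]) (auto intro!: has_derivative_mult simp: distrib_left mult.assoc mult.left_commute)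
qed

lemma holomorphic_fun_on_inverse_linear:
  assumes "complex_linear l" "\<And>z. z \<in> S \<Longrightarrow> l (z - p) \<noteq> b"
  shows "holomorphic_fun_on (\<lambda>z. 1 / (b - l (z - p))) S"
proof (rule holomorphic_fun_onI)
  fix z assume z: "z \<in> S"
  have "(l has_derivative l) F" for F
    using assms by (simp add: complex_linear_def bounded_linear_imp_has_derivative linear_conv_bounded_linear)
  moreover have "((\<lambda>z. z - p) has_derivative (\<lambda>v. v)) (at z)"
    by (auto intro!: derivative_eq_intros)
  ultimately have "((\<lambda>z. l (z - p)) has_derivative l) (at z)"
    using has_derivative_compose[of "\<lambda>z. z - p" "\<lambda>v. v" z UNIV l l] by simp
  then have *: "((\<lambda>z. b - l (z - p)) has_derivative (\<lambda>v. - l v)) (at z)"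
    by (auto intro!: derivative_eq_intros)
  have "((\<lambda>z. inverse (b - l (z - p))) has_derivative (\<lambda>h. - (inverse (b - l (z - p)) * (- l h) * inverse (b - l (z - p))))) (at z)"
    by (rule Deriv.has_derivative_inverse[OF _ *]) (use assms z in force)
  then show "\<exists>D. ((\<lambda>z. 1 / (b - l (z - p))) has_derivative D) (at z) \<and> (\<forall>c v. D (c *s v) = c * D v)"
    using assms by (intro exI) (auto simp: inverse_eq_divide complex_linear_def)
qed

text \<open>The continuity principle for the discs \<open>P _ s\<close> described at the beginning. They are bent by the
  quadratic term because the complex lines \<open>z\<^sub>2 = s - z\<^sub>1\<close> would meet the limiting wedge for \<open>s = 0\<close> in a whole
  real line. On a disc of radius \<open>r\<close> the wedge is known up to an error proportional to \<open>r\<close>, which is why the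
  curvature is scaled with \<open>r\<close>. The map \<open>\<Phi> u z\<close> is the point with parameter \<open>u\<close> on the disc through \<open>z\<close>;
  it is holomorphic in \<open>z\<close>, so the Cauchy integrals over all these discs form a holomorphic function of \<open>z\<close>.\<close>

lemma not_domain_of_holomorphy_if_concave_edge:
  fixes \<Omega> :: "(complex^'N) set"
  assumes \<Omega>: "open \<Omega>" and p: "p \<notin> \<Omega>"
    and l: "complex_linear l1" "complex_linear l2"
    and e: "l1 e1 = 1" "l1 e2 = 0" "l2 e1 = 0" "l2 e2 = 1"
    and wedge: "outer_wedge \<Omega> p (\<lambda>z. Re (l1 z)) (\<lambda>z. Re (l2 z))"
  shows "\<not> domain_of_holomorphy \<Omega>"
proof -
  \<comment> \<open>All points of the discs have distance at most \<open>r * C\<close> from \<open>p\<close>; with the error \<open>1/(8*C)\<close> in the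
    wedge condition, both real forms are at most \<open>r/8\<close> at every point of a disc outside \<open>\<Omega>\<close>.\<close>
  define C where "C = norm e1 + 3 * norm e2 + 1"
  have C: "C > 0" by (simp add: C_def add_nonneg_pos)
  obtain \<delta> where \<delta>: "\<delta> > 0" "\<And>z. norm (z - p) < \<delta> \<Longrightarrow> z \<notin> \<Omega> \<Longrightarrow>
      Re (l1 (z - p)) \<le> 1/(8*C) * norm (z - p) \<and> Re (l2 (z - p)) \<le> 1/(8*C) * norm (z - p)"
    using wedge C unfolding outer_wedge_def by (metis divide_pos_pos mult_pos_pos zero_less_numeral zero_less_one)
  define r where "r = \<delta> / (2 * C)"
  have r: "r > 0" "r * C < \<delta>" using \<delta> C by (auto simp: r_def)
  define P where "P u s = p + u *s e1 + (- u - u\<^sup>2 / (2 * of_real r) + s) *s e2" for u s :: complex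
  have l_lin: "l1 (x + y) = l1 x + l1 y" "l1 (c *s x) = c * l1 x" "l1 (x - y) = l1 x - l1 y"
     "l2 (x + y) = l2 x + l2 y" "l2 (c *s x) = c * l2 x" "l2 (x - y) = l2 x - l2 y" "l1 0 = 0" "l2 0 = 0" for x y c
    using l unfolding complex_linear_def by (auto simp: linear_add linear_diff linear_0)
  have lP: "l1 (P u s - p) = u" "l2 (P u s - p) = - u - u\<^sup>2 / (2 * of_real r) + s" for u s
    by (simp_all only: P_def l_lin e add_diff_cancel_left') simp_all
  have normP: "norm (P u s - p) \<le> r * C" if "norm u \<le> r" "norm s \<le> r" for u s
  proof -
    have "norm (u\<^sup>2 / (2 * of_real r)) \<le> r"
    proof -
      have "norm u ^ 2 \<le> r ^ 2" using that by (simp add: power_mono)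
      then have "norm (u\<^sup>2 / (2 * of_real r)) \<le> r^2 / (2 * r)"
        using r by (simp add: norm_divide norm_power divide_right_mono)
      also have "\<dots> \<le> r" using r by (simp add: power2_eq_square)
      finally show ?thesis .
    qed
    then have "norm (- u - u\<^sup>2 / (2 * of_real r) + s) \<le> 3 * r"
      using that norm_triangle_ineq[of "- u - u\<^sup>2 / (2 * of_real r)" s] norm_triangle_ineq4[of "-u" "u\<^sup>2 / (2 * of_real r)"]
      by simp
    then have "norm ((- u - u\<^sup>2 / (2 * of_real r) + s) *s e2) \<le> 3 * r * norm e2"
      by (simp only: norm_smult mult_right_mono norm_ge_zero)
    moreover have "norm (u *s e1) \<le> r * norm e1"
      using that by (simp add: norm_smult mult_right_mono)
    ultimately have "norm (P u s - p) \<le> r * norm e1 + 3 * r * norm e2"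
      using norm_triangle_ineq[of "u *s e1" "(- u - u\<^sup>2 / (2 * of_real r) + s) *s e2"]
      by (simp only: P_def add_diff_cancel_left' add.assoc[of p])
    also have "\<dots> \<le> r * C" using r by (simp add: C_def algebra_simps)
    finally show ?thesis .
  qed
  have P_in: "P u (of_real s) \<in> \<Omega>" if u: "norm u \<le> r" and s: "0 \<le> s" "s \<le> r" and alt: "norm u = r \<or> s = r" for u s
  proof (rule ccontr)
    assume "P u (of_real s) \<notin> \<Omega>"
    moreover have n: "norm (P u (of_real s) - p) \<le> r * C" using normP u s by simp
    ultimately have "Re u \<le> 1/(8*C) * norm (P u (of_real s) - p)"
       "Re (- u - u\<^sup>2 / (2 * of_real r) + of_real s) \<le> 1/(8*C) * norm (P u (of_real s) - p)"
      using \<delta>(2)[of "P u (of_real s)"] r lP[of u "of_real s"] by auto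
    moreover have "1/(8*C) * norm (P u (of_real s) - p) \<le> r / 8"
      using mult_left_mono[OF n, of "1/(8*C)"] C by simp
    ultimately have 1: "Re u \<le> r / 8" and "Re (- u - u\<^sup>2 / (2 * of_real r) + of_real s) \<le> r / 8" by linarith+
    moreover have "Re (u\<^sup>2 / (2 * of_real r)) = ((Re u)\<^sup>2 - (Im u)\<^sup>2) / (2 * r)"
      by (metis Re_divide_of_real Re_power2 of_real_mult of_real_numeral)
    ultimately have "- Re u - ((Re u)\<^sup>2 - (Im u)\<^sup>2) / (2 * r) + s \<le> r / 8" by simp
    then have "(- Re u - ((Re u)\<^sup>2 - (Im u)\<^sup>2) / (2 * r) + s) * (2 * r) \<le> r / 8 * (2 * r)"
      using r by (intro mult_right_mono) auto
    moreover have "(- Re u - ((Re u)\<^sup>2 - (Im u)\<^sup>2) / (2 * r) + s) * (2 * r)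
        = - 2 * r * Re u - (Re u)\<^sup>2 + (Im u)\<^sup>2 + 2 * r * s"
    proof -
      have "(- a - x / (2 * r) + s) * (2 * r) = - 2 * r * a - x + 2 * r * s" for a x
        using r by (simp add: field_simps)
      from this[of "Re u" "(Re u)\<^sup>2 - (Im u)\<^sup>2"] show ?thesis by simp
    qed
    ultimately have 2: "- 2 * r * Re u - (Re u)\<^sup>2 + (Im u)\<^sup>2 + 2 * r * s \<le> r\<^sup>2 / 4"
      by (simp add: power2_eq_square)
    have nu: "(Re u)\<^sup>2 + (Im u)\<^sup>2 = (norm u)\<^sup>2" by (simp add: cmod_power2)
    have "- r \<le> Re u" using abs_Re_le_cmod[of u] u by linarith
    have "- (r * Re u) - (Re u)\<^sup>2 \<ge> - (r\<^sup>2 / 8) - r\<^sup>2 / 64"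
    proof (cases "Re u \<le> 0")
      case True
      then have "(- Re u) * (r + Re u) \<ge> 0" using \<open>- r \<le> Re u\<close> by (intro mult_nonneg_nonneg) auto
      then have "0 \<le> - (r * Re u) - (Re u)\<^sup>2" by (simp add: algebra_simps power2_eq_square)
      then show ?thesis using zero_le_power2[of r] by linarith
    next
      case False
      then have "r * Re u \<le> r * (r / 8)" "(Re u)\<^sup>2 \<le> (r / 8)\<^sup>2"
        using 1 r by (auto intro: mult_left_mono power_mono)
      then show ?thesis by (simp add: power2_eq_square power_divide)
    qed
    note 3 = this
    have r2: "r\<^sup>2 > 0" using r by simp
    from alt show False
    proof
      assume "norm u = r"
      moreover have "2 * r * s \<ge> 0" using r s by simp
      ultimately show False using 2 3 nu r2 by (simp add: algebra_simps)
    next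
      assume "s = r"
      then have "2 * r * s = 2 * r\<^sup>2" by (simp add: power2_eq_square)
      moreover have "- (r * Re u) \<ge> - (r\<^sup>2 / 8)" using mult_left_mono[OF 1, of r] r by (simp add: power2_eq_square)
      moreover have "0 \<le> (Im u)\<^sup>2" by simp
      ultimately show False using 2 3 r2 by linarith
    qed
  qed
  define c where "c z = l1 (z - p)" for z
  define \<Phi> where "\<Phi> u z = z + (u - c z) *s e1 + (c z - u + ((c z)\<^sup>2 - u\<^sup>2) / (2 * of_real r)) *s e2" for u z
  have \<Phi>_self: "\<Phi> (c z) z = z" for z by (simp add: \<Phi>_def)
  have \<Phi>_P: "\<Phi> u (P v s) = P u s" for u v s
    unfolding \<Phi>_def c_def lP by (simp add: P_def vec_eq_iff algebra_simps diff_divide_distrib)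
  have cont_l: "continuous_on A l1" for A
    using l(1) by (simp add: complex_linear_def linear_continuous_on linear_conv_bounded_linear)
  have cont_c: "continuous_on A c" for A
    unfolding c_def by (rule continuous_on_compose2[OF cont_l[of UNIV]]) (auto intro!: continuous_intros)
  have cont_sm: "continuous_on A (\<lambda>x. g x *s (e::complex^'N))" if "continuous_on A g" for A :: "'x::topological_space set" and g e
    using bounded_linear.continuous_on[OF bounded_linear_smult_left that] .
  have cont\<Phi>: "continuous_on A (\<lambda>(u,z). \<Phi> u z)" for A
    unfolding \<Phi>_def split_beta 
    by (intro continuous_intros cont_sm continuous_on_compose2[OF cont_c[of UNIV]]) (use r in auto)
  have der_c: "(c has_derivative l1) (at z)" for z
  proof -
    have "(l1 has_derivative l1) F" for F
      using l by (simp add: complex_linear_def bounded_linear_imp_has_derivative linear_conv_bounded_linear)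
    moreover have "((\<lambda>z. z - p) has_derivative (\<lambda>v. v)) (at z)"
      by (auto intro!: derivative_eq_intros)
    ultimately show ?thesis
      using has_derivative_compose[of "\<lambda>z. z - p" "\<lambda>v. v" z UNIV l1 l1] by (simp add: c_def[abs_def])
  qed
  have der\<Phi>: "(\<Phi> u has_derivative (\<lambda>v. v + (- l1 v) *s e1 + (l1 v + (2 * c z * l1 v) / (2 * of_real r)) *s e2)) (at z)" for u z
  proof -
    have 1: "((\<lambda>z. u - c z) has_derivative (\<lambda>v. - l1 v)) (at z)"
      by (auto intro!: derivative_eq_intros der_c)
    have 2: "((\<lambda>z. c z - u + ((c z)\<^sup>2 - u\<^sup>2) / (2 * of_real r)) has_derivative
        (\<lambda>v. l1 v + (2 * c z * l1 v) / (2 * of_real r))) (at z)"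
      by (auto intro!: derivative_eq_intros der_c simp: power2_eq_square fun_eq_iff) (use r in \<open>simp add: field_simps\<close>)
    show ?thesis
      unfolding \<Phi>_def
      by (intro has_derivative_add bounded_linear.has_derivative[OF bounded_linear_smult_left] 1 2 has_derivative_ident)
  qed
  have \<Phi>_smult: "d *s v + (- l1 (d *s v)) *s e1 + (l1 (d *s v) + (2 * c z * l1 (d *s v)) / (2 * of_real r)) *s e2
      = d *s (v + (- l1 v) *s e1 + (l1 v + (2 * c z * l1 v) / (2 * of_real r)) *s e2)" for d v z
    by (simp add: l_lin vec_eq_iff field_simps)
  define S2 where "S2 = {z. norm (c z) < r} \<inter> {z. \<forall>u\<in>sphere 0 r. \<Phi> u z \<in> \<Omega>}"
  have "open {z. norm (c z) < r}"
    by (intro open_Collect_less continuous_intros cont_c)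
  then have S2: "open S2"
    unfolding S2_def by (intro open_Int open_Collect_ball_compact[OF _ \<Omega> cont\<Phi>]) auto
  \<comment> \<open>The set \<open>S2\<close> consists of the points in discs with boundary in \<open>\<Omega>\<close>; the segment of disc centres from
    \<open>p\<close> to \<open>p + r e2\<close> joins, inside it, the point \<open>p\<close> to a disc contained in \<open>\<Omega>\<close>.\<close>
  define \<Omega>2 where "\<Omega>2 = connected_component_set S2 p"
  define \<Omega>1 where "\<Omega>1 = \<Omega>2 \<inter> {z. \<forall>u\<in>cball 0 r. \<Phi> u z \<in> \<Omega>}"
  have \<Omega>2: "open \<Omega>2" "connected \<Omega>2" "\<Omega>2 \<subseteq> S2"
    using S2 by (auto simp: \<Omega>2_def open_connected_component connected_component_subset)
  have \<Omega>1: "open \<Omega>1"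
    unfolding \<Omega>1_def by (intro open_Int open_Collect_ball_compact[OF _ \<Omega> cont\<Phi>] \<Omega>2) auto
  have S2_P: "P 0 (of_real s) \<in> S2" if "0 \<le> s" "s \<le> r" for s
    using that P_in r by (auto simp: S2_def \<Phi>_P c_def lP)
  have seg: "closed_segment p (P 0 (of_real r)) \<subseteq> S2"
  proof
    fix z assume "z \<in> closed_segment p (P 0 (of_real r))"
    then obtain t where t: "0 \<le> t" "t \<le> 1" "z = (1 - t) *\<^sub>R p + t *\<^sub>R P 0 (of_real r)"
      by (auto simp: in_segment)
    then have "z = P 0 (of_real (t * r))"
      by (simp add: P_def vec_eq_iff scaleR_conv_of_real[where 'a=complex] algebra_simps)
    then show "z \<in> S2" using S2_P[of "t * r"] t r by (simp add: mult_left_le_one_le)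
  qed
  have "connected_component S2 p (P 0 (of_real r))"
    unfolding connected_component_def using seg
    by (intro exI[of _ "closed_segment p (P 0 (of_real r))"]) auto
  then have end_in: "P 0 (of_real r) \<in> \<Omega>1"
    using P_in r by (auto simp: \<Omega>1_def \<Omega>2_def \<Phi>_P)
  have p_in: "p \<in> \<Omega>2" using seg by (auto simp: \<Omega>2_def)
  have \<Omega>1_sub: "\<Omega>1 \<subseteq> \<Omega> \<inter> \<Omega>2"
  proof
    fix z assume z: "z \<in> \<Omega>1"
    then have "norm (c z) < r" using \<Omega>2 by (auto simp: \<Omega>1_def S2_def)
    then have "\<Phi> (c z) z \<in> \<Omega>" using z by (auto simp: \<Omega>1_def)
    then show "z \<in> \<Omega> \<inter> \<Omega>2" using z by (simp add: \<Phi>_self \<Omega>1_def)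
  qed
  have ext: "\<exists>g. holomorphic_fun_on g \<Omega>2 \<and> (\<forall>z\<in>\<Omega>1. g z = f z)" if f: "holomorphic_fun_on f \<Omega>" for f
  proof -
    define \<gamma> where "\<gamma> = circlepath 0 r"
    have \<gamma>n: "norm (\<gamma> t) = r" for t using r by (simp add: \<gamma>_def circlepath norm_mult)
    define k where "k z t = f (\<Phi> (\<gamma> t) z) * (1 / (\<gamma> t - l1 (z - p))) * \<gamma> t" for z t
    have ne: "l1 (z - p) \<noteq> \<gamma> t" if "z \<in> \<Omega>2" for z t
      using that \<Omega>2 \<gamma>n[of t] by (auto simp: S2_def c_def)
    have holk: "holomorphic_fun_on (\<lambda>z. k z t) \<Omega>2" for t
      unfolding k_def
    proof (intro holomorphic_fun_on_mult holomorphic_fun_on_inverse_linear l(1) ne)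
      show "holomorphic_fun_on (\<lambda>z. f (\<Phi> (\<gamma> t) z)) \<Omega>2"
      proof (rule holomorphic_fun_onI)
        fix z assume "z \<in> \<Omega>2"
        then have "\<Phi> (\<gamma> t) z \<in> \<Omega>" using \<Omega>2 \<gamma>n[of t] by (auto simp: S2_def)
        from holomorphic_fun_on_compose[OF f this der\<Phi> \<Phi>_smult]
        show "\<exists>D. ((\<lambda>z. f (\<Phi> (\<gamma> t) z)) has_derivative D) (at z) \<and> (\<forall>c v. D (c *s v) = c * D v)" .
      qed
      show "holomorphic_fun_on (\<lambda>z. \<gamma> t) \<Omega>2"
        by (rule holomorphic_fun_onI) (auto intro!: exI[of _ "\<lambda>h. 0"])
    qed
    have contf: "continuous_on \<Omega> f"
      by (meson f continuous_at_imp_continuous_on has_derivative_continuous holomorphic_fun_on_def)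
    have cont\<gamma>: "continuous_on A \<gamma>" for A
      unfolding \<gamma>_def circlepath by (intro continuous_intros)
    define A where "A = \<Omega>2 \<times> {0..1::real}"
    have c1: "continuous_on A (\<lambda>x. \<gamma> (snd x))"
      by (rule continuous_on_compose2[OF cont\<gamma>[of UNIV] continuous_on_snd[OF continuous_on_id]]) simp
    have "continuous_on A (\<lambda>x. (\<gamma> (snd x), fst x))"
      by (intro continuous_on_Pair c1 continuous_on_fst continuous_on_id)
    from continuous_on_compose2[OF cont\<Phi>[of UNIV] this]
    have c2: "continuous_on A (\<lambda>x. \<Phi> (\<gamma> (snd x)) (fst x))" by simp
    have c3: "continuous_on A (\<lambda>x. f (\<Phi> (\<gamma> (snd x)) (fst x)))"
    proof (rule continuous_on_compose2[OF contf c2], rule image_subsetI)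
      fix x assume "x \<in> A"
      then have "fst x \<in> S2" using \<Omega>2(3) by (auto simp: A_def)
      then show "\<Phi> (\<gamma> (snd x)) (fst x) \<in> \<Omega>"
        using \<gamma>n[of "snd x"] by (auto simp: S2_def)
    qed
    have c4: "continuous_on A (\<lambda>x. l1 (fst x - p))"
      by (rule continuous_on_compose2[OF cont_l[of UNIV]]) (auto intro!: continuous_intros)
    have n0: "\<gamma> (snd x) - l1 (fst x - p) \<noteq> 0" if "x \<in> A" for x
      using ne[of "fst x" "snd x"] that by (auto simp: A_def)
    have "continuous_on A (\<lambda>x. k (fst x) (snd x))"
      unfolding k_def
      by (intro continuous_on_mult continuous_on_divide continuous_on_diff c1 c3 c4 continuous_on_const)
        (use n0 in blast)
    then have contk: "continuous_on (\<Omega>2 \<times> {0..1}) (\<lambda>(z,t). k z t)"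
      by (simp add: split_beta A_def)
    have "integral {0..1} (k z) = f z" if z: "z \<in> \<Omega>1" for z
    proof -
      have cz: "norm (c z) < r" using z \<Omega>2 by (auto simp: \<Omega>1_def S2_def)
      have holo: "(\<lambda>u. f (\<Phi> u z)) holomorphic_on cball 0 r"
        unfolding holomorphic_on_def field_differentiable_def
      proof
        fix u assume "u \<in> cball (0::complex) r"
        then have "\<Phi> u z \<in> \<Omega>" using z by (auto simp: \<Omega>1_def)
        then obtain D where D: "(f has_derivative D) (at (\<Phi> u z))" "\<And>c v. D (c *s v) = c * D v"
          using f by (auto simp: holomorphic_fun_on_def)
        have "((\<lambda>u. \<Phi> u z) has_derivative (\<lambda>h. h *s (e1 + (- 1 - u / of_real r) *s e2))) (at u)"
        proof -
          have 1: "((\<lambda>u. u - c z) has_derivative (\<lambda>h. h)) (at u)"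
            by (auto intro!: derivative_eq_intros)
          have 2: "((\<lambda>u. c z - u + ((c z)\<^sup>2 - u\<^sup>2) / (2 * of_real r)) has_derivative
              (\<lambda>h. h * (- 1 - u / of_real r))) (at u)"
            using r by (auto intro!: derivative_eq_intros simp: power2_eq_square fun_eq_iff)
               (simp only: right_diff_distrib mult_minus1_right times_divide_eq_right)
          have "((\<lambda>u. \<Phi> u z) has_derivative (\<lambda>h. 0 + h *s e1 + (h * (- 1 - u / of_real r)) *s e2)) (at u)"
            unfolding \<Phi>_def
            by (intro has_derivative_add bounded_linear.has_derivative[OF bounded_linear_smult_left] 1 2 has_derivative_const)
          moreover have "(\<lambda>h. 0 + h *s e1 + (h * (- 1 - u / of_real r)) *s e2) = (\<lambda>h. h *s (e1 + (- 1 - u / of_real r) *s e2))"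
            by (simp add: fun_eq_iff vec_eq_iff algebra_simps)
          ultimately show ?thesis by simp
        qed
        from has_derivative_compose[OF this D(1)]
        have "((\<lambda>u. f (\<Phi> u z)) has_derivative (\<lambda>h. D (e1 + (- 1 - u / of_real r) *s e2) * h)) (at u)"
          by (simp only: D(2) mult.commute)
        then show "\<exists>f'. ((\<lambda>u. f (\<Phi> u z)) has_field_derivative f') (at u within cball 0 r)"
          unfolding has_field_derivative_def using has_derivative_at_withinI by blast
      qed
      have "((\<lambda>u. f (\<Phi> u z) / (u - c z)) has_contour_integral (2 * of_real pi * \<i> * f (\<Phi> (c z) z))) \<gamma>"
        unfolding \<gamma>_def by (rule Cauchy_integral_circlepath_simple[OF holo]) (use cz in simp)
      then have "((\<lambda>t. f (\<Phi> (\<gamma> t) z) / (\<gamma> t - c z) * vector_derivative \<gamma> (at t within {0..1})) has_integral (2 * of_real pi * \<i> * f z)) {0..1}"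
        by (simp add: has_contour_integral_def \<Phi>_self)
      then have "((\<lambda>t. (2 * of_real pi * \<i>) * k z t) has_integral (2 * of_real pi * \<i> * f z)) {0..1}"
      proof (rule has_integral_eq[rotated])
        fix t :: real assume "t \<in> {0..1}"
        then have "vector_derivative \<gamma> (at t within {0..1}) = 2 * of_real pi * \<i> * \<gamma> t"
          unfolding \<gamma>_def by (subst vector_derivative_circlepath01) (auto simp: circlepath)
        then show "f (\<Phi> (\<gamma> t) z) / (\<gamma> t - c z) * vector_derivative \<gamma> (at t within {0..1})
            = (2 * of_real pi * \<i>) * k z t"
          by (simp add: k_def c_def)
      qed
      from has_integral_mult_right[OF this, of "1 / (2 * of_real pi * \<i>)"]
      show ?thesis by (simp add: integral_unique)
    qed
    then show ?thesis
      using holomorphic_integral[OF \<Omega>2(1) holk contk] by blast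
  qed
  have "\<Omega>1 \<noteq> {}" "\<not> \<Omega>2 \<subseteq> \<Omega>" using end_in p_in p by auto
  then show ?thesis
    unfolding domain_of_holomorphy_def using \<Omega>1 \<Omega>1_sub \<Omega>2(1,2) ext by blast
qed

section \<open>Submanifolds with complex tangent hyperplanes\<close>

text \<open>The shear that subtracts \<open>\<gamma>\<close> from the coordinate \<open>j\<close> flattens the graph of \<open>\<gamma>\<close>. The function \<open>\<gamma>\<close> is
  given on the full space and is constant in the direction of the coordinate \<open>j\<close>.\<close>

lemma graph_complex_hypersurface:
  fixes \<gamma> :: "complex^'N \<Rightarrow> complex"
  assumes U: "open U" and \<gamma>: "holomorphic_fun_on \<gamma> U"
    and S: "p \<in> S" "open P" "p \<in> P" "S \<inter> P \<subseteq> U"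
    and indep: "\<And>z u. z \<in> U \<Longrightarrow> z + u *s axis j 1 \<in> U" "\<And>z u. z \<in> U \<Longrightarrow> \<gamma> (z + u *s axis j 1) = \<gamma> z"
    and graph: "\<And>z. z \<in> P \<Longrightarrow> z \<in> U \<Longrightarrow> z \<in> S \<longleftrightarrow> z $ j = \<gamma> z"
  shows "\<exists>W V \<phi> j. p \<in> W \<and> biholomorphic \<phi> W V \<and> \<phi> ` (S \<inter> W) = V \<inter> {z. z $ j = 0}"
proof -
  define e :: "complex^'N" where "e = axis j 1"
  define \<phi> where "\<phi> z = z - \<gamma> z *s e" for z
  define \<phi>' where "\<phi>' z = z + \<gamma> z *s e" for z
  define W where "W = P \<inter> U"
  define V where "V = U \<inter> \<phi>' -` P"
  have shift: "z + u *s e \<in> U" "\<gamma> (z + u *s e) = \<gamma> z" "z - u *s e \<in> U" "\<gamma> (z - u *s e) = \<gamma> z" if "z \<in> U" for z u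
    using indep(1)[OF that, of u] indep(2)[OF that, of u] indep(1)[OF that, of "- u"] indep(2)[OF that, of "- u"]
    by (simp_all add: e_def)
  have \<phi>\<phi>': "\<phi>' (\<phi> z) = z" "\<phi> z \<in> U" if "z \<in> U" for z
    using shift[OF that] by (auto simp: \<phi>_def \<phi>'_def)
  have \<phi>'\<phi>: "\<phi> (\<phi>' z) = z" "\<phi>' z \<in> U" if "z \<in> U" for z
    using shift[OF that] by (auto simp: \<phi>_def \<phi>'_def)
  have bij: "bij_betw \<phi> W V"
    by (rule bij_betwI[where g=\<phi>']) (auto simp: W_def V_def \<phi>\<phi>' \<phi>'\<phi>)
  have comp: "holomorphic_fun_on (\<lambda>z. z $ i + b * \<gamma> z) A" if "A \<subseteq> U" for A i b
  proof (rule holomorphic_fun_onI)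
    fix z assume "z \<in> A"
    then have "z \<in> U" using that by blast
    from bspec[OF \<gamma>[unfolded holomorphic_fun_on_def] this]
    obtain D where D: "(\<gamma> has_derivative D) (at z)" "\<And>c v. D (c *s v) = c * D v"
      by blast
    have "((\<lambda>z. z $ i + b * \<gamma> z) has_derivative (\<lambda>v. v $ i + b * D v)) (at z)"
      by (intro has_derivative_add bounded_linear_imp_has_derivative bounded_linear_vec_nth
        has_derivative_mult_right D)
    then show "\<exists>D. ((\<lambda>z. z $ i + b * \<gamma> z) has_derivative D) (at z) \<and> (\<forall>c v. D (c *s v) = c * D v)"
      using D(2) by (intro exI[of _ "\<lambda>v. v $ i + b * D v"]) (simp add: algebra_simps)
  qed
  have cont\<gamma>: "continuous_on U \<gamma>"
    using \<gamma> unfolding holomorphic_fun_on_def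
    by (meson continuous_at_imp_continuous_on has_derivative_continuous)
  have "continuous_on U \<phi>'"
    unfolding \<phi>'_def
    by (intro continuous_on_add continuous_on_id bounded_linear.continuous_on[OF bounded_linear_smult_left cont\<gamma>])
  then have oV: "open V"
    unfolding V_def using U S(2) by (rule continuous_open_preimage)
  have oW: "open W" using U S by (auto simp: W_def)
  have "holomorphic_map_on \<phi> W"
    unfolding holomorphic_map_on_def
  proof
    fix i
    have "holomorphic_fun_on (\<lambda>z. z $ i + (- (e $ i)) * \<gamma> z) W" by (rule comp) (simp add: W_def)
    then show "holomorphic_fun_on (\<lambda>z. \<phi> z $ i) W" by (simp add: \<phi>_def mult.commute)
  qed
  moreover have "holomorphic_map_on (inv_into W \<phi>) V"
    unfolding holomorphic_map_on_def
  proof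
    fix i
    have h: "holomorphic_fun_on (\<lambda>z. z $ i + e $ i * \<gamma> z) V" by (rule comp) (simp add: V_def)
    have "z $ i + e $ i * \<gamma> z = inv_into W \<phi> z $ i" if "z \<in> V" for z
    proof -
      have "\<phi>' z \<in> W" "\<phi> (\<phi>' z) = z" using that \<phi>'\<phi> by (auto simp: W_def V_def)
      then have "inv_into W \<phi> z = \<phi>' z" using bij by (metis bij_betw_inv_into_left)
      then show ?thesis by (simp add: \<phi>'_def mult.commute)
    qed
    from holomorphic_fun_on_cong[OF oV this h]
    show "holomorphic_fun_on (\<lambda>z. inv_into W \<phi> z $ i) V" .
  qed
  ultimately have "biholomorphic \<phi> W V" using bij oV oW by (simp add: biholomorphic_def)
  moreover have "\<phi> ` (S \<inter> W) = V \<inter> {z. z $ j = 0}"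
  proof (intro equalityI subsetI)
    fix w assume "w \<in> \<phi> ` (S \<inter> W)"
    then obtain z where z: "z \<in> S" "z \<in> W" "w = \<phi> z" by blast
    then have "z $ j = \<gamma> z" using graph by (auto simp: W_def)
    then show "w \<in> V \<inter> {z. z $ j = 0}" using z bij_betwE[OF bij] by (auto simp: \<phi>_def e_def)
  next
    fix w assume w: "w \<in> V \<inter> {z. z $ j = 0}"
    then have "w \<in> U" by (auto simp: V_def)
    then have "\<gamma> (\<phi>' w) = \<gamma> w" using shift by (auto simp: \<phi>'_def)
    moreover have "\<phi>' w $ j = \<gamma> w" using w by (simp add: \<phi>'_def e_def)
    moreover have "\<phi>' w \<in> W" using w \<phi>'\<phi>[OF \<open>w \<in> U\<close>] by (auto simp: V_def W_def)
    ultimately have "\<phi>' w \<in> S \<inter> W" using graph by (auto simp: W_def)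
    then show "w \<in> \<phi> ` (S \<inter> W)" using \<phi>'\<phi>[OF \<open>w \<in> U\<close>] by (metis imageI)
  qed
  moreover have "p \<in> W" using S by (auto simp: W_def)
  ultimately show ?thesis by blast
qed

text \<open>Near \<open>p\<close> the submanifold is a graph over a coordinate hyperplane \<open>{z $ j = 0}\<close> that is transversal to
  the kernel of the form at \<open>p\<close>. At every point of the graph the derivative \<open>D\<close> of the graph function satisfies
  \<open>g (v + D v *s e) = 0\<close> for a nonzero complex linear form \<open>g\<close>, which determines \<open>D\<close> and
  makes it complex linear.\<close>

lemma complex_hypersurface_if_tangents_complex:
  fixes M :: "(complex^'N) set"
  assumes M: "Ck_submanifold 1 (DIM(complex^'N) - 2) M" and N: "open N"
    and tan: "\<And>p. p \<in> M \<inter> N \<Longrightarrow> \<exists>f. complex_linear f \<and> (\<exists>z. f z \<noteq> 0) \<and> (\<forall>v\<in>tangent_cone M p. f v = 0)"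
  shows "complex_hypersurface (M \<inter> N)"
  unfolding complex_hypersurface_def
proof
  fix p assume p: "p \<in> M \<inter> N"
  obtain f where f: "complex_linear f" "\<exists>z. f z \<noteq> 0" "\<And>v. v \<in> tangent_cone M p \<Longrightarrow> f v = 0"
    using tan[OF p] by blast
  have f_lin: "f (x + y) = f x + f y" "f (c *s x) = c * f x" "f 0 = 0" if "complex_linear f" for f :: "complex^'N \<Rightarrow> complex" and x y c
    using that unfolding complex_linear_def by (auto simp: linear_add linear_0)
  have "\<exists>j. f (axis j 1) \<noteq> 0"
  proof (rule ccontr)
    assume "\<not> ?thesis"
    then have "f (x $ i *s axis i 1) = 0" for x i using f_lin[OF f(1)] by simp
    moreover have "f (\<Sum>i\<in>UNIV. x $ i *s axis i 1) = (\<Sum>i\<in>UNIV. f (x $ i *s axis i 1))" for x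
      using f(1) by (intro linear_sum) (simp add: complex_linear_def)
    ultimately have "f x = 0" for x by (simp add: basis_expansion)
    then show False using f(2) by blast
  qed
  then obtain j where j: "f (axis j 1) \<noteq> 0" by blast
  define e :: "complex^'N" where "e = axis j 1"
  define \<pi> where "\<pi> z = z - z $ j *s e" for z
  have \<pi>_nth: "\<pi> z $ i = (if i = j then 0 else z $ i)" for z i
    by (simp add: \<pi>_def e_def axis_def)
  have \<pi>_smult: "\<pi> (c *s v) = c *s \<pi> v" for c v by (simp add: vec_eq_iff \<pi>_nth)
  have lin\<pi>: "linear \<pi>" by (rule linearI) (simp_all add: vec_eq_iff \<pi>_nth)
  have b\<pi>: "bounded_linear \<pi>" using lin\<pi> by (simp add: linear_conv_bounded_linear)
  have \<pi>\<pi>: "\<pi> (\<pi> x) = \<pi> x" for x by (simp add: vec_eq_iff \<pi>_nth)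
  have decomp: "z = \<pi> z + z $ j *s e" for z by (simp add: \<pi>_def)
  have fr\<pi>: "frechet_derivative \<pi> (at z) = \<pi>" for z
    using frechet_derivative_at[OF bounded_linear_imp_has_derivative[OF b\<pi>]] by simp
  have dim\<pi>: "dim (range \<pi>) = DIM(complex^'N) - 2"
  proof -
    let ?d = "Basis - {axis j 1, axis j \<i>} :: (complex^'N) set"
    have in1: "x \<bullet> axis j 1 = Re (x $ j)" "x \<bullet> axis j \<i> = Im (x $ j)" for x :: "complex^'N"
      by (simp_all add: inner_axis)
    have ax: "axis j 1 \<in> (Basis :: (complex^'N) set)" "axis j \<i> \<in> (Basis :: (complex^'N) set)"
      by (auto simp: Basis_vec_def Basis_complex_def)
    have "range \<pi> = {x. x $ j = 0}"
    proof (intro equalityI subsetI)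
      fix x :: "complex^'N" assume "x \<in> {x. x $ j = 0}"
      then have "x = \<pi> x" using decomp[of x] by simp
      then show "x \<in> range \<pi>" by (metis rangeI)
    qed (auto simp: \<pi>_nth)
    also have "\<dots> = {x. \<forall>i\<in>Basis. i \<notin> ?d \<longrightarrow> x \<bullet> i = 0}"
      using ax by (auto simp: in1 complex_eq_iff)
    finally have "dim (range \<pi>) = card ?d" using dim_substandard[of ?d] by (simp only:) blast
    also have "\<dots> = DIM(complex^'N) - card {axis j 1, axis j \<i> :: complex^'N}"
      using ax by (intro card_Diff_subset) auto
    also have "card {axis j 1, axis j \<i> :: complex^'N} = 2"
      by (simp add: axis_eq_axis complex_eq_iff)
    finally show ?thesis .
  qed
  have inj: "v = 0" if "v \<in> tangent_cone M p" "\<pi> v = 0" for v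
  proof -
    have v: "v = v $ j *s e" using decomp[of v] that(2) by simp
    have "f v = v $ j * f e" using arg_cong[OF v, of f] f_lin(2)[OF f(1), of "v $ j" e] by (rule trans)
    then have "v $ j = 0" using f(3)[OF that(1)] j by (simp add: e_def)
    then show "v = 0" using v by (metis vector_smult_lzero)
  qed
  obtain A B Q \<Psi> \<Psi>' c where s: "open A" "0 \<in> A" "open B" "homeomorphism A B \<Psi> \<Psi>'" "Ck_on 1 \<Psi> A"
    "\<And>y. y \<in> B \<Longrightarrow> \<exists>E. (\<Psi>' has_derivative E) (at y) \<and>
        (\<forall>v. E (frechet_derivative \<Psi> (at (\<Psi>' y)) v) = v) \<and> (\<forall>v. frechet_derivative \<Psi> (at (\<Psi>' y)) (E v) = v)"
    "Ck_on 1 c A" "c 0 = p" "c ` A \<subseteq> N"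
    "\<And>x. x \<in> A \<Longrightarrow> \<Psi> x = \<pi> (c x) + (x - \<pi> x)"
    "\<And>x. x \<in> A \<Longrightarrow> \<pi> x = x \<Longrightarrow> c x \<in> M"
    "open Q" "p \<in> Q" "\<And>q. q \<in> M \<inter> Q \<Longrightarrow> \<exists>x\<in>A. \<pi> x = x \<and> c x = q"
    by (rule submanifold_straighten[OF M _ N _ Ck_on_linear[OF N b\<pi>] lin\<pi> \<pi>\<pi> dim\<pi>, of p])
      (use p inj in \<open>auto simp: fr\<pi> \<pi>\<pi>\<close>)
  have hom: "\<Psi> x \<in> B" "\<Psi>' (\<Psi> x) = x" if "x \<in> A" for x
    using s(4) that by (auto simp: homeomorphism_def)
  have hom': "\<Psi>' y \<in> A" "\<Psi> (\<Psi>' y) = y" if "y \<in> B" for y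
    using s(4) that by (auto simp: homeomorphism_def)
  define \<sigma> where "\<sigma> y = c (\<Psi>' y)" for y
  have linD: "\<pi> (x + y) = \<pi> x + \<pi> y" "\<pi> (x - y) = \<pi> x - \<pi> y" for x y
    using lin\<pi> by (simp_all add: linear_add linear_diff)
  have \<sigma>: "\<sigma> y \<in> M" "\<sigma> y \<in> N" "\<pi> (\<sigma> y) = y" if y: "y \<in> B" "\<pi> y = y" for y
  proof -
    have "\<pi> (\<Psi> (\<Psi>' y)) = \<pi> (c (\<Psi>' y))"
      using s(10)[OF hom'(1)[OF y(1)]] by (simp add: linD \<pi>\<pi>)
    then have 1: "\<pi> (\<sigma> y) = y" using hom'(2)[OF y(1)] y(2) by (simp add: \<sigma>_def)
    have "y = \<pi> (c (\<Psi>' y)) + (\<Psi>' y - \<pi> (\<Psi>' y))"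
      using s(10)[OF hom'(1)[OF y(1)]] hom'(2)[OF y(1)] by simp
    then have "\<pi> (\<Psi>' y) = \<Psi>' y" using 1 by (simp add: \<sigma>_def)
    then show "\<sigma> y \<in> M" "\<sigma> y \<in> N" "\<pi> (\<sigma> y) = y"
      using s(9,11) hom'(1)[OF y(1)] 1 by (auto simp: \<sigma>_def)
  qed
  define U where "U = \<pi> -` B"
  have U: "open U"
    unfolding U_def using s(3) by (intro open_vimage) (auto intro: linear_continuous_on[OF b\<pi>])
  define \<gamma> where "\<gamma> z = \<sigma> (\<pi> z) $ j" for z
  have \<sigma>_U: "\<sigma> (\<pi> z) = \<pi> z + \<gamma> z *s e" if "z \<in> U" for z
    using decomp[of "\<sigma> (\<pi> z)"] \<sigma>(3)[of "\<pi> z"] that by (simp add: U_def \<pi>\<pi> \<gamma>_def)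
  have hol: "holomorphic_fun_on \<gamma> U"
  proof (rule holomorphic_fun_onI)
    fix z assume z: "z \<in> U"
    then have k: "\<pi> z \<in> B" by (simp add: U_def)
    obtain E where E: "(\<Psi>' has_derivative E) (at (\<pi> z))" using s(6)[OF k] by blast
    have "(c has_derivative frechet_derivative c (at (\<Psi>' (\<pi> z)))) (at (\<Psi>' (\<pi> z)))"
      by (rule Ck_on_has_derivative[of 0]) (use s(7) hom'(1)[OF k] in auto)
    from has_derivative_compose[OF E this] obtain \<Sigma> where \<Sigma>: "(\<sigma> has_derivative \<Sigma>) (at (\<pi> z))"
      unfolding \<sigma>_def by blast
    have d\<pi>: "(\<pi> has_derivative \<pi>) (at z)" using b\<pi> by (rule bounded_linear_imp_has_derivative)
    have \<Sigma>\<pi>: "((\<lambda>z. \<sigma> (\<pi> z)) has_derivative (\<lambda>v. \<Sigma> (\<pi> v))) (at z)"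
      by (rule has_derivative_compose[OF d\<pi> \<Sigma>])
    then have "((\<lambda>z. \<pi> (\<sigma> (\<pi> z))) has_derivative (\<lambda>v. \<pi> (\<Sigma> (\<pi> v)))) (at z)"
      by (rule bounded_linear.has_derivative[OF b\<pi>])
    then have "(\<pi> has_derivative (\<lambda>v. \<pi> (\<Sigma> (\<pi> v)))) (at z)"
      by (rule has_derivative_transform_within_open[OF _ U z]) (simp add: \<sigma>(3) U_def \<pi>\<pi>)
    from has_derivative_unique[OF this d\<pi>] have \<pi>\<Sigma>: "\<pi> (\<Sigma> (\<pi> v)) = \<pi> v" for v by metis
    define D where "D v = \<Sigma> (\<pi> v) $ j" for v
    have D: "(\<gamma> has_derivative D) (at z)"
      unfolding \<gamma>_def D_def by (rule bounded_linear.has_derivative[OF bounded_linear_vec_nth \<Sigma>\<pi>])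
    have \<Sigma>_eq: "\<Sigma> (\<pi> v) = \<pi> v + D v *s e" for v
      using decomp[of "\<Sigma> (\<pi> v)"] by (simp add: \<pi>\<Sigma> D_def)
    have q: "\<sigma> (\<pi> z) \<in> M \<inter> N" using \<sigma>(1,2)[OF k \<pi>\<pi>] by blast
    then obtain g where g: "complex_linear g" "\<exists>z. g z \<noteq> 0" "\<And>v. v \<in> tangent_cone M (\<sigma> (\<pi> z)) \<Longrightarrow> g v = 0"
      using tan by blast
    have "\<Sigma> (\<pi> v) \<in> tangent_cone M (\<sigma> (\<pi> z))" for v
    proof (rule derivative_in_tangent_cone[OF \<Sigma> s(3) k])
      fix r :: real assume "\<pi> z + r *\<^sub>R \<pi> v \<in> B"
      then show "\<sigma> (\<pi> z + r *\<^sub>R \<pi> v) \<in> M"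
        by (rule \<sigma>(1)) (simp add: linD \<pi>\<pi> linear_scale[OF lin\<pi>])
    qed
    from g(3)[OF this] have 0: "g (\<pi> v) + D v * g e = 0" for v
      unfolding \<Sigma>_eq f_lin(1)[OF g(1)] f_lin(2)[OF g(1)] .
    have "g e \<noteq> 0"
    proof
      assume ge: "g e = 0"
      have "g v = g (\<pi> v) + v $ j * g e" for v
        using arg_cong[OF decomp[of v], of g] unfolding f_lin(1)[OF g(1)] f_lin(2)[OF g(1)] .
      then have "g v = 0" for v using 0 ge by simp
      then show False using g(2) by blast
    qed
    then have Dv: "D v = - g (\<pi> v) / g e" for v
      using 0[of v] by (simp add: field_simps add_eq_0_iff)
    have "D (b *s v) = b * D v" for b v
      unfolding Dv \<pi>_smult f_lin(2)[OF g(1)] by simp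
    then show "\<exists>D. (\<gamma> has_derivative D) (at z) \<and> (\<forall>c v. D (c *s v) = c * D v)" using D by blast
  qed
  have in_M: "\<pi> q \<in> B" "q $ j = \<gamma> q" if q: "q \<in> M \<inter> Q" for q
  proof -
    obtain x where x: "x \<in> A" "\<pi> x = x" "c x = q" using s(14)[OF q] by blast
    then have \<Psi>x: "\<Psi> x = \<pi> q" using s(10)[OF x(1)] by simp
    then show "\<pi> q \<in> B" using hom(1)[OF x(1)] by simp
    show "q $ j = \<gamma> q" using hom(2)[OF x(1)] x(3) by (simp add: \<gamma>_def \<sigma>_def \<Psi>x[symmetric])
  qed
  show "\<exists>W V \<phi> j. p \<in> W \<and> biholomorphic \<phi> W V \<and> \<phi> ` (M \<inter> N \<inter> W) = V \<inter> {z. z $ j = 0}"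
  proof (rule graph_complex_hypersurface[OF U hol p, of "N \<inter> Q" j])
    show "open (N \<inter> Q)" "p \<in> N \<inter> Q" using N s(12,13) p by auto
    show "M \<inter> N \<inter> (N \<inter> Q) \<subseteq> U" using in_M by (auto simp: U_def)
    have sh: "\<pi> (z + u *s axis j 1) = \<pi> z" for z u
      by (simp add: vec_eq_iff \<pi>_nth axis_def)
    then show "z + u *s axis j 1 \<in> U" "\<gamma> (z + u *s axis j 1) = \<gamma> z" if "z \<in> U" for z u
      using that by (auto simp: U_def \<gamma>_def)
    fix z assume z: "z \<in> N \<inter> Q" "z \<in> U"
    show "z \<in> M \<inter> N \<longleftrightarrow> z $ j = \<gamma> z"
    proof
      assume "z $ j = \<gamma> z"
      then have "\<sigma> (\<pi> z) = z" using \<sigma>_U[OF z(2)] decomp[of z] by simp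
      then have "z \<in> M" using \<sigma>(1)[of "\<pi> z"] z(2) by (auto simp: U_def \<pi>\<pi>)
      then show "z \<in> M \<inter> N" using z by auto
    qed (use in_M z in auto)
  qed
qed

section \<open>Lipschitz estimates across thin sets\<close>

text \<open>Cover \<open>f (Z)\<close> by an open set \<open>T\<close> of measure less than \<open>e\<close>, and let \<open>\<Phi> y\<close> be the measure of the part of
  \<open>T\<close> below \<open>y\<close>. The function \<open>f - \<Phi> \<circ> f\<close> is locally constant near \<open>Z\<close> and locally
  Lipschitz with constant \<open>B\<close> elsewhere, and it differs from \<open>f\<close> by at most \<open>e\<close>.\<close>

lemma increment_bound_off_null_image:
  fixes f :: "real \<Rightarrow> real"
  assumes ab: "a \<le> b" and contf: "continuous_on {a..b} f" and Z: "closed Z" 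
    and null: "negligible (f ` (Z \<inter> {a..b}))" and B: "B \<ge> 0"
    and der: "\<And>t. t \<in> {a..b} - Z \<Longrightarrow> (f has_real_derivative f' t) (at t)"
    and bound: "\<And>t. t \<in> {a..b} - Z \<Longrightarrow> \<bar>f' t\<bar> \<le> B"
  shows "\<bar>f b - f a\<bar> \<le> B * (b - a)"
proof (rule field_le_epsilon)
  fix e :: real assume e: "e > 0"
  let ?S = "f ` (Z \<inter> {a..b})"
  have S: "?S \<in> null_sets lebesgue" using null by (simp add: negligible_iff_null_sets)
  obtain T where T: "open T" "?S \<subseteq> T" "T - ?S \<in> lmeasurable" "emeasure lebesgue (T - ?S) < ennreal e"
    using sets_lebesgue_outer_open[OF null_setsD2[OF S] e] .
  have "T = (T - ?S) \<union> ?S" using T(2) by blast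
  then have Tm: "T \<in> lmeasurable" using fmeasurable.Un[OF T(3) negligible_imp_measurable[OF null]] by simp
  have "measure lebesgue (T - ?S) < e"
    using T(4) e emeasure_eq_measure2[OF T(3)] by (simp add: ennreal_less_iff)
  then have Te: "measure lebesgue T < e"
    using measure_Diff_null_set[OF fmeasurableD[OF Tm] S] by simp
  define \<Phi> where "\<Phi> y = measure lebesgue (T \<inter> {..y})" for y
  have meas: "T \<inter> A \<in> lmeasurable" if "A \<in> sets borel" for A
    using Tm that by (intro fmeasurable_Int_fmeasurable) auto
  have \<Phi>_diff: "\<Phi> y2 = \<Phi> y1 + measure lebesgue (T \<inter> {y1<..y2})" if "y1 \<le> y2" for y1 y2
  proof -
    have 1: "(T \<inter> {..y1}) \<union> (T \<inter> {..y2}) = T \<inter> {..y2}" "T \<inter> {..y2} - T \<inter> {..y1} = T \<inter> {y1<..y2}"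
      using that by auto
    have "measure lebesgue ((T \<inter> {..y1}) \<union> (T \<inter> {..y2}))
        = measure lebesgue (T \<inter> {..y1}) + measure lebesgue (T \<inter> {..y2} - T \<inter> {..y1})"
      by (rule measure_Un2) (simp_all add: meas)
    then show ?thesis unfolding \<Phi>_def 1 .
  qed
  have \<Phi>_mono: "\<Phi> y1 \<le> \<Phi> y2" if "y1 \<le> y2" for y1 y2
    using \<Phi>_diff[OF that] by simp
  have \<Phi>_le: "\<Phi> y2 - \<Phi> y1 \<le> y2 - y1" if "y1 \<le> y2" for y1 y2
  proof -
    have "measure lebesgue (T \<inter> {y1<..y2}) \<le> measure lebesgue {y1<..y2}"
      by (rule measure_mono_fmeasurable) (auto intro!: fmeasurableD[OF meas] bounded_set_imp_lmeasurable bounded_subset[OF bounded_cbox[of y1 y2]])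
    also have "\<dots> = y2 - y1" using that by simp
    finally show ?thesis using \<Phi>_diff[OF that] by simp
  qed
  have \<Phi>_eq: "\<Phi> y2 - \<Phi> y1 = y2 - y1" if "y1 \<le> y2" "{y1..y2} \<subseteq> T" for y1 y2
  proof -
    have "T \<inter> {y1<..y2} = {y1<..y2}" using that(2) by auto
    then show ?thesis using \<Phi>_diff[OF that(1)] that(1) by simp
  qed
  have \<Phi>_range: "0 \<le> \<Phi> y" "\<Phi> y \<le> e" for y
  proof -
    show "0 \<le> \<Phi> y" by (simp add: \<Phi>_def)
    have "\<Phi> y \<le> measure lebesgue T" unfolding \<Phi>_def
      by (rule measure_mono_fmeasurable) (auto intro: fmeasurableD[OF meas] Tm)
    then show "\<Phi> y \<le> e" using Te by simp
  qed
  define F where "F t = f t - \<Phi> (f t)" for t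
  have F_lip: "\<bar>F t - F s\<bar> \<le> \<bar>f t - f s\<bar>" for s t
    using \<Phi>_mono[of "f s" "f t"] \<Phi>_le[of "f s" "f t"] \<Phi>_mono[of "f t" "f s"] \<Phi>_le[of "f t" "f s"]
    unfolding F_def by (cases "f s \<le> f t") auto
  define P where "P s t \<longleftrightarrow> (a \<le> s \<longrightarrow> t \<le> b \<longrightarrow> \<bar>F t - F s\<bar> \<le> B * (t - s))" for s t
  have "P a b" using ab
  proof (induct rule: Bolzano)
    case (trans r s t)
    then show ?case unfolding P_def by (auto simp: algebra_simps)
  next
    case (local t)
    show ?case
    proof (cases "t \<in> Z")
      case True
      then have "f t \<in> T" using local T(2) by auto
      then obtain r where r: "r > 0" "ball (f t) r \<subseteq> T" using T(1) open_contains_ball by blast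
      obtain d where d: "d > 0" "\<And>s. s \<in> {a..b} \<Longrightarrow> dist s t < d \<Longrightarrow> dist (f s) (f t) < r"
        using contf r(1) local unfolding continuous_on_iff by (metis atLeastAtMost_iff)
      show ?thesis
      proof (intro exI[of _ d] conjI allI impI)
        fix u v assume uv: "u \<le> t \<and> t \<le> v \<and> v - u < d"
        show "P u v" unfolding P_def
        proof (intro impI)
          assume "a \<le> u" "v \<le> b"
          then have near: "f u \<in> ball (f t) r" "f v \<in> ball (f t) r"
          proof -
            have "dist u t < d" "dist v t < d" "u \<in> {a..b}" "v \<in> {a..b}"
              using uv \<open>a \<le> u\<close> \<open>v \<le> b\<close> by (auto simp: dist_real_def)
            then show "f u \<in> ball (f t) r" "f v \<in> ball (f t) r"
              using d(2)[of u] d(2)[of v] by (simp_all add: dist_commute[of "f t"])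
          qed
          have "convex (ball (f t) r)" by simp
          then have sub: "{x..y} \<subseteq> T" if "x \<in> ball (f t) r" "y \<in> ball (f t) r" for x y
            using that r(2) by (fastforce simp: dist_real_def abs_if split: if_splits)
          have "F v = F u"
          proof (cases "f u \<le> f v")
            case True then show ?thesis using \<Phi>_eq[OF True sub] near by (simp add: F_def)
          next
            case False then show ?thesis using \<Phi>_eq[of "f v" "f u"] sub near by (simp add: F_def)
          qed
          then show "\<bar>F v - F u\<bar> \<le> B * (v - u)" using B uv by simp
        qed
      qed (rule d)
    next
      case False
      then obtain d where d: "d > 0" "ball t d \<inter> Z = {}"
        using Z by (metis ComplI Int_commute disjoint_eq_subset_Compl open_Compl open_contains_ball)
      show ?thesis
      proof (intro exI[of _ d] conjI allI impI)
        fix u v assume uv: "u \<le> t \<and> t \<le> v \<and> v - u < d"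
        show "P u v" unfolding P_def
        proof (intro impI)
          assume ab': "a \<le> u" "v \<le> b"
          have sub: "s \<in> {a..b} - Z" if "s \<in> {u..v}" for s
          proof -
            have "s \<in> ball t d" using that uv by (auto simp: dist_real_def)
            then show ?thesis using d(2) that ab' by auto
          qed
          have "norm (f v - f u) \<le> B * norm (v - u)"
          proof (rule differentiable_bound[where S="{u..v}" and f'="\<lambda>t. (*) (f' t)"])
            fix s assume s: "s \<in> {u..v}"
            show "(f has_derivative (*) (f' s)) (at s within {u..v})"
              using der[OF sub[OF s]] by (simp add: has_field_derivative_def has_derivative_at_withinI)
            show "onorm ((*) (f' s)) \<le> B"
              using bound[OF sub[OF s]] by (intro onorm_bound[OF B]) (simp add: abs_mult mult_right_mono)
          qed (use uv in auto)
          then show "\<bar>F v - F u\<bar> \<le> B * (v - u)" using F_lip[of v u] uv by simp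
        qed
      qed (rule d)
    qed
  qed
  then have "\<bar>F b - F a\<bar> \<le> B * (b - a)" by (simp add: P_def)
  moreover have "\<bar>f b - f a\<bar> \<le> \<bar>F b - F a\<bar> + e"
    using \<Phi>_range[of "f a"] \<Phi>_range[of "f b"] by (simp add: F_def)
  ultimately show "\<bar>f b - f a\<bar> \<le> B * (b - a) + e" by simp
qed

text \<open>Almost every slice of a null set is a null set, and a set of full measure meets every nonempty open set.\<close>

lemma negligible_slice_in_open:
  fixes N :: "('a::euclidean_space \<times> real) set"
  assumes "negligible N" "open U" "U \<noteq> {}"
  obtains x where "x \<in> U" "negligible {t. (x, t) \<in> N}"
proof -
  have "N \<in> null_sets (completion lborel)" using assms(1) by (simp only: negligible_iff_null_sets)
  then obtain N' where N': "N' \<in> null_sets lborel" "N \<subseteq> N'"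
    using null_sets_completion_iff2[of N lborel] by auto
  from AE_not_in[OF N'(1)] have "AE x in lborel \<Otimes>\<^sub>M lborel. x \<notin> N'"
    by (simp only: lborel_prod)
  then have "AE x in lborel. AE t in lborel. (x, t) \<notin> N'"
    by (rule pair_sigma_finite.AE_pair[rotated])
      (intro pair_sigma_finite.intro sigma_finite_lborel)
  then obtain R where R: "R \<in> null_sets lborel" "{x. \<not> (AE t in lborel. (x, t) \<notin> N')} \<subseteq> R"
    unfolding eventually_ae_filter by auto
  have "\<not> U \<subseteq> R"
  proof
    assume "U \<subseteq> R"
    have "negligible R" using null_sets_completionI[OF R(1)] by (simp only: negligible_iff_null_sets)
    then have "negligible U" using \<open>U \<subseteq> R\<close> negligible_subset by blast
    then show False using open_not_negligible[OF assms(2,3)] by blast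
  qed
  then obtain x where x: "x \<in> U" "AE t in lborel. (x, t) \<notin> N'" using R(2) by blast
  then obtain R' where R': "R' \<in> null_sets lborel" "{t. \<not> (x, t) \<notin> N'} \<subseteq> R'"
    unfolding eventually_ae_filter by auto
  have "negligible R'" using null_sets_completionI[OF R'(1)] by (simp only: negligible_iff_null_sets)
  moreover have "{t. (x, t) \<in> N} \<subseteq> R'" using R'(2) N'(2) by auto
  ultimately have "negligible {t. (x, t) \<in> N}" using negligible_subset by blast
  with x(1) show thesis by (rule that)
qed

text \<open>For a direction \<open>v\<close> the set in the assumption \<open>thin\<close> has the slice \<open>h (E \<inter> (x + \<real> v))\<close> over \<open>x\<close>. So on
  lines in a dense set of parallel positions the one-dimensional estimate applies, and
  continuity of \<open>h\<close> carries it over to all lines.\<close>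

lemma lipschitz_across_thin_set:
  fixes h :: "'a::euclidean_space \<Rightarrow> real"
  assumes U: "open U" "convex U" and conth: "continuous_on U h"
    and E: "closedin (top_of_set U) E" and B: "B \<ge> 0"
    and der: "\<And>x. x \<in> U - E \<Longrightarrow> (h has_derivative h' x) (at x)"
    and bound: "\<And>x v. x \<in> U - E \<Longrightarrow> \<bar>h' x v\<bar> \<le> B * norm v"
    and thin: "\<And>v. negligible {(x + t *\<^sub>R v, h x) | x t. x \<in> E}"
    and xy: "x \<in> U" "y \<in> U"
  shows "\<bar>h y - h x\<bar> \<le> B * norm (y - x)"
proof (rule ccontr)
  assume neg: "\<not> ?thesis"
  define v where "v = y - x"
  have E_U: "E \<subseteq> U" using E by (auto simp: closedin_def)
  define G where "G = U \<inter> (\<lambda>z. z + v) -` U"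
  have G: "open G" unfolding G_def
    by (intro open_Int U open_vimage) (auto intro!: continuous_intros)
  have "continuous_on G (\<lambda>z. \<bar>h (z + v) - h z\<bar>)"
    by (intro continuous_intros continuous_on_compose2[OF conth]) (auto simp: G_def)
  then have oG: "open (G \<inter> (\<lambda>z. \<bar>h (z + v) - h z\<bar>) -` {B * norm v<..})"
    using G by (rule continuous_open_preimage) simp
  have "x \<in> G \<inter> (\<lambda>z. \<bar>h (z + v) - h z\<bar>) -` {B * norm v<..}"
    using neg xy by (auto simp: G_def v_def)
  then have "G \<inter> (\<lambda>z. \<bar>h (z + v) - h z\<bar>) -` {B * norm v<..} \<noteq> {}" by blast
  from negligible_slice_in_open[OF thin[of v] oG this]
  obtain z where "z \<in> G \<inter> (\<lambda>z. \<bar>h (z + v) - h z\<bar>) -` {B * norm v<..}"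
    and null: "negligible {s. (z, s) \<in> {(x + t *\<^sub>R v, h x) | x t. x \<in> E}}" .
  then have z: "z \<in> G" "\<bar>h (z + v) - h z\<bar> > B * norm v" by auto
  have seg: "z + s *\<^sub>R v \<in> U" if "s \<in> {0..1}" for s
  proof -
    have "z + s *\<^sub>R v = (1 - s) *\<^sub>R z + s *\<^sub>R (z + v)" by (simp add: algebra_simps)
    then show ?thesis using z(1) that U(2) by (auto simp: G_def intro: convexD)
  qed
  define f where "f s = h (z + s *\<^sub>R v)" for s
  define Z where "Z = {0..1} \<inter> (\<lambda>s. z + s *\<^sub>R v) -` E"
  have cl: "continuous_on A (\<lambda>s. z + s *\<^sub>R v)" for A by (intro continuous_intros)
  have "closedin (top_of_set {0..1}) Z"
    unfolding Z_def by (rule continuous_closedin_preimage_gen[OF cl _ E]) (use seg in auto)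
  then have Z: "closed Z" using closed_atLeastAtMost by (metis closedin_closed_trans)
  have "\<bar>f 1 - f 0\<bar> \<le> (B * norm v) * (1 - 0)"
  proof (rule increment_bound_off_null_image[OF _ _ Z, where f'="\<lambda>s. h' (z + s *\<^sub>R v) v"])
    show "continuous_on {0..1} f"
      unfolding f_def by (intro continuous_on_compose2[OF conth cl]) (use seg in auto)
    show "negligible (f ` (Z \<inter> {0..1}))"
    proof (rule negligible_subset[OF null], safe)
      fix s assume "s \<in> Z"
      then have "z + s *\<^sub>R v \<in> E" "(z, f s) = ((z + s *\<^sub>R v) + (- s) *\<^sub>R v, h (z + s *\<^sub>R v))"
        by (auto simp: Z_def f_def)
      then show "\<exists>x t. (z, f s) = (x + t *\<^sub>R v, h x) \<and> x \<in> E" by blast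
    qed
    fix s assume s: "s \<in> {0..1} - Z"
    then have zs: "z + s *\<^sub>R v \<in> U - E" using seg by (auto simp: Z_def)
    have "((\<lambda>s. z + s *\<^sub>R v) has_derivative (\<lambda>r. r *\<^sub>R v)) (at s)"
      by (auto intro!: derivative_eq_intros)
    from has_derivative_compose[OF this der[OF zs]]
    have "(f has_derivative (\<lambda>r. h' (z + s *\<^sub>R v) (r *\<^sub>R v))) (at s)" unfolding f_def .
    moreover have "h' (z + s *\<^sub>R v) (r *\<^sub>R v) = h' (z + s *\<^sub>R v) v * r" for r
      using linear_scale[OF has_derivative_linear[OF der[OF zs]]] by simp
    ultimately show "(f has_real_derivative h' (z + s *\<^sub>R v) v) (at s)"
      by (simp add: has_field_derivative_def)
    show "\<bar>h' (z + s *\<^sub>R v) v\<bar> \<le> B * norm v" using bound[OF zs] .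
  qed (use B in auto)
  then show False using z(2) by (simp add: f_def)
qed

text \<open>The set is a differentiable image of a piece of the subspace spanned by \<open>L\<close> and one further
  vector \<open>e\<close>, which is a null set because \<open>L\<close> has codimension at least two.\<close>

lemma negligible_submanifold_lines:
  fixes M L :: "'a::euclidean_space set" and \<phi> :: "'a \<Rightarrow> 'b::euclidean_space"
  assumes dims: "DIM('a) \<le> DIM('b)" "dim L + 2 \<le> DIM('a)" 
    and \<psi>: "Ck_diffeo 1 \<psi> W V" "subspace L" "\<psi> ` (M \<inter> W) = V \<inter> L"
    and \<phi>: "\<And>q. q \<in> W' \<Longrightarrow> \<phi> differentiable (at q)" and W': "W' \<subseteq> W"
  shows "negligible {\<phi> q + t *\<^sub>R w | q t. q \<in> M \<inter> W'}"
proof -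
  define \<xi> where "\<xi> = inv_into W \<psi>"
  have a: "open V" "bij_betw \<psi> W V" "Ck_on 1 \<xi> V"
    using \<psi>(1) by (auto simp: Ck_diffeo_def \<xi>_def)
  obtain e where e: "e \<noteq> 0" "\<And>y. y \<in> span L \<Longrightarrow> orthogonal e y"
    using orthogonal_to_subspace_exists[of L] dims by auto
  define r where "r z = (z \<bullet> e) / (e \<bullet> e)" for z
  define g where "g z = \<phi> (\<xi> (z - r z *\<^sub>R e)) + r z *\<^sub>R w" for z
  define S where "S = {z \<in> span (insert e L). z - r z *\<^sub>R e \<in> V \<and> \<xi> (z - r z *\<^sub>R e) \<in> W'}"
  have rder: "r differentiable (at z)" for z
    unfolding r_def by (auto intro!: derivative_intros simp: e)
  have "g differentiable_on S"
    unfolding differentiable_on_def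
  proof
    fix z assume z: "z \<in> S"
    have "(\<lambda>z. z - r z *\<^sub>R e) differentiable (at z)"
      by (intro derivative_intros rder)
    moreover have "\<xi> differentiable (at (z - r z *\<^sub>R e))"
      using a(3) z by (simp add: S_def)
    moreover have "\<phi> differentiable (at (\<xi> (z - r z *\<^sub>R e)))"
      using \<phi> z by (simp add: S_def)
    ultimately have "(\<lambda>z. \<phi> (\<xi> (z - r z *\<^sub>R e))) differentiable (at z)"
      using differentiable_compose by metis
    then have "g differentiable (at z)"
      unfolding g_def by (intro derivative_intros rder)
    then show "g differentiable (at z within S)" by (rule differentiable_at_withinI)
  qed
  moreover have "negligible S"
  proof -
    have "dim (span (insert e L)) \<le> dim L + 1" by (simp add: dim_insert)
    then have "negligible (span (insert e L))" using dims by (intro negligible_lowdim) simp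
    then show ?thesis by (rule negligible_subset) (auto simp: S_def)
  qed
  ultimately have "negligible (g ` S)"
    using negligible_differentiable_image_negligible dims(1) by blast
  moreover have "{\<phi> q + t *\<^sub>R w | q t. q \<in> M \<inter> W'} \<subseteq> g ` S"
  proof clarify
    fix q t assume q: "q \<in> M" "q \<in> W'"
    then have qW: "q \<in> W" using W' by blast
    have l: "\<psi> q \<in> V \<inter> L" using \<psi>(3) q qW by blast
    then have "\<psi> q \<bullet> e = 0" using e(2)[of "\<psi> q"] by (simp add: span_base orthogonal_def inner_commute)
    then have "r (\<psi> q + t *\<^sub>R e) = t" using e(1) by (simp add: r_def inner_add_left)
    moreover have "\<xi> (\<psi> q) = q" using a(2) qW by (simp add: \<xi>_def bij_betw_inv_into_left)
    moreover have "\<psi> q + t *\<^sub>R e \<in> span (insert e L)"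
      using l by (intro span_add span_scale span_base) auto
    ultimately have "\<psi> q + t *\<^sub>R e \<in> S" "g (\<psi> q + t *\<^sub>R e) = \<phi> q + t *\<^sub>R w"
      using l q by (auto simp: S_def g_def)
    then show "\<phi> q + t *\<^sub>R w \<in> g ` S" by (metis imageI)
  qed
  ultimately show ?thesis using negligible_subset by blast
qed

section \<open>Regular boundary points of a graph\<close>

lemma le_on_open_if_le_on_dense:
  fixes f :: "'a::topological_space \<Rightarrow> real"
  assumes "open S" "continuous_on S f" "S \<subseteq> closure V" "\<And>x. x \<in> V \<inter> S \<Longrightarrow> f x \<le> b" "x \<in> S"
  shows "f x \<le> b"
proof (rule ccontr)
  assume "\<not> f x \<le> b"
  have "open (S \<inter> f -` {b<..})" by (rule continuous_open_preimage[OF assms(2,1)]) simp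
  moreover have "x \<in> S \<inter> f -` {b<..}" using \<open>\<not> f x \<le> b\<close> assms(5) by simp
  moreover have "x \<in> closure V" using assms(3,5) by blast
  ultimately obtain y where "y \<in> V" "y \<in> S \<inter> f -` {b<..}"
    by (metis closure_iff_nhds_not_empty order_refl Int_iff all_not_in_conv)
  then show False using assms(4)[of y] by auto
qed

text \<open>Continuity of \<open>h\<close> together with the expansion of \<open>\<rho> (x, h x) = 0\<close> first gives a Lipschitz bound
  at \<open>x0\<close>, and with this bound the expansion determines the derivative.\<close>

lemma implicit_function_has_derivative:
  fixes \<rho> :: "'e::real_normed_vector \<times> real \<Rightarrow> real" and h :: "'e \<Rightarrow> real"
  assumes cont: "isCont h x0" and \<rho>: "(\<rho> has_derivative \<rho>') (at (x0, h x0))" and nz: "\<rho>' (0, 1) \<noteq> 0"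
    and X: "open X" "x0 \<in> X" "\<And>x. x \<in> X \<Longrightarrow> \<rho> (x, h x) = 0"
  shows "(h has_derivative (\<lambda>v. - \<rho>' (v, 0) * inverse (\<rho>' (0, 1)))) (at x0)"
proof -
  define c where "c = \<rho>' (0, 1)"
  have bl: "bounded_linear \<rho>'" using \<rho> by (rule has_derivative_bounded_linear)
  have split: "\<rho>' (v, r) = \<rho>' (v, 0) + r * c" for v r
  proof -
    have "\<rho>' (v, r) = \<rho>' ((v, 0) + r *\<^sub>R (0, 1))" by simp
    also have "\<dots> = \<rho>' (v, 0) + r *\<^sub>R \<rho>' (0, 1)"
      by (simp only: linear_add[OF bounded_linear.linear[OF bl]] linear_scale[OF bounded_linear.linear[OF bl]])
    finally show ?thesis by (simp add: c_def)
  qed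
  have bl1: "bounded_linear (\<lambda>v. \<rho>' (v, 0))"
    by (rule bounded_linear_compose[OF bl]) (intro bounded_linear_Pair bounded_linear_ident bounded_linear_zero)
  obtain K where K: "K > 0" "\<And>v. norm (\<rho>' (v, 0)) \<le> K * norm v"
    using bounded_linear.pos_bounded[OF bl1] by (auto simp: mult.commute)
  define C where "C = (2 * K + \<bar>c\<bar>) / \<bar>c\<bar>"
  have c: "\<bar>c\<bar> > 0" using nz by (simp add: c_def)
  have C: "C > 0" using K c by (simp add: C_def)
  have est: "\<exists>d>0. \<forall>x. norm (x - x0) < d \<longrightarrow> \<bar>\<rho>' (x - x0, 0) + (h x - h x0) * c\<bar> \<le> \<epsilon> * (norm (x - x0) + \<bar>h x - h x0\<bar>)"
    if \<epsilon>: "\<epsilon> > 0" for \<epsilon>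
  proof -
    obtain d1 where d1: "d1 > 0" "\<And>y. norm (y - (x0, h x0)) < d1 \<Longrightarrow>
        norm (\<rho> y - \<rho> (x0, h x0) - \<rho>' (y - (x0, h x0))) \<le> \<epsilon> * norm (y - (x0, h x0))"
      using \<rho> \<epsilon> unfolding has_derivative_at_alt by blast
    obtain d2 where d2: "d2 > 0" "\<And>x. dist x x0 < d2 \<Longrightarrow> dist (h x) (h x0) < d1 / 2"
      using cont d1(1) unfolding continuous_at_eps_delta by (metis half_gt_zero)
    obtain d3 where d3: "d3 > 0" "ball x0 d3 \<subseteq> X" using X open_contains_ball by blast
    show ?thesis
    proof (intro exI[of _ "min (d1 / 2) (min d2 d3)"] conjI allI impI)
      fix x assume "norm (x - x0) < min (d1 / 2) (min d2 d3)"
      then have x: "norm (x - x0) < d1 / 2" "dist x x0 < d2" "x \<in> ball x0 d3" by (auto simp: dist_norm norm_minus_commute)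
      have n: "norm ((x, h x) - (x0, h x0)) \<le> norm (x - x0) + \<bar>h x - h x0\<bar>"
        using norm_Pair_le[of "x - x0" "h x - h x0"] by simp
      moreover have "\<bar>h x - h x0\<bar> < d1 / 2" using d2(2)[OF x(2)] by (simp add: dist_real_def)
      ultimately have "norm ((x, h x) - (x0, h x0)) < d1" using x(1) by linarith
      from d1(2)[OF this] have "norm (\<rho>' (x - x0, h x - h x0)) \<le> \<epsilon> * norm ((x, h x) - (x0, h x0))"
        using X(3)[of x] X(3)[OF X(2)] x(3) d3(2) by auto
      also have "\<dots> \<le> \<epsilon> * (norm (x - x0) + \<bar>h x - h x0\<bar>)" using n \<epsilon> by (intro mult_left_mono) auto
      finally show "\<bar>\<rho>' (x - x0, 0) + (h x - h x0) * c\<bar> \<le> \<epsilon> * (norm (x - x0) + \<bar>h x - h x0\<bar>)"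
        unfolding split[of "x - x0" "h x - h x0"] by simp
    qed (use d1 d2 d3 in auto)
  qed
  obtain da where da: "da > 0" "\<And>x. norm (x - x0) < da \<Longrightarrow>
      \<bar>\<rho>' (x - x0, 0) + (h x - h x0) * c\<bar> \<le> \<bar>c\<bar> / 2 * (norm (x - x0) + \<bar>h x - h x0\<bar>)"
    using est[of "\<bar>c\<bar> / 2"] c by auto
  have lip: "\<bar>h x - h x0\<bar> \<le> C * norm (x - x0)" if "norm (x - x0) < da" for x
  proof -
    have "\<bar>h x - h x0\<bar> * \<bar>c\<bar> \<le> \<bar>\<rho>' (x - x0, 0)\<bar> + \<bar>\<rho>' (x - x0, 0) + (h x - h x0) * c\<bar>"
      unfolding abs_mult[symmetric] by linarith
    also have "\<dots> \<le> K * norm (x - x0) + \<bar>c\<bar> / 2 * (norm (x - x0) + \<bar>h x - h x0\<bar>)"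
      using da(2)[OF that] K(2)[of "x - x0"] by simp
    finally have "\<bar>h x - h x0\<bar> * \<bar>c\<bar> \<le> (2 * K + \<bar>c\<bar>) * norm (x - x0)"
      by (simp add: algebra_simps)
    then show ?thesis using c by (simp add: C_def field_simps)
  qed
  show ?thesis
    unfolding has_derivative_at_alt
  proof (intro conjI allI impI)
    show "bounded_linear (\<lambda>v. - \<rho>' (v, 0) * inverse (\<rho>' (0, 1)))"
      using bl1 by (intro bounded_linear_mult_const bounded_linear_minus)
    fix e :: real assume e: "e > 0"
    then have "e * \<bar>c\<bar> / (1 + C) > 0" using c C by simp
    from est[OF this] obtain db where db: "db > 0" "\<And>x. norm (x - x0) < db \<Longrightarrow>
      \<bar>\<rho>' (x - x0, 0) + (h x - h x0) * c\<bar> \<le> e * \<bar>c\<bar> / (1 + C) * (norm (x - x0) + \<bar>h x - h x0\<bar>)" by blast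
    show "\<exists>d>0. \<forall>y. norm (y - x0) < d \<longrightarrow>
      norm (h y - h x0 - - \<rho>' (y - x0, 0) * inverse (\<rho>' (0, 1))) \<le> e * norm (y - x0)"
    proof (intro exI[of _ "min da db"] conjI allI impI)
      fix y assume y: "norm (y - x0) < min da db"
      have "\<bar>\<rho>' (y - x0, 0) + (h y - h x0) * c\<bar> \<le> e * \<bar>c\<bar> / (1 + C) * (norm (y - x0) + \<bar>h y - h x0\<bar>)"
        using db(2) y by simp
      also have "\<dots> \<le> e * \<bar>c\<bar> / (1 + C) * ((1 + C) * norm (y - x0))"
        using lip[of y] y e c C by (intro mult_left_mono) (auto simp: algebra_simps)
      also have "\<dots> = e * norm (y - x0) * \<bar>c\<bar>" using C by simp
      finally have 1: "\<bar>\<rho>' (y - x0, 0) + (h y - h x0) * c\<bar> \<le> e * norm (y - x0) * \<bar>c\<bar>" .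
      have "(h y - h x0 - - \<rho>' (y - x0, 0) * inverse c) * c = \<rho>' (y - x0, 0) + (h y - h x0) * c"
        using c by (simp add: field_simps)
      then have "\<bar>h y - h x0 - - \<rho>' (y - x0, 0) * inverse c\<bar> * \<bar>c\<bar> \<le> e * norm (y - x0) * \<bar>c\<bar>"
        using 1 by (simp only: abs_mult[symmetric])
      then show "norm (h y - h x0 - - \<rho>' (y - x0, 0) * inverse (\<rho>' (0, 1))) \<le> e * norm (y - x0)"
        using c by (simp add: c_def[symmetric])
    qed (use da db in auto)
  qed
qed

text \<open>Differentiating \<open>\<rho> (x, h x) = 0\<close> at points of the dense set \<open>V\<close> bounds the horizontal derivatives of
  \<open>\<rho>\<close> by a multiple of the vertical one. The bound persists at \<open>x0\<close> by continuity, so the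
  vertical derivative cannot vanish there: a bounded gradient on a dense set excludes a vertical tangent plane.\<close>

lemma Ck_on_2_if_implicit:
  fixes h :: "'e::euclidean_space \<Rightarrow> real" and \<rho> :: "'e \<times> real \<Rightarrow> real"
  assumes U: "open U" "continuous_on U h" "x0 \<in> U"
    and V: "open V" "U \<subseteq> closure V" "\<And>x. x \<in> V \<Longrightarrow> h differentiable (at x)"
      "\<And>v. bounded ((\<lambda>x. frechet_derivative h (at x) v) ` V)"
    and Y: "open Y" "Ck_on 2 \<rho> Y" "(x0, h x0) \<in> Y"
    and zero: "\<And>x. x \<in> U \<Longrightarrow> (x, h x) \<in> Y \<Longrightarrow> \<rho> (x, h x) = 0"
    and nz: "frechet_derivative \<rho> (at (x0, h x0)) w \<noteq> 0"
  shows "\<exists>X. open X \<and> x0 \<in> X \<and> X \<subseteq> U \<and> Ck_on 2 h X"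
proof -
  define \<rho>' where "\<rho>' z = frechet_derivative \<rho> (at z)" for z
  have two: "(2::nat) = Suc (Suc 0)" by simp
  have \<rho>der: "(\<rho> has_derivative \<rho>' z) (at z)" if "z \<in> Y" for z
    unfolding \<rho>'_def using Ck_on_has_derivative[OF Y(2)[unfolded two] that] .
  have \<rho>'1: "Ck_on (Suc 0) (\<lambda>z. \<rho>' z v) Y" for v
    unfolding \<rho>'_def using Y(2) unfolding two Ck_on.simps(2)[of "Suc 0"] by blast
  define X1 where "X1 = U \<inter> (\<lambda>x. (x, h x)) -` Y"
  have contg: "continuous_on U (\<lambda>x. (x, h x))" by (intro continuous_intros U)
  have X1: "open X1" unfolding X1_def by (rule continuous_open_preimage[OF contg U(1) Y(1)])
  have cont\<rho>: "continuous_on X1 (\<lambda>x. \<rho>' (x, h x) v)" for v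
    by (rule continuous_on_compose2[OF Ck_on_imp_continuous[OF \<rho>'1] continuous_on_subset[OF contg]])
      (auto simp: X1_def)
  have isc: "isCont h x" if "x \<in> X1" for x
    using U that by (auto simp: X1_def continuous_on_eq_continuous_at)
  have x0: "x0 \<in> X1" using U Y by (simp add: X1_def)
  have le: "\<exists>b. \<bar>\<rho>' (x0, h x0) (v, 0)\<bar> \<le> b * \<bar>\<rho>' (x0, h x0) (0, 1)\<bar>" for v
  proof -
    obtain b where b: "\<And>x. x \<in> V \<Longrightarrow> \<bar>frechet_derivative h (at x) v\<bar> \<le> b"
      using V(4)[of v] by (auto simp: bounded_iff)
    have "\<bar>\<rho>' (x0, h x0) (v, 0)\<bar> - b * \<bar>\<rho>' (x0, h x0) (0, 1)\<bar> \<le> 0"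
    proof (rule le_on_open_if_le_on_dense[OF X1, where f="\<lambda>x. \<bar>\<rho>' (x, h x) (v, 0)\<bar> - b * \<bar>\<rho>' (x, h x) (0, 1)\<bar>"])
      show "continuous_on X1 (\<lambda>x. \<bar>\<rho>' (x, h x) (v, 0)\<bar> - b * \<bar>\<rho>' (x, h x) (0, 1)\<bar>)"
        by (intro continuous_intros cont\<rho>)
      show "X1 \<subseteq> closure V" using V(2) by (auto simp: X1_def)
      fix x assume x: "x \<in> V \<inter> X1"
      let ?Dh = "frechet_derivative h (at x)"
      have hder: "(h has_derivative ?Dh) (at x)" using V(3) x by (simp add: frechet_derivative_works)
      have "((\<lambda>x. (x, h x)) has_derivative (\<lambda>v. (v, ?Dh v))) (at x)"
        by (intro has_derivative_Pair has_derivative_ident hder)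
      from has_derivative_compose[OF this \<rho>der] x
      have "((\<lambda>x. \<rho> (x, h x)) has_derivative (\<lambda>v. \<rho>' (x, h x) (v, ?Dh v))) (at x)" by (simp add: X1_def)
      moreover have "((\<lambda>x. \<rho> (x, h x)) has_derivative (\<lambda>v. 0)) (at x)"
        by (rule has_derivative_transform_within_open[OF has_derivative_const[of 0] X1])
          (use x zero in \<open>auto simp: X1_def\<close>)
      ultimately have "(\<lambda>v. \<rho>' (x, h x) (v, ?Dh v)) = (\<lambda>v. 0)" by (rule has_derivative_unique)
      then have "\<rho>' (x, h x) (v, ?Dh v) = 0" by metis
      moreover have lin: "linear (\<rho>' (x, h x))" using \<rho>der x by (auto simp: X1_def intro: has_derivative_linear)
      have "\<rho>' (x, h x) (v, ?Dh v) = \<rho>' (x, h x) ((v, 0) + ?Dh v *\<^sub>R (0, 1))" by simp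
      then have "\<rho>' (x, h x) (v, ?Dh v) = \<rho>' (x, h x) (v, 0) + ?Dh v * \<rho>' (x, h x) (0, 1)"
        by (simp only: linear_add[OF lin] linear_scale[OF lin] real_scaleR_def)
      ultimately have "\<bar>\<rho>' (x, h x) (v, 0)\<bar> = \<bar>?Dh v\<bar> * \<bar>\<rho>' (x, h x) (0, 1)\<bar>"
        by (simp add: add_eq_0_iff2 abs_mult)
      also have "\<dots> \<le> b * \<bar>\<rho>' (x, h x) (0, 1)\<bar>" using b x by (intro mult_right_mono) auto
      finally show "\<bar>\<rho>' (x, h x) (v, 0)\<bar> - b * \<bar>\<rho>' (x, h x) (0, 1)\<bar> \<le> 0" by simp
    qed (rule x0)
    then show ?thesis by (intro exI[of _ b]) simp
  qed
  have nz1: "\<rho>' (x0, h x0) (0, 1) \<noteq> 0"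
  proof
    assume 0: "\<rho>' (x0, h x0) (0, 1) = 0"
    then have 1: "\<rho>' (x0, h x0) (v, 0) = 0" for v using le[of v] by simp
    have lin: "linear (\<rho>' (x0, h x0))" using \<rho>der Y(3) by (auto intro: has_derivative_linear)
    have "w = (fst w, 0) + snd w *\<^sub>R (0, 1)" by (simp add: prod_eq_iff)
    then have "\<rho>' (x0, h x0) w = \<rho>' (x0, h x0) (fst w, 0) + snd w *\<^sub>R \<rho>' (x0, h x0) (0, 1)"
      using linear_add[OF lin] linear_scale[OF lin] by metis
    then have "\<rho>' (x0, h x0) w = 0" using 0 1 by simp
    then show False using nz by (simp add: \<rho>'_def)
  qed
  define X where "X = X1 \<inter> (\<lambda>x. \<rho>' (x, h x) (0, 1)) -` (- {0})"
  have X: "open X" unfolding X_def by (rule continuous_open_preimage[OF cont\<rho> X1]) (simp add: open_Compl)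
  define D where "D x v = - \<rho>' (x, h x) (v, 0) * inverse (\<rho>' (x, h x) (0, 1))" for x v
  have hder: "(h has_derivative D x) (at x)" if x: "x \<in> X" for x
    unfolding D_def
    by (rule implicit_function_has_derivative[OF isc \<rho>der _ X1]) (use x zero in \<open>auto simp: X_def X1_def\<close>)
  note mult = Ck_on_scaleR[OF X, where 'b=real, unfolded real_scaleR_def]
  have DC: "Ck_on k (\<lambda>x. D x v) X" if g: "Ck_on k (\<lambda>x. (x, h x)) X" and k: "k \<le> Suc 0" for k v
  proof -
    have \<rho>k: "Ck_on k (\<lambda>x. \<rho>' (x, h x) v) X" for v
    proof (rule Ck_on_compose[OF X g Y(1)])
      from k consider "k = 0" | "k = Suc 0" by linarith
      then show "Ck_on k (\<lambda>z. \<rho>' z v) Y"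
        using Ck_on_Suc_imp[OF \<rho>'1] \<rho>'1 by cases (simp_all only:)
    qed (auto simp: X_def X1_def)
    have "Ck_on k (\<lambda>x. (- 1) * \<rho>' (x, h x) (v, 0) * inverse (\<rho>' (x, h x) (0, 1))) X"
      by (intro mult Ck_on_inverse \<rho>k Ck_on_const X) (auto simp: X_def)
    then show ?thesis by (simp add: D_def)
  qed
  have "X \<subseteq> U" by (auto simp: X_def X1_def)
  have "Ck_on 0 (\<lambda>x. (x, h x)) X" using continuous_on_subset[OF contg \<open>X \<subseteq> U\<close>] by simp
  then have "Ck_on (Suc 0) h X"
    by (intro Ck_on_I[OF X hder] DC) auto
  then have "Ck_on (Suc 0) (\<lambda>x. (x, h x)) X"
    by (rule Ck_on_Pair[OF X Ck_on_linear[OF X bounded_linear_ident]])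
  then have "Ck_on (Suc (Suc 0)) h X"
    by (intro Ck_on_I[OF X hder] DC) auto
  then show ?thesis using X x0 nz1 \<open>X \<subseteq> U\<close> by (intro exI[of _ X]) (auto simp: X_def two)
qed

text \<open>The defining function is the component of the flattening chart normal to the flattened set.\<close>

lemma regular_point_defining_function:
  fixes A :: "'a::euclidean_space set"
  assumes "regular_point A q"
  obtains \<rho> N w where "open N" "q \<in> N" "Ck_on 2 (\<rho> :: 'a \<Rightarrow> real) N" "\<And>z. z \<in> A \<inter> N \<Longrightarrow> \<rho> z = 0"
    "frechet_derivative \<rho> (at q) w \<noteq> 0"
proof -
  obtain G where G: "open G" "q \<in> G" "Ck_submanifold 2 (DIM('a) - 1) (A \<inter> G)" and q: "q \<in> A"
    using assms unfolding regular_point_def by blast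
  have "q \<in> A \<inter> G" using G q by blast
  from bspec[OF G(3)[unfolded Ck_submanifold_def] this]
  obtain W V L and \<psi> :: "'a \<Rightarrow> 'a" where \<psi>: "q \<in> W" "Ck_diffeo 2 \<psi> W V" "subspace L" "dim L = DIM('a) - 1"
    and flat: "\<psi> ` (A \<inter> G \<inter> W) = V \<inter> L" by blast
  have two: "(2::nat) = Suc (Suc 0)" by simp
  have W: "open W" "Ck_on 2 \<psi> W" using \<psi>(2) by (auto simp: Ck_diffeo_def)
  have "dim L < DIM('a)" using \<psi>(4) DIM_positive[where 'a='a] by linarith
  then obtain e where e: "e \<noteq> 0" "\<And>y. y \<in> span L \<Longrightarrow> orthogonal e y"
    using orthogonal_to_subspace_exists by blast
  note D = Ck_diffeo_derivatives[OF \<psi>(2)[unfolded two] \<psi>(1)]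
  let ?D = "frechet_derivative \<psi> (at q)" and ?E = "frechet_derivative (inv_into W \<psi>) (at (\<psi> q))"
  show thesis
  proof (rule that[of "G \<inter> W" "\<lambda>z. \<psi> z \<bullet> e" "?E e"])
    show "open (G \<inter> W)" "q \<in> G \<inter> W" using G W \<psi> by auto
    show "Ck_on 2 (\<lambda>z. \<psi> z \<bullet> e) (G \<inter> W)"
      by (rule Ck_on_subset[OF Ck_on_linear_compose[OF W(1) bounded_linear_inner_left W(2)]]) simp
    show "\<psi> z \<bullet> e = 0" if "z \<in> A \<inter> (G \<inter> W)" for z
    proof -
      have "\<psi> z \<in> L" using that flat by blast
      then show ?thesis using e(2)[of "\<psi> z"] by (simp add: span_base orthogonal_def inner_commute)
    qed
    have "((\<lambda>z. \<psi> z \<bullet> e) has_derivative (\<lambda>v. ?D v \<bullet> e)) (at q)"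
      by (rule has_derivative_inner_left[OF D(1)])
    then have "frechet_derivative (\<lambda>z. \<psi> z \<bullet> e) (at q) = (\<lambda>v. ?D v \<bullet> e)"
      by (rule frechet_derivative_at[symmetric])
    then show "frechet_derivative (\<lambda>z. \<psi> z \<bullet> e) (at q) (?E e) \<noteq> 0"
      using D(4)[of e] e(1) by simp
  qed
qed

text \<open>By continuity, bounds on a dense set hold everywhere on \<open>S\<close>. The gradient \<open>g\<close> is used in place of the
  derivative of \<open>h\<close>, since it takes its values in a Euclidean space.\<close>

lemma gradient_bounds:
  fixes h :: "'e::euclidean_space \<Rightarrow> real"
  assumes S: "open S" "Ck_on 2 h S" "S \<subseteq> closure V"
    and b1: "\<And>v. bounded ((\<lambda>x. frechet_derivative h (at x) v) ` V)"
    and b2: "\<And>v w. bounded ((\<lambda>x. frechet_derivative (\<lambda>y. frechet_derivative h (at y) v) (at x) w) ` V)"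
  obtains g g' B K where "B \<ge> 0" "\<And>x. x \<in> S \<Longrightarrow> (h has_derivative (\<lambda>v. g x \<bullet> v)) (at x)"
    "\<And>x v. x \<in> S \<Longrightarrow> \<bar>g x \<bullet> v\<bar> \<le> B * norm v"
    "\<And>x. x \<in> S \<Longrightarrow> (g has_derivative g' x) (at x)"
    "\<And>x v. x \<in> S \<Longrightarrow> norm (g' x v) \<le> K * norm v"
proof -
  define D where "D v x = frechet_derivative h (at x) v" for v x
  have two: "(2::nat) = Suc (Suc 0)" by simp
  have hder: "(h has_derivative (\<lambda>v. D v x)) (at x)" if "x \<in> S" for x
    using Ck_on_has_derivative[OF S(2)[unfolded two] that] by (simp add: D_def)
  have D1: "Ck_on (Suc 0) (D v) S" for v
    using S(2) unfolding two Ck_on.simps(2)[of "Suc 0"] D_def by blast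
  have Dder: "(D v has_derivative frechet_derivative (D v) (at x)) (at x)" if "x \<in> S" for x v
    by (rule Ck_on_has_derivative[OF D1 that])
  have "\<exists>b. \<forall>x\<in>S. \<bar>D v x\<bar> \<le> b" for v
  proof -
    obtain b where b: "\<And>x. x \<in> V \<Longrightarrow> \<bar>D v x\<bar> \<le> b"
      using b1[of v] unfolding bounded_iff D_def by auto
    have "\<bar>D v x\<bar> \<le> b" if "x \<in> S" for x
      by (rule le_on_open_if_le_on_dense[OF S(1) _ S(3) _ that, where f="\<lambda>x. \<bar>D v x\<bar>"])
        (use b in \<open>auto intro!: continuous_on_rabs Ck_on_imp_continuous[OF D1]\<close>)
    then show ?thesis by blast
  qed
  then obtain b where b: "\<And>v x. x \<in> S \<Longrightarrow> \<bar>D v x\<bar> \<le> b v" by metis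
  have "\<exists>c. \<forall>x\<in>S. \<bar>frechet_derivative (D v) (at x) w\<bar> \<le> c" for v w
  proof -
    obtain c where c: "\<And>x. x \<in> V \<Longrightarrow> \<bar>frechet_derivative (D v) (at x) w\<bar> \<le> c"
      using b2[of v w] unfolding bounded_iff D_def by auto
    have cont: "continuous_on S (\<lambda>x. frechet_derivative (D v) (at x) w)"
      using D1[of v] by simp
    have "\<bar>frechet_derivative (D v) (at x) w\<bar> \<le> c" if "x \<in> S" for x
      by (rule le_on_open_if_le_on_dense[OF S(1) _ S(3) _ that, where f="\<lambda>x. \<bar>frechet_derivative (D v) (at x) w\<bar>"])
        (use c in \<open>auto intro!: continuous_on_rabs cont\<close>)
    then show ?thesis by blast
  qed
  then obtain c where c: "\<And>v w x. x \<in> S \<Longrightarrow> \<bar>frechet_derivative (D v) (at x) w\<bar> \<le> c v w" by metis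
  have lin_bound: "\<bar>l v\<bar> \<le> (\<Sum>i\<in>Basis. \<bar>\<beta> i\<bar>) * norm v"
    if l: "linear l" and \<beta>: "\<And>i. i \<in> Basis \<Longrightarrow> \<bar>l i\<bar> \<le> \<beta> i" for l :: "'e \<Rightarrow> real" and \<beta> v
  proof -
    have "l v = l (\<Sum>i\<in>Basis. (v \<bullet> i) *\<^sub>R i)" by (simp only: euclidean_representation)
    also have "\<dots> = (\<Sum>i\<in>Basis. (v \<bullet> i) *\<^sub>R l i)" by (simp only: linear_sum[OF l] linear_scale[OF l])
    finally have "\<bar>l v\<bar> \<le> (\<Sum>i\<in>Basis. \<bar>(v \<bullet> i) *\<^sub>R l i\<bar>)" by (simp only: sum_abs)
    also have "\<dots> \<le> (\<Sum>i\<in>Basis. norm v * \<bar>\<beta> i\<bar>)"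
    proof (rule sum_mono)
      fix i :: 'e assume i: "i \<in> Basis"
      have "\<bar>l i\<bar> \<le> \<bar>\<beta> i\<bar>" using \<beta>[OF i] by linarith
      then show "\<bar>(v \<bullet> i) *\<^sub>R l i\<bar> \<le> norm v * \<bar>\<beta> i\<bar>"
        using Basis_le_norm[OF i, of v] by (simp add: abs_mult mult_mono)
    qed
    also have "\<dots> = (\<Sum>i\<in>Basis. \<bar>\<beta> i\<bar>) * norm v" by (simp add: sum_distrib_left mult.commute)
    finally show ?thesis .
  qed
  define g where "g x = (\<Sum>i\<in>Basis. D i x *\<^sub>R i)" for x
  define g' where "g' x w = (\<Sum>i\<in>Basis. frechet_derivative (D i) (at x) w *\<^sub>R i)" for x w
  have gD: "g x \<bullet> v = D v x" if x: "x \<in> S" for x v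
  proof -
    have l: "linear (\<lambda>v. D v x)" using hder[OF x] by (rule has_derivative_linear)
    have "D v x = D (\<Sum>i\<in>Basis. (v \<bullet> i) *\<^sub>R i) x" by (simp only: euclidean_representation)
    also have "\<dots> = (\<Sum>i\<in>Basis. (v \<bullet> i) *\<^sub>R D i x)" by (simp only: linear_sum[OF l] linear_scale[OF l])
    also have "\<dots> = g x \<bullet> v"
      unfolding g_def inner_sum_left by (rule sum.cong) (simp_all add: inner_commute mult.commute)
    finally show ?thesis ..
  qed
  show thesis
  proof (rule that[of "\<Sum>i\<in>Basis. \<bar>b i\<bar>" g g' "\<Sum>i\<in>Basis. \<Sum>j\<in>Basis. \<bar>c i j\<bar>"])
    show "(\<Sum>i\<in>Basis. \<bar>b i\<bar>) \<ge> 0" by (simp add: sum_nonneg)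
    fix x assume x: "x \<in> S"
    have "(\<lambda>v. g x \<bullet> v) = (\<lambda>v. D v x)" by (rule ext) (rule gD[OF x])
    then show "(h has_derivative (\<lambda>v. g x \<bullet> v)) (at x)" using hder[OF x] by (simp only:)
    show "(g has_derivative g' x) (at x)"
      unfolding g_def g'_def by (intro has_derivative_sum has_derivative_scaleR_left Dder[OF x])
    fix v
    show "\<bar>g x \<bullet> v\<bar> \<le> (\<Sum>i\<in>Basis. \<bar>b i\<bar>) * norm v"
      unfolding gD[OF x] by (rule lin_bound[OF has_derivative_linear[OF hder[OF x]] b[OF x]])
    have "norm (g' x v) \<le> (\<Sum>i\<in>Basis. norm (frechet_derivative (D i) (at x) v *\<^sub>R (i::'e)))"
      unfolding g'_def by (rule norm_sum)
    also have "\<dots> \<le> (\<Sum>i\<in>(Basis::'e set). (\<Sum>j\<in>Basis. \<bar>c i j\<bar>) * norm v)"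
    proof (rule sum_mono)
      fix i :: 'e assume i: "i \<in> Basis"
      have "\<bar>frechet_derivative (D i) (at x) v\<bar> \<le> (\<Sum>j\<in>Basis. \<bar>c i j\<bar>) * norm v"
        by (rule lin_bound[OF has_derivative_linear[OF Dder[OF x]] c[OF x]])
      then show "norm (frechet_derivative (D i) (at x) v *\<^sub>R i) \<le> (\<Sum>j\<in>Basis. \<bar>c i j\<bar>) * norm v"
        using i by simp
    qed
    also have "\<dots> = (\<Sum>i\<in>Basis. \<Sum>j\<in>Basis. \<bar>c i j\<bar>) * norm v" by (simp add: sum_distrib_right)
    finally show "norm (g' x v) \<le> (\<Sum>i\<in>Basis. \<Sum>j\<in>Basis. \<bar>c i j\<bar>) * norm v" .
  qed
qed

section \<open>One-sided derivatives\<close>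

text \<open>By the mean value theorem \<open>f - l\<close> has a small Lipschitz constant near \<open>x0\<close> in \<open>C\<close>, and by density in \<open>S\<close>.\<close>

lemma derivative_within_convex_closure:
  fixes f :: "'a::euclidean_space \<Rightarrow> real"
  assumes C: "open C" "convex C" "C \<subseteq> S" "S \<subseteq> closure C" and x0: "x0 \<in> S" and cont: "continuous_on S f"
    and der: "\<And>x. x \<in> C \<Longrightarrow> (f has_derivative F x) (at x)"
    and lim: "\<And>e. e > 0 \<Longrightarrow> \<exists>d>0. \<forall>x\<in>C. norm (x - x0) < d \<longrightarrow> (\<forall>v. \<bar>F x v - l v\<bar> \<le> e * norm v)"
    and l: "bounded_linear l"
  shows "(f has_derivative l) (at x0 within S)"
  unfolding has_derivative_within_alt
proof (intro conjI allI impI l)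
  fix e :: real assume e: "e > 0"
  obtain d where d: "d > 0" "\<And>x v. x \<in> C \<Longrightarrow> norm (x - x0) < d \<Longrightarrow> \<bar>F x v - l v\<bar> \<le> e * norm v"
    using lim[OF e] by blast
  define D where "D = C \<inter> ball x0 d"
  have D: "convex D" "open D" unfolding D_def using C by (auto intro: convex_Int)
  have contl: "continuous_on X l" for X using l by (rule linear_continuous_on)
  have in_cl: "y \<in> closure D" if "y \<in> S" "norm (y - x0) < d" for y
  proof -
    have "y \<in> ball x0 d \<inter> closure C" using that C(4) by (auto simp: dist_norm norm_minus_commute)
    then have "y \<in> closure (ball x0 d \<inter> C)" using open_Int_closure_subset[of "ball x0 d" C] by blast
    then show ?thesis unfolding D_def Int_commute[of C] .
  qed
  have D_bound: "\<bar>(f y - l y) - (f x - l x)\<bar> \<le> e * norm (y - x)" if "x \<in> D" "y \<in> D" for x y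
  proof -
    have "norm ((f y - l y) - (f x - l x)) \<le> e * norm (y - x)"
    proof (rule differentiable_bound[OF D(1), where f'="\<lambda>x v. F x v - l v"])
      fix z assume z: "z \<in> D"
      then have "(f has_derivative F z) (at z)" using der by (simp add: D_def)
      then show "((\<lambda>x. f x - l x) has_derivative (\<lambda>v. F z v - l v)) (at z within D)"
        by (intro has_derivative_diff bounded_linear_imp_has_derivative[OF l]) (rule has_derivative_at_withinI)
      show "onorm (\<lambda>v. F z v - l v) \<le> e"
        using d(2)[of z] z e by (intro onorm_bound) (auto simp: D_def dist_norm norm_minus_commute)
    qed (use that in auto)
    then show ?thesis by simp
  qed
  show "\<exists>d>0. \<forall>y\<in>S. norm (y - x0) < d \<longrightarrow> norm (f y - f x0 - l (y - x0)) \<le> e * norm (y - x0)"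
  proof (intro exI[of _ d] conjI ballI impI d(1))
    fix y assume y: "y \<in> S" "norm (y - x0) < d"
    obtain u where u: "\<And>n::nat. u n \<in> D" "u \<longlonglongrightarrow> y"
      using in_cl[OF y] unfolding closure_sequential by (elim exE conjE) (rule that, auto)
    obtain w where w: "\<And>n::nat. w n \<in> D" "w \<longlonglongrightarrow> x0"
    proof -
      have "x0 \<in> closure D" by (rule in_cl[OF x0]) (use d(1) in simp)
      then show thesis unfolding closure_sequential by (elim exE conjE) (rule that, auto)
    qed
    have DS: "D \<subseteq> S" using C(3) by (auto simp: D_def)
    have fl: "(\<lambda>n. f (s n) - l (s n)) \<longlonglongrightarrow> f z - l z" if "\<And>n. s n \<in> D" "s \<longlonglongrightarrow> z" "z \<in> S" for s :: "nat \<Rightarrow> 'a" and z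
    proof (rule continuous_on_tendsto_compose[of S "\<lambda>x. f x - l x"])
      show "continuous_on S (\<lambda>x. f x - l x)" by (intro continuous_on_diff cont contl)
      show "s \<longlonglongrightarrow> z" "z \<in> S" by fact+
      show "\<forall>\<^sub>F n in sequentially. s n \<in> S" using that(1) DS by (intro always_eventually) blast
    qed
    have "\<bar>(f y - l y) - (f x0 - l x0)\<bar> \<le> e * norm (y - x0)"
    proof (rule LIMSEQ_le)
      show "(\<lambda>n. \<bar>(f (u n) - l (u n)) - (f (w n) - l (w n))\<bar>) \<longlonglongrightarrow> \<bar>(f y - l y) - (f x0 - l x0)\<bar>"
        by (intro tendsto_rabs tendsto_diff[OF fl[OF u y(1)] fl[OF w x0]])
      show "(\<lambda>n. e * norm (u n - w n)) \<longlonglongrightarrow> e * norm (y - x0)"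
        by (intro tendsto_mult tendsto_norm tendsto_diff tendsto_const u w)
      show "\<exists>N. \<forall>n\<ge>N. \<bar>(f (u n) - l (u n)) - (f (w n) - l (w n))\<bar> \<le> e * norm (u n - w n)"
        using D_bound[OF w(1) u(1)] by blast
    qed
    moreover have "l (y - x0) = l y - l x0" by (rule linear_diff[OF bounded_linear.linear[OF l]])
    ultimately show "norm (f y - f x0 - l (y - x0)) \<le> e * norm (y - x0)" by simp
  qed
qed

lemma half_ball_closure:
  fixes \<nu> :: "'e::euclidean_space"
  assumes "\<nu> \<noteq> 0"
  shows "{x \<in> ball 0 r. x \<bullet> \<nu> \<ge> 0} \<subseteq> closure {x \<in> ball 0 r. x \<bullet> \<nu> > 0}"
proof
  fix x assume x: "x \<in> {x \<in> ball 0 r. x \<bullet> \<nu> \<ge> 0}"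
  show "x \<in> closure {x \<in> ball 0 r. x \<bullet> \<nu> > 0}"
    unfolding closure_approachable
  proof (intro allI impI)
    fix e :: real assume e: "e > 0"
    define s where "s = min (e / 2) ((r - norm x) / 2) / norm \<nu>"
    have s: "s > 0" using x e assms by (auto simp: s_def)
    have xr: "norm x < r" using x by simp
    then have "0 < min (e / 2) ((r - norm x) / 2)" using e by auto
    then have "norm (s *\<^sub>R \<nu>) = min (e / 2) ((r - norm x) / 2)"
      unfolding s_def norm_scaleR using assms by (simp only: abs_divide abs_norm_cancel abs_of_pos) simp
    then have "norm (s *\<^sub>R \<nu>) \<le> e / 2" "norm (s *\<^sub>R \<nu>) \<le> (r - norm x) / 2"
      by (simp_all only: min.cobounded1 min.cobounded2)
    then have n: "norm (s *\<^sub>R \<nu>) < e" "norm (s *\<^sub>R \<nu>) < r - norm x"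
      using e xr by argo+
    have "(x + s *\<^sub>R \<nu>) \<bullet> \<nu> > 0" using x s assms by (auto simp: inner_add_left add_nonneg_pos)
    moreover have "x + s *\<^sub>R \<nu> \<in> ball 0 r" using n(2) norm_triangle_ineq[of x "s *\<^sub>R \<nu>"] by simp
    moreover have "dist (x + s *\<^sub>R \<nu>) x < e" using n(1) by (simp add: dist_norm)
    ultimately show "\<exists>y\<in>{x \<in> ball 0 r. x \<bullet> \<nu> > 0}. dist y x < e" by blast
  qed
qed

text \<open>The gradient of \<open>h\<close>, transported by \<open>\<Psi>\<close> to the open half ball, is Lipschitz because the half ball is
  convex; hence it extends continuously to the flat boundary, and the extension gives the one-sided derivatives.\<close>

lemma one_sided_C1:
  fixes \<Psi> :: "'e::euclidean_space \<Rightarrow> 'e" and h :: "'e \<Rightarrow> real" and g :: "'e \<Rightarrow> 'e" and \<nu> :: 'e and r :: real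
  assumes \<nu>: "\<nu> \<noteq> 0"
  defines "C \<equiv> {x \<in> ball 0 r. x \<bullet> \<nu> > 0}" and "S \<equiv> {x \<in> ball 0 r. x \<bullet> \<nu> \<ge> 0}"
  assumes \<Psi>: "\<And>x. x \<in> ball 0 r \<Longrightarrow> (\<Psi> has_derivative blinfun_apply (\<Psi>d x)) (at x)"
      "continuous_on (ball 0 r) \<Psi>d" "\<And>x. x \<in> ball 0 r \<Longrightarrow> norm (\<Psi>d x) \<le> K2"
    and h: "continuous_on (\<Psi> ` S) h" "\<And>x. x \<in> C \<Longrightarrow> (h has_derivative (\<lambda>v. g (\<Psi> x) \<bullet> v)) (at (\<Psi> x))"
    and g: "\<And>x. x \<in> C \<Longrightarrow> (g has_derivative g' (\<Psi> x)) (at (\<Psi> x))"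
      "\<And>x v. x \<in> C \<Longrightarrow> norm (g' (\<Psi> x) v) \<le> K1 * norm v"
  obtains G where "continuous_on S G"
    "\<And>x. x \<in> S \<Longrightarrow> ((\<lambda>x. h (\<Psi> x)) has_derivative (\<lambda>v. G x \<bullet> blinfun_apply (\<Psi>d x) v)) (at x within S)"
proof -
  have C: "open C" "convex C" "C \<subseteq> S" "S \<subseteq> ball 0 r"
  proof -
    have "C = ball 0 r \<inter> {x. \<nu> \<bullet> x > 0}" by (auto simp: C_def inner_commute)
    then show "open C" "convex C" by (simp_all add: open_Int open_halfspace_gt convex_Int convex_halfspace_gt)
  qed (auto simp: C_def S_def)
  have SC: "S \<subseteq> closure C" unfolding S_def C_def by (rule half_ball_closure[OF \<nu>])
  define K where "K = \<bar>K1\<bar> * \<bar>K2\<bar>"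
  have lip: "norm (g (\<Psi> y) - g (\<Psi> x)) \<le> K * norm (y - x)" if "x \<in> C" "y \<in> C" for x y
  proof (rule differentiable_bound[OF C(2), where f'="\<lambda>x v. g' (\<Psi> x) (blinfun_apply (\<Psi>d x) v)"])
    fix z assume z: "z \<in> C"
    then have zb: "z \<in> ball 0 r" using C by blast
    show "((\<lambda>x. g (\<Psi> x)) has_derivative (\<lambda>v. g' (\<Psi> z) (blinfun_apply (\<Psi>d z) v))) (at z within C)"
      by (rule has_derivative_at_withinI[OF has_derivative_compose[OF \<Psi>(1)[OF zb] g(1)[OF z]]])
    show "onorm (\<lambda>v. g' (\<Psi> z) (blinfun_apply (\<Psi>d z) v)) \<le> K"
    proof (rule onorm_bound)
      fix v
      have "norm (blinfun_apply (\<Psi>d z) v) \<le> \<bar>K2\<bar> * norm v"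
        using norm_blinfun[of "\<Psi>d z" v] \<Psi>(3)[OF zb] by (smt (verit) mult_right_mono norm_ge_zero)
      then have "norm (g' (\<Psi> z) (blinfun_apply (\<Psi>d z) v)) \<le> \<bar>K1\<bar> * (\<bar>K2\<bar> * norm v)"
        using g(2)[OF z, of "blinfun_apply (\<Psi>d z) v"]
        by (smt (verit) mult_mono norm_ge_zero)
      then show "norm (g' (\<Psi> z) (blinfun_apply (\<Psi>d z) v)) \<le> K * norm v" by (simp add: K_def mult.assoc)
    qed (simp add: K_def)
  qed (use that in auto)
  have "uniformly_continuous_on C (\<lambda>x. g (\<Psi> x))"
    unfolding uniformly_continuous_on_def
  proof (intro allI impI)
    fix e :: real assume e: "e > 0"
    have K0: "K \<ge> 0" by (simp add: K_def)
    show "\<exists>d>0. \<forall>x\<in>C. \<forall>x'\<in>C. dist x' x < d \<longrightarrow> dist (g (\<Psi> x')) (g (\<Psi> x)) < e"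
    proof (intro exI[of _ "e / (K + 1)"] conjI ballI impI)
      show "e / (K + 1) > 0" using e K0 by simp
      fix x x' assume x: "x \<in> C" "x' \<in> C" "dist x' x < e / (K + 1)"
      have "norm (g (\<Psi> x') - g (\<Psi> x)) \<le> K * norm (x' - x)" by (rule lip) (use x in auto)
      also have "\<dots> \<le> (K + 1) * norm (x' - x)" by (simp add: algebra_simps)
      also have "\<dots> < e" using x(3) K0 by (simp add: dist_norm pos_less_divide_eq mult.commute)
      finally show "dist (g (\<Psi> x')) (g (\<Psi> x)) < e" by (simp add: dist_norm)
    qed
  qed
  from uniformly_continuous_on_extension_on_closure[OF this]
  obtain G where G: "uniformly_continuous_on (closure C) G" "\<And>x. x \<in> C \<Longrightarrow> g (\<Psi> x) = G x" by metis
  have contG: "continuous_on (closure C) G" by (rule uniformly_continuous_imp_continuous[OF G(1)])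
  have cont\<Psi>: "continuous_on S \<Psi>"
    using \<Psi>(1) C(4) by (meson continuous_at_imp_continuous_on has_derivative_continuous subsetD)
  show thesis
  proof (rule that)
    show "continuous_on S G" using contG SC by (rule continuous_on_subset)
    fix x0 assume x0: "x0 \<in> S"
    have x0b: "x0 \<in> ball 0 r" using x0 C by blast
    show "((\<lambda>x. h (\<Psi> x)) has_derivative (\<lambda>v. G x0 \<bullet> blinfun_apply (\<Psi>d x0) v)) (at x0 within S)"
    proof (rule derivative_within_convex_closure[OF C(1,2,3) SC x0])
      show "continuous_on S (\<lambda>x. h (\<Psi> x))"
        by (rule continuous_on_compose2[OF h(1) cont\<Psi>]) simp
      show "((\<lambda>x. h (\<Psi> x)) has_derivative (\<lambda>v. G x \<bullet> blinfun_apply (\<Psi>d x) v)) (at x)" if x: "x \<in> C" for x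
      proof -
        have "x \<in> ball 0 r" using x C by blast
        from has_derivative_compose[OF \<Psi>(1)[OF this] h(2)[OF x]]
        show ?thesis by (simp add: G(2)[OF x])
      qed
      show "bounded_linear (\<lambda>v. G x0 \<bullet> blinfun_apply (\<Psi>d x0) v)"
        by (rule bounded_linear_compose[OF bounded_linear_inner_right blinfun.bounded_linear_right])
      fix e :: real assume e: "e > 0"
      define k where "k = norm (\<Psi>d x0) + norm (G x0) + 2"
      have k: "k > 0" "norm (\<Psi>d x0) + 1 \<le> k" "norm (G x0) \<le> k"
        unfolding k_def using norm_ge_zero[of "\<Psi>d x0"] norm_ge_zero[of "G x0"] by linarith+
      define e' where "e' = min 1 (e / (2 * k))"
      have e': "e' > 0" "e' \<le> 1" "e' * k \<le> e / 2"
      proof -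
        show "e' > 0" "e' \<le> 1" using e k by (auto simp: e'_def)
        have "e' * k \<le> e / (2 * k) * k" unfolding e'_def using k(1) by (intro mult_right_mono) auto
        then show "e' * k \<le> e / 2" using k(1) by simp
      qed
      have x0cl: "x0 \<in> closure C" using x0 SC by blast
      obtain d1 where d1: "d1 > 0" "\<And>x. x \<in> closure C \<Longrightarrow> dist x x0 < d1 \<Longrightarrow> dist (G x) (G x0) < e'"
        using contG x0cl e'(1) unfolding continuous_on_iff by meson
      obtain d2 where d2: "d2 > 0" "\<And>x. x \<in> ball 0 r \<Longrightarrow> dist x x0 < d2 \<Longrightarrow> dist (\<Psi>d x) (\<Psi>d x0) < e'"
        using \<Psi>(2) x0b e'(1) unfolding continuous_on_iff by meson
      show "\<exists>d>0. \<forall>x\<in>C. norm (x - x0) < d \<longrightarrow>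
          (\<forall>v. \<bar>G x \<bullet> blinfun_apply (\<Psi>d x) v - G x0 \<bullet> blinfun_apply (\<Psi>d x0) v\<bar> \<le> e * norm v)"
      proof (intro exI[of _ "min d1 d2"] conjI ballI impI allI)
        fix x v assume x: "x \<in> C" "norm (x - x0) < min d1 d2"
        have n1: "norm (G x - G x0) \<le> e'" using d1(2)[of x] x closure_subset[of C] by (auto simp: dist_norm)
        have n2: "norm (\<Psi>d x - \<Psi>d x0) \<le> e'" using d2(2)[of x] x C by (auto simp: dist_norm)
        have n3: "norm (\<Psi>d x) \<le> k" using n2 e'(2) k(2) norm_triangle_ineq2[of "\<Psi>d x" "\<Psi>d x0"] by linarith
        have "G x \<bullet> blinfun_apply (\<Psi>d x) v - G x0 \<bullet> blinfun_apply (\<Psi>d x0) v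
            = (G x - G x0) \<bullet> blinfun_apply (\<Psi>d x) v + G x0 \<bullet> blinfun_apply (\<Psi>d x - \<Psi>d x0) v"
          by (simp add: inner_diff_left inner_diff_right blinfun.diff_left)
        also have "\<bar>\<dots>\<bar> \<le> norm (G x - G x0) * norm (blinfun_apply (\<Psi>d x) v) + norm (G x0) * norm (blinfun_apply (\<Psi>d x - \<Psi>d x0) v)"
          by (intro order_trans[OF abs_triangle_ineq] add_mono Cauchy_Schwarz_ineq2)
        also have "\<dots> \<le> e' * (k * norm v) + k * (e' * norm v)"
        proof (intro add_mono mult_mono n1 k(3))
          show "norm (blinfun_apply (\<Psi>d x) v) \<le> k * norm v"
            by (rule order_trans[OF norm_blinfun mult_right_mono[OF n3]]) simp
          show "norm (blinfun_apply (\<Psi>d x - \<Psi>d x0) v) \<le> e' * norm v"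
            by (rule order_trans[OF norm_blinfun mult_right_mono[OF n2]]) simp
        qed (use e' k in auto)
        also have "\<dots> = 2 * (e' * k) * norm v" by simp
        also have "\<dots> \<le> e * norm v" using e'(3) by (intro mult_right_mono) auto
        finally show "\<bar>G x \<bullet> blinfun_apply (\<Psi>d x) v - G x0 \<bullet> blinfun_apply (\<Psi>d x0) v\<bar> \<le> e * norm v" .
      qed (use d1 d2 in auto)
    qed
  qed
qed

text \<open>The two one-sided derivatives agree on the common boundary hyperplane, so they differ by a multiple of the
  normal component.\<close>

lemma kink_expansion:
  fixes f :: "'e::euclidean_space \<Rightarrow> real"
  assumes x: "x \<in> ball 0 r" "x \<bullet> \<nu> = 0" and \<nu>: "norm \<nu> = 1"
    and p: "(f has_derivative lp) (at x within {y \<in> ball 0 r. y \<bullet> \<nu> \<ge> 0})"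
    and m: "(f has_derivative lm) (at x within {y \<in> ball 0 r. y \<bullet> \<nu> \<le> 0})"
  shows "lp v = lm v + (v \<bullet> \<nu>) * (lp \<nu> - lm \<nu>)"
    and "e > 0 \<Longrightarrow> \<exists>d>0. \<forall>y. norm (y - x) < d \<longrightarrow>
       ((y - x) \<bullet> \<nu> \<ge> 0 \<longrightarrow> \<bar>f y - f x - lp (y - x)\<bar> \<le> e * norm (y - x)) \<and>
       ((y - x) \<bullet> \<nu> \<le> 0 \<longrightarrow> \<bar>f y - f x - lm (y - x)\<bar> \<le> e * norm (y - x))"
proof -
  have main: "\<exists>d>0. \<forall>y. norm (y - x) < d \<longrightarrow>
       ((y - x) \<bullet> \<nu> \<ge> 0 \<longrightarrow> \<bar>f y - f x - lp (y - x)\<bar> \<le> e * norm (y - x)) \<and>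
       ((y - x) \<bullet> \<nu> \<le> 0 \<longrightarrow> \<bar>f y - f x - lm (y - x)\<bar> \<le> e * norm (y - x))" if e: "e > 0" for e
  proof -
    obtain d1 where d1: "d1 > 0" "\<And>y. y \<in> {y \<in> ball 0 r. y \<bullet> \<nu> \<ge> 0} \<Longrightarrow> norm (y - x) < d1 \<Longrightarrow>
        norm (f y - f x - lp (y - x)) \<le> e * norm (y - x)"
      using p e unfolding has_derivative_within_alt by blast
    obtain d2 where d2: "d2 > 0" "\<And>y. y \<in> {y \<in> ball 0 r. y \<bullet> \<nu> \<le> 0} \<Longrightarrow> norm (y - x) < d2 \<Longrightarrow>
        norm (f y - f x - lm (y - x)) \<le> e * norm (y - x)"
      using m e unfolding has_derivative_within_alt by blast
    obtain d3 where d3: "d3 > 0" "ball x d3 \<subseteq> ball 0 r" using x(1) open_contains_ball[of "ball 0 r"] open_ball by blast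
    show ?thesis
    proof (intro exI[of _ "min d1 (min d2 d3)"] conjI allI impI)
      fix y assume "norm (y - x) < min d1 (min d2 d3)"
      then have y: "norm (y - x) < d1" "norm (y - x) < d2" "y \<in> ball x d3"
        by (simp_all add: dist_norm norm_minus_commute)
      then have yb: "y \<in> ball 0 r" using d3 by blast
      { assume "(y - x) \<bullet> \<nu> \<ge> 0"
        then have "y \<in> {y \<in> ball 0 r. y \<bullet> \<nu> \<ge> 0}" using yb x(2) by (simp add: inner_diff_left)
        from d1(2)[OF this y(1)] show "\<bar>f y - f x - lp (y - x)\<bar> \<le> e * norm (y - x)" by simp }
      { assume "(y - x) \<bullet> \<nu> \<le> 0"
        then have "y \<in> {y \<in> ball 0 r. y \<bullet> \<nu> \<le> 0}" using yb x(2) by (simp add: inner_diff_left)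
        from d2(2)[OF this y(2)] show "\<bar>f y - f x - lm (y - x)\<bar> \<le> e * norm (y - x)" by simp }
    qed (use d1 d2 d3 in auto)
  qed
  then show "e > 0 \<Longrightarrow> \<exists>d>0. \<forall>y. norm (y - x) < d \<longrightarrow>
       ((y - x) \<bullet> \<nu> \<ge> 0 \<longrightarrow> \<bar>f y - f x - lp (y - x)\<bar> \<le> e * norm (y - x)) \<and>
       ((y - x) \<bullet> \<nu> \<le> 0 \<longrightarrow> \<bar>f y - f x - lm (y - x)\<bar> \<le> e * norm (y - x))" .
  have linp: "linear lp" using p by (rule has_derivative_linear)
  have linm: "linear lm" using m by (rule has_derivative_linear)
  have flat: "lp w = lm w" if w: "w \<bullet> \<nu> = 0" for w
  proof (rule ccontr)
    assume neq: "lp w \<noteq> lm w"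
  \<comment> \<open>The points \<open>x + s w\<close> belong to both closed half balls, so both expansions hold there.\<close>
    have nw: "norm w + 1 > 0" by (simp add: add_nonneg_pos)
    define e where "e = \<bar>lp w - lm w\<bar> / (4 * (norm w + 1))"
    have e: "e > 0" using neq nw by (simp add: e_def)
    obtain d where d: "d > 0" "\<And>y. norm (y - x) < d \<Longrightarrow>
       ((y - x) \<bullet> \<nu> \<ge> 0 \<longrightarrow> \<bar>f y - f x - lp (y - x)\<bar> \<le> e * norm (y - x)) \<and>
       ((y - x) \<bullet> \<nu> \<le> 0 \<longrightarrow> \<bar>f y - f x - lm (y - x)\<bar> \<le> e * norm (y - x))"
      using main[OF e] by blast
    define s where "s = d / (2 * (norm w + 1))"
    have s: "s > 0" using d nw by (simp add: s_def)
    have "s * norm w \<le> s * (norm w + 1)" using s by simp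
    also have "\<dots> = d / 2" unfolding s_def
    proof -
      have "X / (2 * N) * N = X / 2" if "N > 0" for X N :: real using that by simp
      from this[OF nw] show "d / (2 * (norm w + 1)) * (norm w + 1) = d / 2" .
    qed
    finally have "norm (x + s *\<^sub>R w - x) < d" using s d(1) by simp
    from d(2)[OF this] have "\<bar>f (x + s *\<^sub>R w) - f x - lp (s *\<^sub>R w)\<bar> \<le> e * (s * norm w)"
       "\<bar>f (x + s *\<^sub>R w) - f x - lm (s *\<^sub>R w)\<bar> \<le> e * (s * norm w)" using s w by simp_all
    then have "\<bar>lp (s *\<^sub>R w) - lm (s *\<^sub>R w)\<bar> \<le> 2 * (e * (s * norm w))" by linarith
    moreover have "lp (s *\<^sub>R w) - lm (s *\<^sub>R w) = s * (lp w - lm w)"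
      by (simp only: linear_scale[OF linp] linear_scale[OF linm] real_scaleR_def right_diff_distrib)
    ultimately have "s * \<bar>lp w - lm w\<bar> \<le> s * (2 * e * norm w)" using s by (simp add: abs_mult mult_ac)
    then have "\<bar>lp w - lm w\<bar> \<le> 2 * e * norm w" using s by simp
    also have "\<dots> \<le> 2 * (e * (norm w + 1))" using e by simp
    also have "e * (norm w + 1) = \<bar>lp w - lm w\<bar> / 4"
    proof -
      have "X / (4 * N) * N = X / 4" if "N > 0" for X N :: real using that by simp
      from this[OF nw] show ?thesis unfolding e_def .
    qed
    finally show False using neq by simp
  qed
  define w where "w = v - (v \<bullet> \<nu>) *\<^sub>R \<nu>"
  have "\<nu> \<bullet> \<nu> = 1" using \<nu> by (simp add: dot_square_norm)
  then have "w \<bullet> \<nu> = 0" by (simp add: w_def inner_diff_left)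
  from flat[OF this] have "lp v - (v \<bullet> \<nu>) * lp \<nu> = lm v - (v \<bullet> \<nu>) * lm \<nu>"
    unfolding w_def linear_diff[OF linp] linear_diff[OF linm] linear_scale[OF linp] linear_scale[OF linm] by simp
  then show "lp v = lm v + (v \<bullet> \<nu>) * (lp \<nu> - lm \<nu>)" by (simp add: right_diff_distrib)
qed

section \<open>Tangent cones of epigraphs\<close>

lemma has_derivative_imp_pointwise_lipschitz:
  assumes "(f has_derivative f') (at p)"
  obtains K d where "K > 0" "d > 0" "\<And>z. norm (z - p) < d \<Longrightarrow> norm (f z - f p) \<le> K * norm (z - p)"
proof -
  obtain B where B: "B > 0" "\<And>v. norm (f' v) \<le> B * norm v"
    using bounded_linear.pos_bounded[OF has_derivative_bounded_linear[OF assms]] by (auto simp: mult.commute)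
  obtain d where d: "d > 0" "\<And>z. norm (z - p) < d \<Longrightarrow> norm (f z - f p - f' (z - p)) \<le> 1 * norm (z - p)"
    using assms unfolding has_derivative_at_alt by (metis zero_less_one)
  show thesis
  proof (rule that[of "B + 1" d])
    fix z assume "norm (z - p) < d"
    then show "norm (f z - f p) \<le> (B + 1) * norm (z - p)"
      using d(2)[of z] B(2)[of "z - p"] norm_triangle_sub[of "f z - f p" "f' (z - p)"] by (simp add: algebra_simps)
  qed (use B d in auto)
qed

text \<open>If \<open>l\<close> bounds the increments of \<open>h\<close> from above to first order, then the subgraph of \<open>h\<close> lies
  to first order in the half-space below the graph of \<open>l\<close>.\<close>

lemma subgraph_wedge:
  fixes \<Phi> :: "'a::real_normed_vector \<Rightarrow> 'e::real_normed_vector \<times> real" and h :: "'e \<Rightarrow> real"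
  assumes \<Phi>: "(\<Phi> has_derivative \<Phi>') (at p)" and Q: "open Q" "p \<in> Q"
    and below: "\<And>z. z \<in> Q \<Longrightarrow> z \<notin> \<Omega> \<Longrightarrow> snd (\<Phi> z) \<le> h (fst (\<Phi> z))" and p: "snd (\<Phi> p) = h (fst (\<Phi> p))"
    and l: "bounded_linear l"
    and upper: "\<And>e. e > 0 \<Longrightarrow> \<exists>d>0. \<forall>y. norm (y - fst (\<Phi> p)) < d \<longrightarrow>
        h y - h (fst (\<Phi> p)) \<le> l (y - fst (\<Phi> p)) + e * norm (y - fst (\<Phi> p))"
    and \<eta>: "\<eta> > 0"
  shows "\<exists>\<delta>>0. \<forall>z. norm (z - p) < \<delta> \<and> z \<notin> \<Omega> \<longrightarrow> snd (\<Phi>' (z - p)) - l (fst (\<Phi>' (z - p))) \<le> \<eta> * norm (z - p)"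
proof -
  obtain K d0 where K: "K > 0" "d0 > 0" "\<And>z. norm (z - p) < d0 \<Longrightarrow> norm (\<Phi> z - \<Phi> p) \<le> K * norm (z - p)"
    using has_derivative_imp_pointwise_lipschitz[OF \<Phi>] by blast
  define k where "k z = snd (\<Phi> z) - l (fst (\<Phi> z))" for z
  have k: "(k has_derivative (\<lambda>v. snd (\<Phi>' v) - l (fst (\<Phi>' v)))) (at p)"
    unfolding k_def by (intro has_derivative_diff has_derivative_snd has_derivative_fst bounded_linear.has_derivative[OF l] \<Phi>)
  have lin: "l (x - y) = l x - l y" for x y by (rule linear_diff[OF bounded_linear.linear[OF l]])
  have "\<eta> / 2 > 0" using \<eta> by simp
  then obtain d1 where d1: "d1 > 0" "\<And>z. norm (z - p) < d1 \<Longrightarrow>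
      norm (k z - k p - (snd (\<Phi>' (z - p)) - l (fst (\<Phi>' (z - p))))) \<le> \<eta> / 2 * norm (z - p)"
    using k unfolding has_derivative_at_alt by blast
  have "\<eta> / (2 * K) > 0" using \<eta> K by simp
  from upper[OF this] obtain d2 where d2: "d2 > 0" "\<And>y. norm (y - fst (\<Phi> p)) < d2 \<Longrightarrow>
        h y - h (fst (\<Phi> p)) \<le> l (y - fst (\<Phi> p)) + \<eta> / (2 * K) * norm (y - fst (\<Phi> p))" by blast
  obtain d3 where d3: "d3 > 0" "ball p d3 \<subseteq> Q" using Q open_contains_ball by blast
  show ?thesis
  proof (intro exI[of _ "min (min d0 d1) (min (d2 / K) d3)"] conjI allI impI)
    fix z assume "norm (z - p) < min (min d0 d1) (min (d2 / K) d3) \<and> z \<notin> \<Omega>"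
    then have z: "norm (z - p) < d0" "norm (z - p) < d1" "norm (z - p) < d2 / K" "z \<in> ball p d3" "z \<notin> \<Omega>"
      by (auto simp: dist_norm norm_minus_commute)
    have n: "norm (fst (\<Phi> z) - fst (\<Phi> p)) \<le> K * norm (z - p)"
    proof -
      have "norm (fst (\<Phi> z - \<Phi> p)) \<le> norm (\<Phi> z - \<Phi> p)" by (metis norm_fst_le prod.collapse)
      then show ?thesis using K(3)[OF z(1)] by simp
    qed
    also have "\<dots> < d2" using z(3) K(1) by (simp add: pos_less_divide_eq mult.commute)
    finally have "h (fst (\<Phi> z)) - h (fst (\<Phi> p)) \<le> l (fst (\<Phi> z) - fst (\<Phi> p)) + \<eta> / (2 * K) * norm (fst (\<Phi> z) - fst (\<Phi> p))"
      by (rule d2(2))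
    also have "\<eta> / (2 * K) * norm (fst (\<Phi> z) - fst (\<Phi> p)) \<le> \<eta> / (2 * K) * (K * norm (z - p))"
      using n \<eta> K by (intro mult_left_mono) auto
    also have "\<dots> = \<eta> / 2 * norm (z - p)" using K by simp
    finally have "h (fst (\<Phi> z)) - h (fst (\<Phi> p)) \<le> l (fst (\<Phi> z) - fst (\<Phi> p)) + \<eta> / 2 * norm (z - p)" by simp
    then have "k z - k p \<le> \<eta> / 2 * norm (z - p)"
      using below[of z] z(4,5) d3(2) p by (auto simp: k_def lin)
    then show "snd (\<Phi>' (z - p)) - l (fst (\<Phi>' (z - p))) \<le> \<eta> * norm (z - p)"
      using d1(2)[OF z(2)] unfolding real_norm_def abs_le_iff by linarith
  qed (use d1 d2 d3 K in auto)
qed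

text \<open>Vectors satisfying both inequalities strictly point into \<open>\<Omega>\<close>; adding small multiples of the vertical vector
  \<open>u\<close> makes the inequalities strict.\<close>

lemma tangent_cone_epigraph_max:
  fixes \<Phi> :: "'a::real_normed_vector \<Rightarrow> 'e::real_normed_vector \<times> real" and h :: "'e \<Rightarrow> real"
  assumes \<Phi>: "(\<Phi> has_derivative \<Phi>') (at p)" and Q: "open Q" "p \<in> Q"
    and epi: "\<And>z. z \<in> Q \<Longrightarrow> z \<in> \<Omega> \<longleftrightarrow> snd (\<Phi> z) > h (fst (\<Phi> z))" and p: "snd (\<Phi> p) = h (fst (\<Phi> p))"
    and l: "bounded_linear l1" "bounded_linear l2"
    and kink: "\<And>e. e > 0 \<Longrightarrow> \<exists>d>0. \<forall>y. norm (y - fst (\<Phi> p)) < d \<longrightarrow>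
        \<bar>h y - h (fst (\<Phi> p)) - max (l1 (y - fst (\<Phi> p))) (l2 (y - fst (\<Phi> p)))\<bar> \<le> e * norm (y - fst (\<Phi> p))"
    and up: "\<Phi>' u = (0, 1)"
  shows "tangent_cone \<Omega> p = {v. snd (\<Phi>' v) \<ge> l1 (fst (\<Phi>' v)) \<and> snd (\<Phi>' v) \<ge> l2 (fst (\<Phi>' v))}"
proof (intro equalityI subsetI CollectI; (drule CollectD)?)
  fix v assume "v \<in> tangent_cone \<Omega> p"
  then obtain x t where x: "\<And>k. x k \<in> \<Omega>" "\<And>k. (t k::real) > 0" "x \<longlonglongrightarrow> p" "(\<lambda>k. t k *\<^sub>R (x k - p)) \<longlonglongrightarrow> v"
    by (auto simp: tangent_cone_def)
  have lim: "(\<lambda>k. t k *\<^sub>R (\<Phi> (x k) - \<Phi> p)) \<longlonglongrightarrow> \<Phi>' v"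
    by (rule tendsto_scaled_difference[OF \<Phi> x(3,2,4)])
  have \<Phi>x: "(\<lambda>k. \<Phi> (x k)) \<longlonglongrightarrow> \<Phi> p"
    using isCont_tendsto_compose[OF has_derivative_continuous[OF \<Phi>] x(3)] .
  have main: "snd (\<Phi>' v) \<ge> l (fst (\<Phi>' v))" if bl: "bounded_linear l" and le: "\<And>w. l w \<le> max (l1 w) (l2 w)" for l
  proof (rule ccontr)
    assume "\<not> ?thesis"
    then have neg: "l (fst (\<Phi>' v)) - snd (\<Phi>' v) > 0" by simp
    define e where "e = (l (fst (\<Phi>' v)) - snd (\<Phi>' v)) / (2 * (norm (fst (\<Phi>' v)) + 1))"
    have pos: "norm (fst (\<Phi>' v)) + 1 > 0" by (smt (verit) norm_ge_zero)
    have e: "e > 0" using neg pos by (simp add: e_def)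
    from kink[OF e] obtain d where d: "d > 0" "\<And>y. norm (y - fst (\<Phi> p)) < d \<Longrightarrow>
        \<bar>h y - h (fst (\<Phi> p)) - max (l1 (y - fst (\<Phi> p))) (l2 (y - fst (\<Phi> p)))\<bar> \<le> e * norm (y - fst (\<Phi> p))" by blast
    have "eventually (\<lambda>k. dist (fst (\<Phi> (x k))) (fst (\<Phi> p)) < d) sequentially"
      using tendsto_fst[OF \<Phi>x] d(1) by (simp add: tendsto_iff)
    moreover have "eventually (\<lambda>k. x k \<in> Q) sequentially"
      using x(3) Q by (auto simp: tendsto_def)
    ultimately have "eventually (\<lambda>k. l (fst (t k *\<^sub>R (\<Phi> (x k) - \<Phi> p))) - e * norm (fst (t k *\<^sub>R (\<Phi> (x k) - \<Phi> p)))
        \<le> snd (t k *\<^sub>R (\<Phi> (x k) - \<Phi> p))) sequentially"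
    proof eventually_elim
      case (elim k)
      let ?w = "fst (\<Phi> (x k)) - fst (\<Phi> p)"
      have "snd (\<Phi> (x k)) - snd (\<Phi> p) \<ge> h (fst (\<Phi> (x k))) - h (fst (\<Phi> p))"
        using epi[OF elim(2)] x(1)[of k] p by simp
      moreover have "h (fst (\<Phi> (x k))) - h (fst (\<Phi> p)) \<ge> l ?w - e * norm ?w"
        using d(2)[of "fst (\<Phi> (x k))"] elim(1) le[of ?w] by (simp add: dist_norm abs_le_iff)
      ultimately have "l ?w - e * norm ?w \<le> snd (\<Phi> (x k)) - snd (\<Phi> p)" by linarith
      then have "t k * (l ?w - e * norm ?w) \<le> t k * (snd (\<Phi> (x k)) - snd (\<Phi> p))"
        using x(2)[of k] by (intro mult_left_mono) auto
      moreover have "l (t k *\<^sub>R ?w) = t k * l ?w"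
        using linear_scale[OF bounded_linear.linear[OF bl]] by simp
      ultimately show ?case using x(2)[of k] by (simp add: right_diff_distrib mult.left_commute)
    qed
    moreover have "(\<lambda>k. l (fst (t k *\<^sub>R (\<Phi> (x k) - \<Phi> p))) - e * norm (fst (t k *\<^sub>R (\<Phi> (x k) - \<Phi> p))))
        \<longlonglongrightarrow> l (fst (\<Phi>' v)) - e * norm (fst (\<Phi>' v))"
      by (intro tendsto_diff tendsto_mult tendsto_const tendsto_norm tendsto_fst lim bounded_linear.tendsto[OF bl])
    moreover have "(\<lambda>k. snd (t k *\<^sub>R (\<Phi> (x k) - \<Phi> p))) \<longlonglongrightarrow> snd (\<Phi>' v)"
      by (rule tendsto_snd[OF lim])
    ultimately have "l (fst (\<Phi>' v)) - e * norm (fst (\<Phi>' v)) \<le> snd (\<Phi>' v)"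
      by (intro tendsto_le[OF sequentially_bot])
    moreover have "e * norm (fst (\<Phi>' v)) \<le> e * (norm (fst (\<Phi>' v)) + 1)" using e by simp
    moreover have "e * (norm (fst (\<Phi>' v)) + 1) = (l (fst (\<Phi>' v)) - snd (\<Phi>' v)) / 2"
    proof -
      have "X / (2 * N) * N = X / 2" if "N > 0" for X N :: real using that by simp
      from this[OF pos] show ?thesis by (simp only: e_def)
    qed
    ultimately show False using neg by simp
  qed
  show "l1 (fst (\<Phi>' v)) \<le> snd (\<Phi>' v) \<and> l2 (fst (\<Phi>' v)) \<le> snd (\<Phi>' v)"
    using main[OF l(1)] main[OF l(2)] by simp
next
  fix v assume v: "l1 (fst (\<Phi>' v)) \<le> snd (\<Phi>' v) \<and> l2 (fst (\<Phi>' v)) \<le> snd (\<Phi>' v)"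
  have lin\<Phi>: "linear \<Phi>'" using \<Phi> by (rule has_derivative_linear)
  have blk: "bounded_linear (\<lambda>w. snd (\<Phi>' w) - l (fst (\<Phi>' w)))" if "bounded_linear l" for l
    by (intro bounded_linear_sub bounded_linear_compose[OF bounded_linear_snd] bounded_linear_compose[OF that]
      bounded_linear_compose[OF bounded_linear_fst] has_derivative_bounded_linear[OF \<Phi>])
  have enter: "\<exists>s>0. s \<le> b \<and> p + s *\<^sub>R w \<in> \<Omega>"
    if w: "snd (\<Phi>' w) - l1 (fst (\<Phi>' w)) > 0" "snd (\<Phi>' w) - l2 (fst (\<Phi>' w)) > 0" and b: "b > 0" for w and b :: real
  proof -
    define c where "c = min (snd (\<Phi>' w) - l1 (fst (\<Phi>' w))) (snd (\<Phi>' w) - l2 (fst (\<Phi>' w)))"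
    have c: "c > 0" using w by (simp add: c_def)
    obtain K d0 where K: "K > 0" "d0 > 0" "\<And>z. norm (z - p) < d0 \<Longrightarrow> norm (\<Phi> z - \<Phi> p) \<le> K * norm (z - p)"
      using has_derivative_imp_pointwise_lipschitz[OF \<Phi>] by blast
    define e where "e = c / (2 * (1 + K) * (norm w + 1))"
    have nw: "norm w + 1 > 0" by (smt (verit) norm_ge_zero)
    have e: "e > 0" using c K nw by (simp add: e_def)
    have k: "((\<lambda>z. snd (\<Phi> z) - l (fst (\<Phi> z))) has_derivative (\<lambda>v. snd (\<Phi>' v) - l (fst (\<Phi>' v)))) (at p)"
      if "bounded_linear l" for l
      by (intro has_derivative_diff has_derivative_snd has_derivative_fst bounded_linear.has_derivative[OF that] \<Phi>)
    have "\<exists>d>0. \<forall>z. norm (z - p) < d \<longrightarrow>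
      norm ((snd (\<Phi> z) - l (fst (\<Phi> z))) - (snd (\<Phi> p) - l (fst (\<Phi> p))) - (snd (\<Phi>' (z - p)) - l (fst (\<Phi>' (z - p))))) \<le> e * norm (z - p)"
      if "bounded_linear l" for l
      using k[OF that] e unfolding has_derivative_at_alt by blast
    from this[OF l(1)] this[OF l(2)] obtain d1 d2 where
      d1: "d1 > 0" "\<And>z. norm (z - p) < d1 \<Longrightarrow>
      norm ((snd (\<Phi> z) - l1 (fst (\<Phi> z))) - (snd (\<Phi> p) - l1 (fst (\<Phi> p))) - (snd (\<Phi>' (z - p)) - l1 (fst (\<Phi>' (z - p))))) \<le> e * norm (z - p)"
      and d2: "d2 > 0" "\<And>z. norm (z - p) < d2 \<Longrightarrow>
      norm ((snd (\<Phi> z) - l2 (fst (\<Phi> z))) - (snd (\<Phi> p) - l2 (fst (\<Phi> p))) - (snd (\<Phi>' (z - p)) - l2 (fst (\<Phi>' (z - p))))) \<le> e * norm (z - p)"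
      by blast
    from kink[OF e] obtain d3 where d3: "d3 > 0" "\<And>y. norm (y - fst (\<Phi> p)) < d3 \<Longrightarrow>
        \<bar>h y - h (fst (\<Phi> p)) - max (l1 (y - fst (\<Phi> p))) (l2 (y - fst (\<Phi> p)))\<bar> \<le> e * norm (y - fst (\<Phi> p))" by blast
    obtain d4 where d4: "d4 > 0" "ball p d4 \<subseteq> Q" using Q open_contains_ball by blast
    define m where "m = min (min d0 (min d1 d2)) (min (d3 / K) d4)"
    have m: "m > 0" using K d1 d2 d3 d4 by (simp add: m_def)
    define s where "s = min b (m / (2 * (norm w + 1)))"
    have s: "s > 0" "s \<le> b" using b m nw by (auto simp: s_def)
    have "s * norm w \<le> m / (2 * (norm w + 1)) * norm w" unfolding s_def by (intro mult_right_mono) auto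
    also have "\<dots> \<le> m / (2 * (norm w + 1)) * (norm w + 1)" using m nw by (intro mult_left_mono) auto
    also have "\<dots> < m"
    proof -
      have "X / (2 * N) * N = X / 2" if "N > 0" for X N :: real using that by simp
      note eq = this[OF nw, of m]
      show ?thesis unfolding eq using m by simp
    qed
    finally have sm: "norm (s *\<^sub>R w) < m" using s by simp
    define z where "z = p + s *\<^sub>R w"
    have zp: "z - p = s *\<^sub>R w" by (simp add: z_def)
    have zb: "norm (z - p) < d0" "norm (z - p) < d1" "norm (z - p) < d2" "norm (z - p) < d3 / K" "z \<in> Q"
      using sm d4(2) by (auto simp: zp m_def z_def dist_norm)
    let ?w = "fst (\<Phi> z) - fst (\<Phi> p)"
    have n: "norm ?w \<le> K * norm (z - p)"
    proof -
      have "norm (fst (\<Phi> z - \<Phi> p)) \<le> norm (\<Phi> z - \<Phi> p)" by (metis norm_fst_le prod.collapse)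
      then show ?thesis using K(3)[OF zb(1)] by simp
    qed
    also have "\<dots> < d3" using zb(4) K(1) by (simp add: pos_less_divide_eq mult.commute)
    finally have "h (fst (\<Phi> z)) - h (fst (\<Phi> p)) \<le> max (l1 ?w) (l2 ?w) + e * norm ?w"
      using d3(2)[of "fst (\<Phi> z)"] by (simp add: abs_le_iff)
    also have "e * norm ?w \<le> e * (K * norm (z - p))" using n e by (intro mult_left_mono) auto
    finally have h_le: "h (fst (\<Phi> z)) - h (fst (\<Phi> p)) \<le> max (l1 ?w) (l2 ?w) + e * K * norm (z - p)" by simp
    have lower: "snd (\<Phi> z) - snd (\<Phi> p) - l ?w \<ge> s * c - e * norm (z - p)"
      if bl: "bounded_linear l" and cl: "c \<le> snd (\<Phi>' w) - l (fst (\<Phi>' w))"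
        and dl: "norm ((snd (\<Phi> z) - l (fst (\<Phi> z))) - (snd (\<Phi> p) - l (fst (\<Phi> p))) - (snd (\<Phi>' (z - p)) - l (fst (\<Phi>' (z - p))))) \<le> e * norm (z - p)"
      for l
    proof -
      have "snd (\<Phi>' (z - p)) - l (fst (\<Phi>' (z - p))) = s * (snd (\<Phi>' w) - l (fst (\<Phi>' w)))"
        using linear_scale[OF bounded_linear.linear[OF blk[OF bl]], of s w] by (simp add: zp)
      moreover have "\<dots> \<ge> s * c" using cl s by (intro mult_left_mono) auto
      moreover have "l ?w = l (fst (\<Phi> z)) - l (fst (\<Phi> p))" by (rule linear_diff[OF bounded_linear.linear[OF bl]])
      ultimately show ?thesis using dl by (simp add: abs_le_iff)
    qed
    have "snd (\<Phi> z) - snd (\<Phi> p) - l1 ?w \<ge> s * c - e * norm (z - p)"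
      by (rule lower[OF l(1) _ d1(2)[OF zb(2)]]) (simp add: c_def)
    moreover have "snd (\<Phi> z) - snd (\<Phi> p) - l2 ?w \<ge> s * c - e * norm (z - p)"
      by (rule lower[OF l(2) _ d2(2)[OF zb(3)]]) (simp add: c_def)
    ultimately have "snd (\<Phi> z) - snd (\<Phi> p) - max (l1 ?w) (l2 ?w) \<ge> s * c - e * norm (z - p)" by simp
    with h_le have "snd (\<Phi> z) - h (fst (\<Phi> z)) \<ge> s * c - e * norm (z - p) - e * K * norm (z - p)" using p by linarith
    moreover have "e * norm (z - p) + e * K * norm (z - p) < s * c"
    proof -
      have "e * norm (z - p) + e * K * norm (z - p) = s * (e * (1 + K) * norm w)"
        using s by (simp add: zp algebra_simps)
      also have "\<dots> \<le> s * (e * (1 + K) * (norm w + 1))" using s e K by (intro mult_left_mono) auto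
      also have "e * (1 + K) * (norm w + 1) = c / 2"
      proof -
        have "c / (2 * A * N) * A * N = c / 2" if "A > 0" "N > 0" for A N :: real using that by simp
        from this[OF _ nw, of "1 + K"] K(1) show ?thesis by (simp only: e_def)
      qed
      also have "s * (c / 2) < s * c" using s c by simp
      finally show ?thesis .
    qed
    ultimately have "snd (\<Phi> z) > h (fst (\<Phi> z))" by linarith
    then have "z \<in> \<Omega>" using epi[OF zb(5)] by simp
    then show ?thesis using s by (auto simp: z_def)
  qed
  define w where "w n = v + inverse (real (Suc n)) *\<^sub>R u" for n
  have "\<exists>s>0. s \<le> inverse (real (Suc n)) \<and> p + s *\<^sub>R w n \<in> \<Omega>" for n
  proof (rule enter)
    have \<Phi>w: "\<Phi>' (w n) = \<Phi>' v + inverse (real (Suc n)) *\<^sub>R (0, 1)"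
      by (simp only: w_def linear_add[OF lin\<Phi>] linear_scale[OF lin\<Phi>] up)
    show "snd (\<Phi>' (w n)) - l1 (fst (\<Phi>' (w n))) > 0" "snd (\<Phi>' (w n)) - l2 (fst (\<Phi>' (w n))) > 0"
    proof -
      have "fst (\<Phi>' (w n)) = fst (\<Phi>' v)" "snd (\<Phi>' (w n)) = snd (\<Phi>' v) + inverse (real (Suc n))"
        by (simp_all add: \<Phi>w)
      moreover have "inverse (real (Suc n)) > 0" by simp
      ultimately show "snd (\<Phi>' (w n)) - l1 (fst (\<Phi>' (w n))) > 0" "snd (\<Phi>' (w n)) - l2 (fst (\<Phi>' (w n))) > 0"
        using v by (simp_all only:) linarith+
    qed
  qed simp
  then obtain s where s: "\<And>n. s n > 0" "\<And>n. s n \<le> inverse (real (Suc n))" "\<And>n. p + s n *\<^sub>R w n \<in> \<Omega>" by metis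
  have "(\<lambda>n. v + inverse (real (Suc n)) *\<^sub>R u) \<longlonglongrightarrow> v + 0 *\<^sub>R u"
    by (intro tendsto_add tendsto_scaleR tendsto_const LIMSEQ_inverse_real_of_nat)
  then have wlim: "w \<longlonglongrightarrow> v" by (simp add: w_def[abs_def])
  have "s \<longlonglongrightarrow> 0"
    by (rule tendsto_sandwich[OF _ _ tendsto_const LIMSEQ_inverse_real_of_nat])
      (simp_all only: s less_imp_le[OF s(1)] eventually_True)
  then have "(\<lambda>n. p + s n *\<^sub>R w n) \<longlonglongrightarrow> p + 0 *\<^sub>R v"
    by (intro tendsto_add tendsto_scaleR tendsto_const wlim)
  then have 1: "(\<lambda>n. p + s n *\<^sub>R w n) \<longlonglongrightarrow> p" by simp
  have "inverse (s n) *\<^sub>R (p + s n *\<^sub>R w n - p) = w n" for n using s(1)[of n] by simp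
  then have 2: "(\<lambda>n. inverse (s n) *\<^sub>R (p + s n *\<^sub>R w n - p)) \<longlonglongrightarrow> v" using wlim by (simp only:)
  show "v \<in> tangent_cone \<Omega> p"
    unfolding tangent_cone_def
  proof (intro CollectI exI[of _ "\<lambda>n. p + s n *\<^sub>R w n"] exI[of _ "\<lambda>n. inverse (s n)"] conjI allI 1 2 s(3))
    show "inverse (s n) > 0" for n using s(1) by simp
  qed
qed

section \<open>The alternative at an edge point\<close>

text \<open>The data at one edge point \<open>a\<close>: the chart \<open>\<phi>\<close> in which \<open>\<Omega>\<close> is the region above the graph of \<open>h\<close>, with
  derivative bounds on the dense set \<open>V\<close>, and the edge \<open>M\<close> containing all singular boundary points in \<open>N\<close>.
  It is purely real and does not refer to the complex structure.\<close>

locale edge_graph =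
  fixes \<Omega> :: "'a::euclidean_space set" and a :: 'a and M :: "'a set" and W :: "'a set"
    and U :: "'e::euclidean_space set" and I :: "real set" and \<phi> :: "'a \<Rightarrow> 'e \<times> real" and h :: "'e \<Rightarrow> real"
    and V :: "'e set" and N :: "'a set"
  assumes open_\<Omega>: "open \<Omega>" and dims: "DIM('a) = DIM('e) + 1"
    and W: "a \<in> W" and U: "open U" and I: "open I" and \<phi>: "Ck_diffeo 2 \<phi> W (U \<times> I)"
    and epi: "\<phi> ` (\<Omega> \<inter> W) = {(x, t). x \<in> U \<and> t \<in> I \<and> t > h x}"
    and cont_h: "continuous_on U h" and V: "open V" "V \<subseteq> U" "U \<subseteq> closure V" "Ck_on 2 h V"
    and b1: "\<And>v. bounded ((\<lambda>x. frechet_derivative h (at x) v) ` V)"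
    and b2: "\<And>v w. bounded ((\<lambda>x. frechet_derivative (\<lambda>y. frechet_derivative h (at y) v) (at x) w) ` V)"
    and M: "a \<in> M" "closedin (top_of_set (frontier \<Omega> \<inter> N)) M" "Ck_submanifold 1 (DIM('a) - 2) M"
    and N: "open N" "a \<in> N" and reg: "{p \<in> frontier \<Omega> \<inter> N. \<not> regular_point (frontier \<Omega>) p} \<subseteq> M"
begin

definition \<xi> :: "'e \<times> real \<Rightarrow> 'a" where "\<xi> = inv_into W \<phi>"
text \<open>A parametrization of the boundary of \<open>\<Omega>\<close> by the points \<open>x\<close> with \<open>h x \<in> I\<close>; at other points its value is
  arbitrary.\<close>

definition \<Gamma> :: "'e \<Rightarrow> 'a" where "\<Gamma> x = \<xi> (x, h x)"

lemma chart_facts: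
  shows "open W" "open (U \<times> I)" "Ck_on 2 \<phi> W" "Ck_on 2 \<xi> (U \<times> I)"
    "z \<in> W \<Longrightarrow> \<phi> z \<in> U \<times> I" "z \<in> W \<Longrightarrow> \<xi> (\<phi> z) = z" "y \<in> U \<times> I \<Longrightarrow> \<xi> y \<in> W" "y \<in> U \<times> I \<Longrightarrow> \<phi> (\<xi> y) = y"
  using \<phi> unfolding Ck_diffeo_def \<xi>_def
  by (auto dest: bij_betwE bij_betw_inv_into simp: bij_betw_inv_into_left bij_betw_inv_into_right)

lemma two: "(2::nat) = Suc (Suc 0)" by simp

lemma cont: "continuous_on W \<phi>" "continuous_on (U \<times> I) \<xi>"
  using chart_facts(3,4) by (auto intro: Ck_on_imp_continuous)

lemma in_\<Omega>_iff:
  assumes z: "z \<in> W" shows "z \<in> \<Omega> \<longleftrightarrow> snd (\<phi> z) > h (fst (\<phi> z))"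
proof
  assume "z \<in> \<Omega>"
  with z have "\<phi> z \<in> \<phi> ` (\<Omega> \<inter> W)" by (intro imageI IntI)
  then show "snd (\<phi> z) > h (fst (\<phi> z))" unfolding epi by (simp add: case_prod_beta)
next
  assume "snd (\<phi> z) > h (fst (\<phi> z))"
  then have "\<phi> z \<in> \<phi> ` (\<Omega> \<inter> W)"
    unfolding epi using chart_facts(5)[OF z] by (simp add: case_prod_beta mem_Times_iff)
  then obtain q where q: "\<phi> z = \<phi> q" "q \<in> \<Omega> \<inter> W" by (rule imageE)
  have "q = z"
    using chart_facts(6)[of q] chart_facts(6)[OF z] q by simp
  then show "z \<in> \<Omega>" using q(2) by simp
qed

lemma in_frontier_iff:
  assumes z: "z \<in> W" shows "z \<in> frontier \<Omega> \<longleftrightarrow> snd (\<phi> z) = h (fst (\<phi> z))"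
proof
  assume fr: "z \<in> frontier \<Omega>"
  then have "z \<notin> \<Omega>" "z \<in> closure \<Omega>" using open_\<Omega> by (simp_all add: frontier_def interior_open)
  have le: "snd (\<phi> z) \<le> h (fst (\<phi> z))" using in_\<Omega>_iff[OF z] \<open>z \<notin> \<Omega>\<close> by simp
  show "snd (\<phi> z) = h (fst (\<phi> z))"
  proof (rule ccontr)
    assume "snd (\<phi> z) \<noteq> h (fst (\<phi> z))"
    with le have less: "h (fst (\<phi> z)) - snd (\<phi> z) > 0" by simp
    have sub: "(\<lambda>z. fst (\<phi> z)) ` W \<subseteq> U"
    proof (rule image_subsetI)
      fix q assume "q \<in> W"
      from chart_facts(5)[OF this] show "fst (\<phi> q) \<in> U" by (simp add: mem_Times_iff)
    qed
    have contd: "continuous_on W (\<lambda>z. h (fst (\<phi> z)) - snd (\<phi> z))"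
      by (rule continuous_on_diff[OF continuous_on_compose2[OF cont_h continuous_on_fst[OF cont(1)] sub] continuous_on_snd[OF cont(1)]])
    define T where "T = W \<inter> (\<lambda>z. h (fst (\<phi> z)) - snd (\<phi> z)) -` {0<..}"
    have T: "open T" unfolding T_def by (rule continuous_open_preimage[OF contd chart_facts(1)]) simp
    have "z \<in> T \<inter> closure \<Omega>" using less z \<open>z \<in> closure \<Omega>\<close> by (simp add: T_def)
    then have "T \<inter> closure \<Omega> \<noteq> {}" by (rule ex_in_conv[THEN iffD1, OF exI])
    then have "T \<inter> \<Omega> \<noteq> {}" unfolding open_Int_closure_eq_empty[OF T] .
    then obtain q where q: "q \<in> T" "q \<in> \<Omega>" by blast
    then have "q \<in> W" "h (fst (\<phi> q)) - snd (\<phi> q) > 0" by (simp_all add: T_def)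
    then show False using in_\<Omega>_iff[OF \<open>q \<in> W\<close>] q(2) by simp
  qed
next
  assume eq: "snd (\<phi> z) = h (fst (\<phi> z))"
  then have "z \<notin> \<Omega>" using in_\<Omega>_iff[OF z] by simp
  moreover have "z \<in> closure \<Omega>"
    unfolding closure_def islimpt_def
  proof (rule UnI2, rule CollectI, intro allI impI)
    fix T assume T: "z \<in> T" "open T"
    have \<phi>z: "\<phi> z \<in> U \<times> I" by (rule chart_facts(5)[OF z])
    have oT: "open ((U \<times> I) \<inter> \<xi> -` T)"
      by (rule continuous_open_preimage[OF cont(2) chart_facts(2) T(2)])
    have "\<phi> z \<in> (U \<times> I) \<inter> \<xi> -` T"
    proof (intro IntI vimageI2)
      show "\<xi> (\<phi> z) \<in> T" using chart_facts(6)[OF z] T(1) by simp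
    qed (rule \<phi>z)
    with oT obtain e where e: "e > 0" "ball (\<phi> z) e \<subseteq> (U \<times> I) \<inter> \<xi> -` T"
      by (rule openE)
    define y where "y = (fst (\<phi> z), snd (\<phi> z) + e / 2)"
    have "dist (\<phi> z) y = e / 2" using e(1) by (simp add: y_def dist_prod_def dist_real_def)
    then have y: "y \<in> (U \<times> I) \<inter> \<xi> -` T" using e(1) by (intro subsetD[OF e(2)]) simp
    then have yUI: "y \<in> U \<times> I" and yT: "\<xi> y \<in> T" by simp_all
    have "\<xi> y \<in> W" "\<phi> (\<xi> y) = y" by (rule chart_facts(7)[OF yUI], rule chart_facts(8)[OF yUI])
    moreover have "h (fst y) < snd y" using eq e(1) by (simp add: y_def)
    ultimately have in\<Omega>: "\<xi> y \<in> \<Omega>" using in_\<Omega>_iff[of "\<xi> y"] by simp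
    then have "\<xi> y \<noteq> z" using \<open>z \<notin> \<Omega>\<close> by blast
    with in\<Omega> yT show "\<exists>y\<in>\<Omega>. y \<in> T \<and> y \<noteq> z" by (intro bexI[of _ "\<xi> y"] conjI)
  qed
  ultimately show "z \<in> frontier \<Omega>" using open_\<Omega> by (simp add: frontier_def interior_open)
qed

lemma \<Gamma>_facts:
  assumes "x \<in> U" "h x \<in> I"
  shows "\<Gamma> x \<in> W" "\<phi> (\<Gamma> x) = (x, h x)" "\<Gamma> x \<in> frontier \<Omega>"
proof -
  show 1: "\<Gamma> x \<in> W" "\<phi> (\<Gamma> x) = (x, h x)"
    using chart_facts(7,8)[of "(x, h x)"] assms by (simp_all add: \<Gamma>_def)
  show "\<Gamma> x \<in> frontier \<Omega>" using in_frontier_iff[OF 1(1)] 1(2) by simp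
qed

lemma \<Gamma>_fst:
  assumes "z \<in> W" "z \<in> frontier \<Omega>"
  shows "\<Gamma> (fst (\<phi> z)) = z" "fst (\<phi> z) \<in> U" "h (fst (\<phi> z)) \<in> I"
proof -
  have eq: "\<phi> z = (fst (\<phi> z), h (fst (\<phi> z)))" using in_frontier_iff[OF assms(1)] assms(2) by (simp add: prod_eq_iff)
  show "\<Gamma> (fst (\<phi> z)) = z"
    unfolding \<Gamma>_def eq[symmetric] by (rule chart_facts(6)[OF assms(1)])
  show "fst (\<phi> z) \<in> U" "h (fst (\<phi> z)) \<in> I"
    using chart_facts(5)[OF assms(1)] in_frontier_iff[OF assms(1)] assms(2) by (auto simp: mem_Times_iff)
qed

lemma M_frontier: "z \<in> M \<Longrightarrow> z \<in> frontier \<Omega>" "z \<in> M \<Longrightarrow> z \<in> N"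
  using M(2) by (auto simp: closedin_def)

lemma small_ball:
  assumes "open Q" "a \<in> Q"
  obtains r where "r > 0" "ball (fst (\<phi> a)) r \<subseteq> U" "\<And>x. x \<in> ball (fst (\<phi> a)) r \<Longrightarrow> h x \<in> I \<and> \<Gamma> x \<in> Q"
    "continuous_on (ball (fst (\<phi> a)) r) \<Gamma>"
proof -
  note a = \<Gamma>_fst[OF W M_frontier(1)[OF M(1)]]
  define X where "X = U \<inter> h -` I"
  have X: "open X" unfolding X_def by (rule continuous_open_preimage[OF cont_h U I])
  have cont\<Gamma>: "continuous_on X \<Gamma>"
    unfolding \<Gamma>_def
    by (rule continuous_on_compose2[OF cont(2)])
      (auto simp: X_def intro!: continuous_on_Pair continuous_on_id continuous_on_subset[OF cont_h])
  have "open (X \<inter> \<Gamma> -` Q)" by (rule continuous_open_preimage[OF cont\<Gamma> X assms(1)])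
  moreover have "fst (\<phi> a) \<in> X \<inter> \<Gamma> -` Q" using a assms(2) by (simp add: X_def)
  ultimately obtain r where r: "r > 0" "ball (fst (\<phi> a)) r \<subseteq> X \<inter> \<Gamma> -` Q"
    by (rule openE)
  show thesis
  proof (rule that[OF r(1)])
    show "continuous_on (ball (fst (\<phi> a)) r) \<Gamma>"
      by (rule continuous_on_subset[OF cont\<Gamma>]) (use r(2) in blast)
  qed (use r(2) in \<open>auto simp: X_def\<close>)
qed

text \<open>Off the edge the boundary is regular, and its defining function, pulled back by the chart, is an implicit
  equation for \<open>h\<close>.\<close>

lemma C2_off_edge:
  assumes x: "x \<in> U" "h x \<in> I" "\<Gamma> x \<in> N" "\<Gamma> x \<notin> M"
  shows "\<exists>X. open X \<and> x \<in> X \<and> X \<subseteq> U \<and> Ck_on 2 h X"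
proof -
  note \<Gamma> = \<Gamma>_facts[OF x(1,2)]
  have "regular_point (frontier \<Omega>) (\<Gamma> x)" using reg x(3,4) \<Gamma>(3) by blast
  then obtain \<rho> P w where \<rho>: "open P" "\<Gamma> x \<in> P" "Ck_on 2 (\<rho> :: 'a \<Rightarrow> real) P"
      "\<And>z. z \<in> frontier \<Omega> \<inter> P \<Longrightarrow> \<rho> z = 0" "frechet_derivative \<rho> (at (\<Gamma> x)) w \<noteq> 0"
    by (rule regular_point_defining_function, intro that) assumption+
  define Y where "Y = (U \<times> I) \<inter> \<xi> -` P"
  have Y: "open Y" unfolding Y_def by (rule continuous_open_preimage[OF cont(2) chart_facts(2) \<rho>(1)])
  have \<xi>Y: "Ck_on 2 \<xi> Y" by (rule Ck_on_subset[OF chart_facts(4)]) (simp add: Y_def)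
  have xY: "(x, h x) \<in> Y" using x \<rho>(2) by (simp add: Y_def \<Gamma>_def)
  note D = Ck_diffeo_derivatives[OF \<phi>[unfolded two] \<Gamma>(1), folded \<xi>_def, unfolded \<Gamma>(2)]
  have \<xi>x: "\<xi> (x, h x) = \<Gamma> x" by (simp add: \<Gamma>_def)
  have "(\<rho> has_derivative frechet_derivative \<rho> (at (\<Gamma> x))) (at (\<xi> (x, h x)))"
    unfolding \<xi>x by (rule Ck_on_has_derivative[OF \<rho>(3)[unfolded two] \<rho>(2)])
  from has_derivative_compose[OF D(2) this]
  have "((\<lambda>y. \<rho> (\<xi> y)) has_derivative
      (\<lambda>v. frechet_derivative \<rho> (at (\<Gamma> x)) (frechet_derivative \<xi> (at (x, h x)) v))) (at (x, h x))" .
  then have fr: "frechet_derivative (\<lambda>y. \<rho> (\<xi> y)) (at (x, h x))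
      = (\<lambda>v. frechet_derivative \<rho> (at (\<Gamma> x)) (frechet_derivative \<xi> (at (x, h x)) v))"
    by (rule frechet_derivative_at[symmetric])
  show ?thesis
  proof (rule Ck_on_2_if_implicit[OF U cont_h x(1) V(1,3) _ b1 Y _ xY, where \<rho>="\<lambda>y. \<rho> (\<xi> y)" and w="frechet_derivative \<phi> (at (\<Gamma> x)) w"])
    show "h differentiable at y" if "y \<in> V" for y using V(4) that by (simp add: two)
    show "Ck_on 2 (\<lambda>y. \<rho> (\<xi> y)) Y" by (rule Ck_on_compose[OF Y \<xi>Y \<rho>(1,3)]) (auto simp: Y_def)
    show "\<rho> (\<xi> (y, h y)) = 0" if "y \<in> U" "(y, h y) \<in> Y" for y
      using \<Gamma>_facts(3)[of y] that \<rho>(4)[of "\<Gamma> y"] by (simp add: Y_def \<Gamma>_def)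
    show "frechet_derivative (\<lambda>y. \<rho> (\<xi> y)) (at (x, h x)) (frechet_derivative \<phi> (at (\<Gamma> x)) w) \<noteq> 0"
      unfolding fr D(3) by (rule \<rho>(5))
  qed
qed

lemma dim_ge_2: "2 \<le> DIM('a)"
  using dims DIM_positive[where 'a='e] by linarith

text \<open>The gradient bound off the projection of the edge becomes a Lipschitz bound for \<open>h\<close> on a whole ball, since
  the edge has codimension two.\<close>

lemma edge_ball:
  obtains r g g' B K where "r > 0" "ball (fst (\<phi> a)) r \<subseteq> U"
    "\<And>x. x \<in> ball (fst (\<phi> a)) r \<Longrightarrow> h x \<in> I \<and> \<Gamma> x \<in> N" "continuous_on (ball (fst (\<phi> a)) r) \<Gamma>"
    "\<And>x. x \<in> ball (fst (\<phi> a)) r \<Longrightarrow> \<Gamma> x \<notin> M \<Longrightarrow> (h has_derivative (\<lambda>v. g x \<bullet> v)) (at x)"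
    "\<And>x. x \<in> ball (fst (\<phi> a)) r \<Longrightarrow> \<Gamma> x \<notin> M \<Longrightarrow> (g has_derivative g' x) (at x)"
    "\<And>x v. x \<in> ball (fst (\<phi> a)) r \<Longrightarrow> \<Gamma> x \<notin> M \<Longrightarrow> norm (g' x v) \<le> K * norm v"
    "\<And>x y. x \<in> ball (fst (\<phi> a)) r \<Longrightarrow> y \<in> ball (fst (\<phi> a)) r \<Longrightarrow> \<bar>h y - h x\<bar> \<le> B * norm (y - x)"
proof -
  obtain W1 V1 L and \<psi> :: "'a \<Rightarrow> 'a" where \<psi>: "a \<in> W1" "Ck_diffeo 1 \<psi> W1 V1" "subspace L" "dim L = DIM('a) - 2"
    and flat: "\<psi> ` (M \<inter> W1) = V1 \<inter> L"
    using bspec[OF M(3)[unfolded Ck_submanifold_def] M(1)] by blast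
  have oW1: "open W1" using \<psi>(2) by (simp add: Ck_diffeo_def)
  obtain r where r: "r > 0" "ball (fst (\<phi> a)) r \<subseteq> U" "\<And>x. x \<in> ball (fst (\<phi> a)) r \<Longrightarrow> h x \<in> I \<and> \<Gamma> x \<in> N \<inter> W1"
    "continuous_on (ball (fst (\<phi> a)) r) \<Gamma>"
    by (rule small_ball[of "N \<inter> W1"]) (use N oW1 \<psi>(1) in auto)
  define X where "X = ball (fst (\<phi> a)) r"
  define E where "E = X \<inter> \<Gamma> -` M"
  have XU: "X \<subseteq> U" using r(2) by (simp add: X_def)
  have X: "h x \<in> I" "\<Gamma> x \<in> N" "\<Gamma> x \<in> W1" "x \<in> U" if "x \<in> X" for x
    using r(3)[of x] that XU by (auto simp: X_def)
  have E: "closedin (top_of_set X) E"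
    unfolding E_def
    by (rule continuous_closedin_preimage_gen[OF _ _ M(2)])
      (use r(4) X \<Gamma>_facts in \<open>auto simp: X_def\<close>)
  have oS: "open (X - E)"
  proof -
    obtain F where "closed F" "E = X \<inter> F" using E by (auto simp: closedin_closed)
    then have "X - E = X - F" "closed F" by auto
    then show ?thesis by (simp add: X_def open_Diff)
  qed
  have C2: "Ck_on 2 h (X - E)"
  proof (rule Ck_on_local)
    fix x assume "x \<in> X - E"
    then have "x \<in> U" "h x \<in> I" "\<Gamma> x \<in> N" "\<Gamma> x \<notin> M" using X by (auto simp: E_def)
    from C2_off_edge[OF this] show "\<exists>X. open X \<and> x \<in> X \<and> Ck_on 2 h X" by (elim exE conjE) (intro exI conjI)
  qed
  have XV: "X - E \<subseteq> closure V" using XU V(3) by blast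
  obtain g g' B K where g: "B \<ge> 0" "\<And>x. x \<in> X - E \<Longrightarrow> (h has_derivative (\<lambda>v. g x \<bullet> v)) (at x)"
    "\<And>x v. x \<in> X - E \<Longrightarrow> \<bar>g x \<bullet> v\<bar> \<le> B * norm v"
    "\<And>x. x \<in> X - E \<Longrightarrow> (g has_derivative g' x) (at x)"
    "\<And>x v. x \<in> X - E \<Longrightarrow> norm (g' x v) \<le> K * norm v"
    by (rule gradient_bounds[OF oS C2 XV b1 b2], rule that) assumption+
  have thin: "negligible {(x + t *\<^sub>R v, h x) | x t. x \<in> E}" for v :: 'e
  proof -
    have \<phi>diff: "\<phi> differentiable (at q)" if "q \<in> W \<inter> W1" for q
      using chart_facts(3) that by (simp add: two)
    have "negligible {\<phi> q + t *\<^sub>R (v, 0) | q t. q \<in> M \<inter> (W \<inter> W1)}"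
      by (rule negligible_submanifold_lines[OF _ _ \<psi>(2,3) flat \<phi>diff]) (use dims dim_ge_2 \<psi>(4) in auto)
    moreover have "{(x + t *\<^sub>R v, h x) | x t. x \<in> E} \<subseteq> {\<phi> q + t *\<^sub>R (v, 0) | q t. q \<in> M \<inter> (W \<inter> W1)}"
    proof clarify
      fix x t assume "x \<in> E"
      then have x: "x \<in> X" "\<Gamma> x \<in> M" by (auto simp: E_def)
      then have "\<Gamma> x \<in> M \<inter> (W \<inter> W1)" "(x + t *\<^sub>R v, h x) = \<phi> (\<Gamma> x) + t *\<^sub>R (v, 0)"
        using X[OF x(1)] \<Gamma>_facts[of x] by simp_all
      then show "\<exists>q s. (x + t *\<^sub>R v, h x) = \<phi> q + s *\<^sub>R (v, 0) \<and> q \<in> M \<inter> (W \<inter> W1)" by blast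
    qed
    ultimately show ?thesis by (rule negligible_subset)
  qed
  have lip: "\<bar>h y - h x\<bar> \<le> B * norm (y - x)" if "x \<in> X" "y \<in> X" for x y
    by (rule lipschitz_across_thin_set[OF _ _ continuous_on_subset[OF cont_h XU] E g(1,2,3) thin that])
      (auto simp: X_def)
  have XE: "x \<in> X - E" if "x \<in> ball (fst (\<phi> a)) r" "\<Gamma> x \<notin> M" for x
    using that by (simp add: X_def E_def)
  show thesis
  proof (rule that[OF r(1,2) _ r(4)])
    show "h x \<in> I \<and> \<Gamma> x \<in> N" if "x \<in> ball (fst (\<phi> a)) r" for x using r(3)[OF that] by simp
    show "(h has_derivative (\<lambda>v. g x \<bullet> v)) (at x)" if "x \<in> ball (fst (\<phi> a)) r" "\<Gamma> x \<notin> M" for x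
      by (rule g(2)[OF XE[OF that]])
    show "(g has_derivative g' x) (at x)" if "x \<in> ball (fst (\<phi> a)) r" "\<Gamma> x \<notin> M" for x
      by (rule g(4)[OF XE[OF that]])
    show "norm (g' x v) \<le> K * norm v" if "x \<in> ball (fst (\<phi> a)) r" "\<Gamma> x \<notin> M" for x v
      by (rule g(5)[OF XE[OF that]])
    show "\<bar>h y - h x\<bar> \<le> B * norm (y - x)" if "x \<in> ball (fst (\<phi> a)) r" "y \<in> ball (fst (\<phi> a)) r" for x y
      by (rule lip) (use that in \<open>simp_all add: X_def\<close>)
  qed
qed

text \<open>The edge lies in the graph of the Lipschitz function \<open>h\<close>.\<close>

lemma tangent_not_vertical:
  assumes v: "v \<in> tangent_cone M a" "fst (frechet_derivative \<phi> (at a) v) = 0"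
  shows "v = 0"
proof -
  obtain r g g' B K where r: "r > 0" "ball (fst (\<phi> a)) r \<subseteq> U"
    and lip: "\<And>x y. x \<in> ball (fst (\<phi> a)) r \<Longrightarrow> y \<in> ball (fst (\<phi> a)) r \<Longrightarrow> \<bar>h y - h x\<bar> \<le> B * norm (y - x)"
    by (rule edge_ball, rule that) assumption+
  note D = Ck_diffeo_derivatives[OF \<phi>[unfolded two] W]
  let ?D = "frechet_derivative \<phi> (at a)"
  obtain x t where x: "\<And>k. x k \<in> M" "\<And>k. (t k::real) > 0" "x \<longlonglongrightarrow> a" "(\<lambda>k. t k *\<^sub>R (x k - a)) \<longlonglongrightarrow> v"
    using v(1) by (auto simp: tangent_cone_def)
  have lim: "(\<lambda>k. t k *\<^sub>R (\<phi> (x k) - \<phi> a)) \<longlonglongrightarrow> ?D v"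
    by (rule tendsto_scaled_difference[OF D(1) x(3,2,4)])
  have \<phi>x: "(\<lambda>k. \<phi> (x k)) \<longlonglongrightarrow> \<phi> a"
    using isCont_tendsto_compose[OF has_derivative_continuous[OF D(1)] x(3)] .
  have "eventually (\<lambda>k. x k \<in> W) sequentially"
    by (rule topological_tendstoD[OF x(3) chart_facts(1) W])
  moreover have "eventually (\<lambda>k. fst (\<phi> (x k)) \<in> ball (fst (\<phi> a)) r) sequentially"
    by (rule topological_tendstoD[OF tendsto_fst[OF \<phi>x] open_ball]) (use r(1) in simp)
  ultimately have "eventually (\<lambda>k. \<bar>snd (t k *\<^sub>R (\<phi> (x k) - \<phi> a))\<bar> \<le> B * norm (fst (t k *\<^sub>R (\<phi> (x k) - \<phi> a)))) sequentially"
  proof eventually_elim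
    case (elim k)
    have "snd (\<phi> (x k)) = h (fst (\<phi> (x k)))" "snd (\<phi> a) = h (fst (\<phi> a))"
      using in_frontier_iff[OF elim(1)] in_frontier_iff[OF W] M_frontier(1) x(1) M(1) by blast+
    then have "\<bar>snd (\<phi> (x k)) - snd (\<phi> a)\<bar> \<le> B * norm (fst (\<phi> (x k)) - fst (\<phi> a))"
      using lip[OF _ elim(2), of "fst (\<phi> a)"] r(1) by simp
    then have "t k * \<bar>snd (\<phi> (x k)) - snd (\<phi> a)\<bar> \<le> t k * (B * norm (fst (\<phi> (x k)) - fst (\<phi> a)))"
      using x(2)[of k] by (intro mult_left_mono) auto
    then show ?case using x(2)[of k] by (simp add: abs_mult mult.left_commute)
  qed
  moreover have "(\<lambda>k. \<bar>snd (t k *\<^sub>R (\<phi> (x k) - \<phi> a))\<bar>) \<longlonglongrightarrow> \<bar>snd (?D v)\<bar>"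
    by (intro tendsto_rabs tendsto_snd lim)
  moreover have "(\<lambda>k. B * norm (fst (t k *\<^sub>R (\<phi> (x k) - \<phi> a)))) \<longlonglongrightarrow> B * norm (fst (?D v))"
    by (intro tendsto_mult tendsto_const tendsto_norm tendsto_fst lim)
  ultimately have "\<bar>snd (?D v)\<bar> \<le> B * norm (fst (?D v))"
    by (intro tendsto_le[OF sequentially_bot])
  then have "?D v = 0" using v(2) by (simp add: prod_eq_iff)
  then have "frechet_derivative (inv_into W \<phi>) (at (\<phi> a)) (?D v) = 0"
    using linear_0[OF has_derivative_linear[OF D(2)]] by simp
  then show "v = 0" by (simp add: D(3))
qed

text \<open>By \<open>tangent_not_vertical\<close> the projection of the edge can be straightened to the hyperplane orthogonal to
  \<open>\<nu>\<close>. In the new coordinates \<open>\<Phi>\<close>, which are \<open>C\<^sup>1\<close> only, \<open>\<Omega>\<close> is the region above the graph of \<open>f\<close>, and \<open>f\<close> has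
  one-sided derivatives \<open>lp x\<close> and \<open>lm x\<close> along this hyperplane.\<close>

lemma edge_normal_form:
  obtains Q and \<Phi> :: "'a \<Rightarrow> 'e \<times> real" and f :: "'e \<Rightarrow> real" and \<nu> :: 'e and r and lp lm :: "'e \<Rightarrow> 'e \<Rightarrow> real" where
    "open Q" "a \<in> Q" "norm \<nu> = 1" "continuous_on Q \<Phi>" "\<And>z. z \<in> Q \<Longrightarrow> fst (\<Phi> z) \<in> ball 0 r"
    "\<And>z. z \<in> Q \<Longrightarrow> z \<in> \<Omega> \<longleftrightarrow> snd (\<Phi> z) > f (fst (\<Phi> z))"
    "\<And>z. z \<in> M \<inter> Q \<Longrightarrow> snd (\<Phi> z) = f (fst (\<Phi> z)) \<and> fst (\<Phi> z) \<bullet> \<nu> = 0"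
    "\<And>z. z \<in> Q \<Longrightarrow> \<exists>\<Phi>'. (\<Phi> has_derivative \<Phi>') (at z) \<and> surj \<Phi>'"
    "\<And>x. x \<in> ball 0 r \<Longrightarrow> x \<bullet> \<nu> = 0 \<Longrightarrow> (f has_derivative lp x) (at x within {y \<in> ball 0 r. y \<bullet> \<nu> \<ge> 0})"
    "\<And>x. x \<in> ball 0 r \<Longrightarrow> x \<bullet> \<nu> = 0 \<Longrightarrow> (f has_derivative lm x) (at x within {y \<in> ball 0 r. y \<bullet> \<nu> \<le> 0})"
    "continuous_on {x \<in> ball 0 r. x \<bullet> \<nu> = 0} (\<lambda>x. lp x \<nu> - lm x (\<nu>::'e))"
proof -
  obtain R g g' B K where R: "R > 0" "ball (fst (\<phi> a)) R \<subseteq> U"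
    "\<And>x. x \<in> ball (fst (\<phi> a)) R \<Longrightarrow> h x \<in> I \<and> \<Gamma> x \<in> N" "continuous_on (ball (fst (\<phi> a)) R) \<Gamma>"
    "\<And>x. x \<in> ball (fst (\<phi> a)) R \<Longrightarrow> \<Gamma> x \<notin> M \<Longrightarrow> (h has_derivative (\<lambda>v. g x \<bullet> v)) (at x)"
    "\<And>x. x \<in> ball (fst (\<phi> a)) R \<Longrightarrow> \<Gamma> x \<notin> M \<Longrightarrow> (g has_derivative g' x) (at x)"
    "\<And>x v. x \<in> ball (fst (\<phi> a)) R \<Longrightarrow> \<Gamma> x \<notin> M \<Longrightarrow> norm (g' x v) \<le> K * norm v"
    by (rule edge_ball, rule that) assumption+
  define T where "T = tangent_cone M a"
  define \<theta> where "\<theta> z = fst (\<phi> z)" for z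
  note D = Ck_diffeo_derivatives[OF \<phi>[unfolded two] W]
  have T: "subspace T" "dim T = DIM('a) - 2"
    unfolding T_def using tangent_cone_submanifold_subspace[OF M(3,1)] by blast+
  have \<phi>1: "Ck_on 1 \<phi> W" using Ck_on_Suc_imp chart_facts(3) by (simp only: two One_nat_def)
  have \<theta>1: "Ck_on 1 \<theta> W"
    unfolding \<theta>_def by (rule Ck_on_linear_compose[OF chart_facts(1) bounded_linear_fst \<phi>1])
  define \<theta>' where "\<theta>' = frechet_derivative \<theta> (at a)"
  have \<theta>'_eq: "\<theta>' v = fst (frechet_derivative \<phi> (at a) v)" for v
  proof -
    have "(\<theta> has_derivative (\<lambda>v. fst (frechet_derivative \<phi> (at a) v))) (at a)"
      unfolding \<theta>_def by (rule has_derivative_fst[OF D(1)])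
    from frechet_derivative_at[OF this] show ?thesis unfolding \<theta>'_def by metis
  qed
  have lin\<theta>': "linear \<theta>'"
    unfolding \<theta>'_def by (rule has_derivative_linear[OF Ck_on_has_derivative[OF \<theta>1[unfolded One_nat_def] W]])
  have inj: "v = 0" if "v \<in> T" "\<theta>' v = 0" for v
    using tangent_not_vertical that by (simp add: T_def \<theta>'_eq)
  have "dim (\<theta>' ` T) \<le> dim T" by (rule dim_image_le[OF lin\<theta>'])
  then have "dim (\<theta>' ` T) < DIM('e)" using T(2) dims DIM_positive[where 'a='e] by linarith
  then obtain \<nu>0 where \<nu>0: "\<nu>0 \<noteq> 0" "\<And>y. y \<in> span (\<theta>' ` T) \<Longrightarrow> orthogonal \<nu>0 y"
    by (rule orthogonal_to_subspace_exists, intro that) assumption+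
  define \<nu> where "\<nu> = inverse (norm \<nu>0) *\<^sub>R \<nu>0"
  have n1: "norm \<nu> = 1" using \<nu>0(1) by (simp add: \<nu>_def)
  then have \<nu>: "norm \<nu> = 1" "\<nu> \<bullet> \<nu> = 1" "\<nu> \<noteq> 0" by (auto simp: dot_square_norm)
  have \<nu>T: "\<theta>' v \<bullet> \<nu> = 0" if "v \<in> T" for v
    using \<nu>0(2)[OF span_base[OF imageI[OF that]]] by (simp add: \<nu>_def orthogonal_def inner_commute)
  define \<pi> where "\<pi> x = x - (x \<bullet> \<nu>) *\<^sub>R \<nu>" for x :: 'e
  have lin\<pi>: "linear \<pi>" by (rule linearI) (simp_all add: \<pi>_def inner_add_left algebra_simps)
  have \<pi>\<nu>: "\<pi> x \<bullet> \<nu> = 0" for x by (simp add: \<pi>_def inner_diff_left \<nu>(2))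
  have \<pi>_id: "\<pi> x = x \<longleftrightarrow> x \<bullet> \<nu> = 0" for x using \<nu>(3) by (simp add: \<pi>_def)
  have \<pi>\<pi>: "\<pi> (\<pi> x) = \<pi> x" for x using \<pi>\<nu> \<pi>_id by blast
  have "range \<pi> = {x. \<nu> \<bullet> x = 0}"
  proof (intro equalityI subsetI)
    fix x assume "x \<in> {x. \<nu> \<bullet> x = 0}"
    then have "x = \<pi> x" using \<pi>_id[of x] by (simp add: inner_commute)
    then show "x \<in> range \<pi>" by (rule range_eqI)
  qed (auto simp: \<pi>\<nu> inner_commute[of \<nu>])
  then have dim\<pi>: "dim (range \<pi>) = DIM('a) - 2" using dim_hyperplane[OF \<nu>(3)] dims by simp
  obtain A B0 Q0 \<Psi> \<Psi>' c where s: "open A" "0 \<in> A" "open B0" "homeomorphism A B0 \<Psi> \<Psi>'" "Ck_on 1 \<Psi> A"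
    "\<And>y. y \<in> B0 \<Longrightarrow> \<exists>E. (\<Psi>' has_derivative E) (at y) \<and>
        (\<forall>v. E (frechet_derivative \<Psi> (at (\<Psi>' y)) v) = v) \<and> (\<forall>v. frechet_derivative \<Psi> (at (\<Psi>' y)) (E v) = v)"
    "Ck_on 1 c A" "c 0 = a" "c ` A \<subseteq> W"
    "\<And>x. x \<in> A \<Longrightarrow> \<Psi> x = \<theta> (c x) + (x - \<pi> x)"
    "\<And>x. x \<in> A \<Longrightarrow> \<pi> x = x \<Longrightarrow> c x \<in> M"
    "open Q0" "a \<in> Q0" "\<And>q. q \<in> M \<inter> Q0 \<Longrightarrow> \<exists>x\<in>A. \<pi> x = x \<and> c x = q"
    by (rule submanifold_straighten[OF M(3,1) chart_facts(1) W \<theta>1 lin\<pi> \<pi>\<pi> dim\<pi>])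
      (use inj \<nu>T \<pi>_id in \<open>auto simp: T_def \<theta>'_def\<close>)
  have hom: "\<Psi> x \<in> B0" "\<Psi>' (\<Psi> x) = x" if "x \<in> A" for x
    using s(4) that by (auto simp: homeomorphism_def)
  have hom': "\<Psi>' y \<in> A" "\<Psi> (\<Psi>' y) = y" if "y \<in> B0" for y
    using s(4) that by (auto simp: homeomorphism_def)
  have \<Psi>0: "\<Psi> 0 = fst (\<phi> a)" using s(10)[OF s(2)] s(8) by (simp add: \<theta>_def \<pi>_def)
  obtain \<Psi>d where \<Psi>d: "\<And>x. x \<in> A \<Longrightarrow> (\<Psi> has_derivative blinfun_apply (\<Psi>d x)) (at x)"
    "\<And>x. x \<in> A \<Longrightarrow> blinfun_apply (\<Psi>d x) = frechet_derivative \<Psi> (at x)" "continuous_on A \<Psi>d"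
    using Ck_on_1_blinfun[OF s(5)] by blast
  have cont\<Psi>: "continuous_on A \<Psi>" by (rule Ck_on_imp_continuous[OF s(5)])
  define X0 where "X0 = A \<inter> \<Psi> -` ball (fst (\<phi> a)) R"
  have X0: "open X0" unfolding X0_def by (rule continuous_open_preimage[OF cont\<Psi> s(1) open_ball])
  have "continuous_on X0 (\<lambda>x. \<Gamma> (\<Psi> x))"
    by (rule continuous_on_compose2[OF R(4) continuous_on_subset[OF cont\<Psi>]]) (auto simp: X0_def)
  then have X1: "open (X0 \<inter> (\<lambda>x. \<Gamma> (\<Psi> x)) -` Q0)"
    by (rule continuous_open_preimage[OF _ X0 s(12)])
  have "continuous_on A (\<lambda>x. norm (\<Psi>d x))" by (rule continuous_on_norm[OF \<Psi>d(3)])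
  then have X2: "open (A \<inter> (\<lambda>x. norm (\<Psi>d x)) -` {..<norm (\<Psi>d 0) + 1})"
    by (rule continuous_open_preimage[OF _ s(1)]) simp
  have "\<Gamma> (fst (\<phi> a)) = a" by (rule \<Gamma>_fst(1)[OF W M_frontier(1)[OF M(1)]])
  then have "0 \<in> (X0 \<inter> (\<lambda>x. \<Gamma> (\<Psi> x)) -` Q0) \<inter> (A \<inter> (\<lambda>x. norm (\<Psi>d x)) -` {..<norm (\<Psi>d 0) + 1})"
    using s(2,13) R(1) by (simp add: X0_def \<Psi>0)
  then obtain r where r: "r > 0" "ball 0 r \<subseteq> (X0 \<inter> (\<lambda>x. \<Gamma> (\<Psi> x)) -` Q0) \<inter> (A \<inter> (\<lambda>x. norm (\<Psi>d x)) -` {..<norm (\<Psi>d 0) + 1})"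
    by (rule openE[OF open_Int[OF X1 X2]])
  have rA: "x \<in> A" and rR: "\<Psi> x \<in> ball (fst (\<phi> a)) R" and rQ: "\<Gamma> (\<Psi> x) \<in> Q0" and rn: "norm (\<Psi>d x) \<le> norm (\<Psi>d 0) + 1"
    if "x \<in> ball 0 r" for x
    using subsetD[OF r(2) that] by (auto simp: X0_def)
  \<comment> \<open>The boundary point over \<open>\<Psi> x\<close> lies in the edge only if \<open>x\<close> lies in the hyperplane: by injectivity of
    \<open>\<Psi>\<close>, as points of the edge near \<open>a\<close> are parametrized by points of the hyperplane.\<close>
  have on_edge: "x \<bullet> \<nu> = 0" if x: "x \<in> ball 0 r" and M': "\<Gamma> (\<Psi> x) \<in> M" for x
  proof -
    obtain y where y: "y \<in> A" "\<pi> y = y" "c y = \<Gamma> (\<Psi> x)" using s(14)[of "\<Gamma> (\<Psi> x)"] M' rQ[OF x] by blast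
    have "\<theta> (\<Gamma> (\<Psi> x)) = \<Psi> x"
    proof -
      have "\<Psi> x \<in> U" by (rule subsetD[OF R(2) rR[OF x]])
      moreover have "h (\<Psi> x) \<in> I" using R(3)[OF rR[OF x]] by blast
      ultimately have "\<phi> (\<Gamma> (\<Psi> x)) = (\<Psi> x, h (\<Psi> x))" by (rule \<Gamma>_facts(2))
      then show ?thesis by (simp add: \<theta>_def)
    qed
    then have "\<Psi> y = \<Psi> x" using s(10)[OF y(1)] y(2,3) by simp
    then have "\<Psi>' (\<Psi> y) = \<Psi>' (\<Psi> x)" by (rule arg_cong)
    then have "y = x" unfolding hom(2)[OF y(1)] hom(2)[OF rA[OF x]] .
    then show ?thesis using y(2) \<pi>_id[of x] by simp
  qed
  define f where "f x = h (\<Psi> x)" for x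
  have sides: "\<exists>G. continuous_on {x \<in> ball 0 r. x \<bullet> \<mu> \<ge> 0} G \<and> (\<forall>x \<in> {x \<in> ball 0 r. x \<bullet> \<mu> \<ge> 0}.
      (f has_derivative (\<lambda>v. G x \<bullet> blinfun_apply (\<Psi>d x) v)) (at x within {x \<in> ball 0 r. x \<bullet> \<mu> \<ge> 0}))"
    if \<mu>: "\<mu> = \<nu> \<or> \<mu> = - \<nu>" for \<mu>
  proof -
    have \<mu>0: "\<mu> \<noteq> 0" using \<mu> \<nu>(3) by auto
    have off: "\<Psi> x \<in> ball (fst (\<phi> a)) R" "\<Gamma> (\<Psi> x) \<notin> M" if "x \<in> {x \<in> ball 0 r. x \<bullet> \<mu> > 0}" for x
    proof -
      have x: "x \<in> ball 0 r" "x \<bullet> \<nu> \<noteq> 0" using that \<mu> by auto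
      show "\<Psi> x \<in> ball (fst (\<phi> a)) R" by (rule rR[OF x(1)])
      show "\<Gamma> (\<Psi> x) \<notin> M" using on_edge[OF x(1)] x(2) by (rule contrapos_nn[rotated])
    qed
    obtain G where G: "continuous_on {x \<in> ball 0 r. x \<bullet> \<mu> \<ge> 0} G"
      "\<And>x. x \<in> {x \<in> ball 0 r. x \<bullet> \<mu> \<ge> 0} \<Longrightarrow>
        ((\<lambda>x. h (\<Psi> x)) has_derivative (\<lambda>v. G x \<bullet> blinfun_apply (\<Psi>d x) v)) (at x within {x \<in> ball 0 r. x \<bullet> \<mu> \<ge> 0})"
    proof (rule one_sided_C1[OF \<mu>0 \<Psi>d(1)[OF rA] _ rn, where h=h and g=g and g'=g' and ?K1.0=K])
      show "continuous_on (ball 0 r) \<Psi>d" by (rule continuous_on_subset[OF \<Psi>d(3)]) (use rA in blast)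
      show "continuous_on (\<Psi> ` {x \<in> ball 0 r. x \<bullet> \<mu> \<ge> 0}) h"
        by (rule continuous_on_subset[OF cont_h]) (use rR R(2) in blast)
      fix x assume "x \<in> {x \<in> ball 0 r. x \<bullet> \<mu> > 0}"
      note o = off[OF this]
      show "(h has_derivative (\<lambda>v. g (\<Psi> x) \<bullet> v)) (at (\<Psi> x))" by (rule R(5)[OF o])
      show "(g has_derivative g' (\<Psi> x)) (at (\<Psi> x))" by (rule R(6)[OF o])
      show "norm (g' (\<Psi> x) v) \<le> K * norm v" for v by (rule R(7)[OF o])
    qed (assumption, assumption, rule that, assumption+)
    then show ?thesis unfolding f_def by (intro exI[of _ G] conjI ballI)
  qed
  obtain Gp where Gp: "continuous_on {x \<in> ball 0 r. x \<bullet> \<nu> \<ge> 0} Gp" "\<And>x. x \<in> {x \<in> ball 0 r. x \<bullet> \<nu> \<ge> 0} \<Longrightarrow>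
      (f has_derivative (\<lambda>v. Gp x \<bullet> blinfun_apply (\<Psi>d x) v)) (at x within {x \<in> ball 0 r. x \<bullet> \<nu> \<ge> 0})"
    using sides[of \<nu>] by blast
  have neg: "{x \<in> ball 0 r. x \<bullet> - \<nu> \<ge> 0} = {x \<in> ball 0 r. x \<bullet> \<nu> \<le> 0}" by simp
  obtain Gm where Gm: "continuous_on {x \<in> ball 0 r. x \<bullet> \<nu> \<le> 0} Gm" "\<And>x. x \<in> {x \<in> ball 0 r. x \<bullet> \<nu> \<le> 0} \<Longrightarrow>
      (f has_derivative (\<lambda>v. Gm x \<bullet> blinfun_apply (\<Psi>d x) v)) (at x within {x \<in> ball 0 r. x \<bullet> \<nu> \<le> 0})"
    using sides[of "- \<nu>"] unfolding neg by blast
  define Y where "Y = B0 \<inter> \<Psi>' -` ball 0 r"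
  have "continuous_on B0 \<Psi>'" using s(4) by (simp add: homeomorphism_def)
  then have Y: "open Y" unfolding Y_def by (rule continuous_open_preimage[OF _ s(3) open_ball])
  define Q where "Q = W \<inter> (\<lambda>z. fst (\<phi> z)) -` Y"
  have Q: "open Q" unfolding Q_def
    by (rule continuous_open_preimage[OF continuous_on_fst[OF cont(1)] chart_facts(1) Y])
  define \<Phi> where "\<Phi> z = (\<Psi>' (fst (\<phi> z)), snd (\<phi> z))" for z
  have QB: "z \<in> W" "fst (\<phi> z) \<in> B0" "\<Psi>' (fst (\<phi> z)) \<in> ball 0 r" if "z \<in> Q" for z
    using that by (auto simp: Q_def Y_def)
  have f\<Phi>: "f (fst (\<Phi> z)) = h (fst (\<phi> z))" if "z \<in> Q" for z
    using hom'(2)[OF QB(2)[OF that]] by (simp add: f_def \<Phi>_def)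
  have der\<Phi>: "\<exists>\<Phi>'. (\<Phi> has_derivative \<Phi>') (at z) \<and> surj \<Phi>'" if z: "z \<in> Q" for z
  proof -
    note Dz = Ck_diffeo_derivatives[OF \<phi>[unfolded two] QB(1)[OF z]]
    let ?D = "frechet_derivative \<phi> (at z)" and ?E = "frechet_derivative (inv_into W \<phi>) (at (\<phi> z))"
    obtain E where E: "(\<Psi>' has_derivative E) (at (fst (\<phi> z)))"
      "\<And>v. E (frechet_derivative \<Psi> (at (\<Psi>' (fst (\<phi> z)))) v) = v"
      using s(6)[OF QB(2)[OF z]] by blast
    have "(\<Phi> has_derivative (\<lambda>v. (E (fst (?D v)), snd (?D v)))) (at z)"
      unfolding \<Phi>_def
      by (intro has_derivative_Pair has_derivative_compose[OF has_derivative_fst[OF Dz(1)] E(1)] has_derivative_snd[OF Dz(1)])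
    moreover have "surj (\<lambda>v. (E (fst (?D v)), snd (?D v)))"
    proof (rule surjI[where f="\<lambda>w. ?E (frechet_derivative \<Psi> (at (\<Psi>' (fst (\<phi> z)))) (fst w), snd w)"])
      show "(E (fst (?D (?E (frechet_derivative \<Psi> (at (\<Psi>' (fst (\<phi> z)))) (fst w), snd w)))),
          snd (?D (?E (frechet_derivative \<Psi> (at (\<Psi>' (fst (\<phi> z)))) (fst w), snd w)))) = w" for w
        by (simp add: Dz(4) E(2))
    qed
    ultimately show ?thesis by blast
  qed
  define lp where "lp x v = Gp x \<bullet> blinfun_apply (\<Psi>d x) v" for x v
  define lm where "lm x v = Gm x \<bullet> blinfun_apply (\<Psi>d x) v" for x v
  show thesis
  proof (rule that[of Q \<nu> \<Phi> r f lp lm])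
    show "open Q" by (rule Q)
    show "a \<in> Q" using W hom[OF s(2)] r(1) by (simp add: Q_def Y_def \<Psi>0)
    show "norm \<nu> = 1" by (rule \<nu>)
    show "continuous_on Q \<Phi>"
      using der\<Phi> by (meson continuous_at_imp_continuous_on has_derivative_continuous)
    fix z assume z: "z \<in> Q"
    show "fst (\<Phi> z) \<in> ball 0 r" using QB(3)[OF z] by (simp add: \<Phi>_def)
    show "z \<in> \<Omega> \<longleftrightarrow> snd (\<Phi> z) > f (fst (\<Phi> z))"
      unfolding f\<Phi>[OF z] using in_\<Omega>_iff[OF QB(1)[OF z]] by (simp add: \<Phi>_def)
    show "\<exists>\<Phi>'. (\<Phi> has_derivative \<Phi>') (at z) \<and> surj \<Phi>'" by (rule der\<Phi>[OF z])
  next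
    fix z assume "z \<in> M \<inter> Q"
    then have z: "z \<in> M" "z \<in> Q" by auto
    have "snd (\<Phi> z) = f (fst (\<Phi> z))"
      unfolding f\<Phi>[OF z(2)] using in_frontier_iff[OF QB(1)[OF z(2)]] M_frontier(1)[OF z(1)] by (simp add: \<Phi>_def)
    moreover have "\<Gamma> (\<Psi> (fst (\<Phi> z))) = z"
      using \<Gamma>_fst(1)[OF QB(1)[OF z(2)] M_frontier(1)[OF z(1)]] hom'(2)[OF QB(2)[OF z(2)]] by (simp add: \<Phi>_def)
    then have "fst (\<Phi> z) \<bullet> \<nu> = 0" using on_edge[of "fst (\<Phi> z)"] QB(3)[OF z(2)] z(1) by (simp add: \<Phi>_def)
    ultimately show "snd (\<Phi> z) = f (fst (\<Phi> z)) \<and> fst (\<Phi> z) \<bullet> \<nu> = 0" by simp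
  next
    fix x :: 'e assume x: "x \<in> ball 0 r" "x \<bullet> \<nu> = 0"
    show "(f has_derivative lp x) (at x within {y \<in> ball 0 r. y \<bullet> \<nu> \<ge> 0})"
      unfolding lp_def by (rule Gp(2)) (use x in simp)
    show "(f has_derivative lm x) (at x within {y \<in> ball 0 r. y \<bullet> \<nu> \<le> 0})"
      unfolding lm_def by (rule Gm(2)) (use x in simp)
  next
    have c: "continuous_on {x \<in> ball 0 r. x \<bullet> \<nu> = 0} \<Psi>d"
      by (rule continuous_on_subset[OF \<Psi>d(3)]) (use rA in blast)
    have cp: "continuous_on {x \<in> ball 0 r. x \<bullet> \<nu> = 0} Gp" by (rule continuous_on_subset[OF Gp(1)]) auto
    have cm: "continuous_on {x \<in> ball 0 r. x \<bullet> \<nu> = 0} Gm" by (rule continuous_on_subset[OF Gm(1)]) auto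
    show "continuous_on {x \<in> ball 0 r. x \<bullet> \<nu> = 0} (\<lambda>x. lp x \<nu> - lm x \<nu>)"
      unfolding lp_def lm_def
      by (intro continuous_on_diff continuous_on_inner cp cm blinfun.continuous_on c continuous_on_const)
  qed
qed

text \<open>The sign of the jump \<open>\<delta>\<close> of the normal derivative decides. If it is nonnegative at \<open>a\<close>, then \<open>f\<close> agrees to first
  order with the maximum of its one-sided derivatives; if it is negative at \<open>a\<close>, then it is negative
  at all edge points nearby, and there \<open>f\<close> lies to first order below each of its one-sided derivatives.\<close>

theorem convex_or_concave_wedges:
  "convex (tangent_cone \<Omega> a) \<or>
   (\<exists>Q. open Q \<and> a \<in> Q \<and> (\<forall>p\<in>M \<inter> Q. \<exists>l1 l2. linear l1 \<and> linear l2 \<and> outer_wedge \<Omega> p l1 l2 \<and>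
      (\<forall>\<alpha> \<beta>. (\<forall>v. \<alpha> * l1 v + \<beta> * l2 v = 0) \<longrightarrow> \<alpha> = 0 \<and> \<beta> = 0)))"
proof -
  obtain Q and \<Phi> :: "'a \<Rightarrow> 'e \<times> real" and f :: "'e \<Rightarrow> real" and \<nu> :: 'e and r and lp lm :: "'e \<Rightarrow> 'e \<Rightarrow> real" where nf:
    "open Q" "a \<in> Q" "norm \<nu> = 1" "continuous_on Q \<Phi>" "\<And>z. z \<in> Q \<Longrightarrow> fst (\<Phi> z) \<in> ball 0 r"
    "\<And>z. z \<in> Q \<Longrightarrow> z \<in> \<Omega> \<longleftrightarrow> snd (\<Phi> z) > f (fst (\<Phi> z))"
    "\<And>z. z \<in> M \<inter> Q \<Longrightarrow> snd (\<Phi> z) = f (fst (\<Phi> z)) \<and> fst (\<Phi> z) \<bullet> \<nu> = 0"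
    "\<And>z. z \<in> Q \<Longrightarrow> \<exists>\<Phi>'. (\<Phi> has_derivative \<Phi>') (at z) \<and> surj \<Phi>'"
    "\<And>x. x \<in> ball 0 r \<Longrightarrow> x \<bullet> \<nu> = 0 \<Longrightarrow> (f has_derivative lp x) (at x within {y \<in> ball 0 r. y \<bullet> \<nu> \<ge> 0})"
    "\<And>x. x \<in> ball 0 r \<Longrightarrow> x \<bullet> \<nu> = 0 \<Longrightarrow> (f has_derivative lm x) (at x within {y \<in> ball 0 r. y \<bullet> \<nu> \<le> 0})"
    "continuous_on {x \<in> ball 0 r. x \<bullet> \<nu> = 0} (\<lambda>x. lp x \<nu> - lm x \<nu>)"
    by (rule edge_normal_form, rule that) assumption+
  define \<delta> where "\<delta> x = lp x \<nu> - lm x \<nu>" for x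
  have H: "fst (\<Phi> p) \<in> ball 0 r" "fst (\<Phi> p) \<bullet> \<nu> = 0" "snd (\<Phi> p) = f (fst (\<Phi> p))" if "p \<in> M \<inter> Q" for p
    using nf(5)[of p] nf(7)[OF that] that by auto
  have kink: "lp x v = lm x v + (v \<bullet> \<nu>) * \<delta> x" 
      "e > 0 \<Longrightarrow> \<exists>d>0. \<forall>y. norm (y - x) < d \<longrightarrow>
       ((y - x) \<bullet> \<nu> \<ge> 0 \<longrightarrow> \<bar>f y - f x - lp x (y - x)\<bar> \<le> e * norm (y - x)) \<and>
       ((y - x) \<bullet> \<nu> \<le> 0 \<longrightarrow> \<bar>f y - f x - lm x (y - x)\<bar> \<le> e * norm (y - x))"
    if "x \<in> ball 0 r" "x \<bullet> \<nu> = 0" for x v e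
    unfolding \<delta>_def using kink_expansion[OF that nf(3) nf(9)[OF that] nf(10)[OF that]] by blast+
  have bl: "bounded_linear (lp x)" "bounded_linear (lm x)" if "x \<in> ball 0 r" "x \<bullet> \<nu> = 0" for x
    using has_derivative_bounded_linear[OF nf(9)[OF that]] has_derivative_bounded_linear[OF nf(10)[OF that]] by blast+
  have aMQ: "a \<in> M \<inter> Q" using M(1) nf(2) by simp
  show ?thesis
  proof (cases "\<delta> (fst (\<Phi> a)) \<ge> 0")
    case True
    define x where "x = fst (\<Phi> a)"
    have x: "x \<in> ball 0 r" "x \<bullet> \<nu> = 0" "\<delta> x \<ge> 0" using H[OF aMQ] True by (simp_all add: x_def)
    obtain \<Phi>' where \<Phi>': "(\<Phi> has_derivative \<Phi>') (at a)" "surj \<Phi>'" using nf(8)[OF nf(2)] by blast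
    obtain u where u: "\<Phi>' u = (0, 1)" using \<Phi>'(2) by (metis surjD)
    have "tangent_cone \<Omega> a = {v. snd (\<Phi>' v) \<ge> lp x (fst (\<Phi>' v)) \<and> snd (\<Phi>' v) \<ge> lm x (fst (\<Phi>' v))}"
    proof (rule tangent_cone_epigraph_max[OF \<Phi>'(1) nf(1,2,6) H(3)[OF aMQ] bl[OF x(1,2)] _ u])
      fix e :: real assume "e > 0"
      from kink(2)[OF x(1,2) this] obtain d where d: "d > 0" "\<And>y. norm (y - x) < d \<Longrightarrow>
       ((y - x) \<bullet> \<nu> \<ge> 0 \<longrightarrow> \<bar>f y - f x - lp x (y - x)\<bar> \<le> e * norm (y - x)) \<and>
       ((y - x) \<bullet> \<nu> \<le> 0 \<longrightarrow> \<bar>f y - f x - lm x (y - x)\<bar> \<le> e * norm (y - x))" by blast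
      have "\<bar>f y - f x - max (lp x (y - x)) (lm x (y - x))\<bar> \<le> e * norm (y - x)" if y: "norm (y - x) < d" for y
      proof (cases "(y - x) \<bullet> \<nu> \<ge> 0")
        case True
        then have "max (lp x (y - x)) (lm x (y - x)) = lp x (y - x)"
          using kink(1)[OF x(1,2), of "y - x"] mult_nonneg_nonneg[OF True x(3)] by simp
        then show ?thesis using d(2)[OF y] True by simp
      next
        case False
        then have F: "(y - x) \<bullet> \<nu> \<le> 0" by simp
        then have "max (lp x (y - x)) (lm x (y - x)) = lm x (y - x)"
          using kink(1)[OF x(1,2), of "y - x"] mult_nonpos_nonneg[OF F x(3)] by simp
        then show ?thesis using d(2)[OF y] F by simp
      qed
      then show "\<exists>d>0. \<forall>y. norm (y - fst (\<Phi> a)) < d \<longrightarrow>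
          \<bar>f y - f (fst (\<Phi> a)) - max (lp x (y - fst (\<Phi> a))) (lm x (y - fst (\<Phi> a)))\<bar> \<le> e * norm (y - fst (\<Phi> a))"
        unfolding x_def[symmetric] using d(1) by blast
    qed
    moreover have "convex {v. snd (\<Phi>' v) \<ge> l (fst (\<Phi>' v))}" if "bounded_linear l" for l
    proof -
      have "bounded_linear (\<lambda>v. snd (\<Phi>' v) - l (fst (\<Phi>' v)))"
        by (intro bounded_linear_sub bounded_linear_compose[OF bounded_linear_snd] bounded_linear_compose[OF that]
          bounded_linear_compose[OF bounded_linear_fst] has_derivative_bounded_linear[OF \<Phi>'(1)])
      then have lin: "linear (\<lambda>v. snd (\<Phi>' v) - l (fst (\<Phi>' v)))" by (rule bounded_linear.linear)
      have "convex ((\<lambda>v. snd (\<Phi>' v) - l (fst (\<Phi>' v))) -` {0..})"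
        by (rule convex_linear_vimage[OF lin]) simp
      moreover have "(\<lambda>v. snd (\<Phi>' v) - l (fst (\<Phi>' v))) -` {0..} = {v. snd (\<Phi>' v) \<ge> l (fst (\<Phi>' v))}" by auto
      ultimately show ?thesis by simp
    qed
    ultimately have "convex (tangent_cone \<Omega> a)"
      using bl[OF x(1,2)] by (simp add: Collect_conj_eq convex_Int)
    then show ?thesis ..
  next
    case False
    have cont: "continuous_on (M \<inter> Q) (\<lambda>z. \<delta> (fst (\<Phi> z)))"
      by (rule continuous_on_compose2[OF nf(11)[folded \<delta>_def] continuous_on_fst[OF continuous_on_subset[OF nf(4)]]])
        (use H in auto)
    have "openin (top_of_set (M \<inter> Q)) ((M \<inter> Q) \<inter> (\<lambda>z. \<delta> (fst (\<Phi> z))) -` {..<0})"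
      by (rule continuous_openin_preimage_gen[OF cont]) simp
    then obtain P where P: "open P" "(M \<inter> Q) \<inter> (\<lambda>z. \<delta> (fst (\<Phi> z))) -` {..<0} = (M \<inter> Q) \<inter> P"
      unfolding openin_open by blast
    have aP: "a \<in> P" using P(2) aMQ False by auto
    have "\<exists>l1 l2. linear l1 \<and> linear l2 \<and> outer_wedge \<Omega> p l1 l2 \<and>
      (\<forall>\<alpha> \<beta>. (\<forall>v. \<alpha> * l1 v + \<beta> * l2 v = 0) \<longrightarrow> \<alpha> = 0 \<and> \<beta> = 0)" if p: "p \<in> M \<inter> (Q \<inter> P)" for p
    proof -
      have pMQ: "p \<in> M \<inter> Q" and pQ: "p \<in> Q" using p by auto
      define x where "x = fst (\<Phi> p)"
      have neg: "\<delta> x < 0" using P(2) p by (auto simp: x_def)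
      have x: "x \<in> ball 0 r" "x \<bullet> \<nu> = 0" using H[OF pMQ] by (simp_all add: x_def)
      obtain \<Phi>' where \<Phi>': "(\<Phi> has_derivative \<Phi>') (at p)" "surj \<Phi>'" using nf(8)[OF pQ] by blast
      have below: "snd (\<Phi> z) \<le> f (fst (\<Phi> z))" if "z \<in> Q" "z \<notin> \<Omega>" for z using nf(6)[OF that(1)] that(2) by simp
      have upper: "\<exists>d>0. \<forall>y. norm (y - x) < d \<longrightarrow> f y - f x \<le> lp x (y - x) + e * norm (y - x)"
         "\<exists>d>0. \<forall>y. norm (y - x) < d \<longrightarrow> f y - f x \<le> lm x (y - x) + e * norm (y - x)" if e: "e > 0" for e
      proof -
        from kink(2)[OF x e] obtain d where d: "d > 0" "\<And>y. norm (y - x) < d \<Longrightarrow>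
         ((y - x) \<bullet> \<nu> \<ge> 0 \<longrightarrow> \<bar>f y - f x - lp x (y - x)\<bar> \<le> e * norm (y - x)) \<and>
         ((y - x) \<bullet> \<nu> \<le> 0 \<longrightarrow> \<bar>f y - f x - lm x (y - x)\<bar> \<le> e * norm (y - x))" by blast
        have "f y - f x \<le> lp x (y - x) + e * norm (y - x) \<and> f y - f x \<le> lm x (y - x) + e * norm (y - x)"
          if y: "norm (y - x) < d" for y
        proof (cases "(y - x) \<bullet> \<nu> \<ge> 0")
          case True
          have "lp x (y - x) \<le> lm x (y - x)"
            using kink(1)[OF x, of "y - x"] mult_nonneg_nonpos[OF True, of "\<delta> x"] neg by simp
          moreover have "\<bar>f y - f x - lp x (y - x)\<bar> \<le> e * norm (y - x)" using d(2)[OF y] True by blast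
          ultimately show ?thesis by linarith
        next
          case False
          then have F: "(y - x) \<bullet> \<nu> \<le> 0" by simp
          have "lm x (y - x) \<le> lp x (y - x)"
            using kink(1)[OF x, of "y - x"] mult_nonpos_nonpos[OF F, of "\<delta> x"] neg by simp
          moreover have "\<bar>f y - f x - lm x (y - x)\<bar> \<le> e * norm (y - x)" using d(2)[OF y] F by blast
          ultimately show ?thesis by linarith
        qed
        then show "\<exists>d>0. \<forall>y. norm (y - x) < d \<longrightarrow> f y - f x \<le> lp x (y - x) + e * norm (y - x)"
         "\<exists>d>0. \<forall>y. norm (y - x) < d \<longrightarrow> f y - f x \<le> lm x (y - x) + e * norm (y - x)" using d(1) by blast+
      qed
      define l1 where "l1 v = snd (\<Phi>' v) - lp x (fst (\<Phi>' v))" for v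
      define l2 where "l2 v = snd (\<Phi>' v) - lm x (fst (\<Phi>' v))" for v
      have lin: "linear (\<lambda>v. snd (\<Phi>' v) - l (fst (\<Phi>' v)))" if "bounded_linear l" for l
        by (rule bounded_linear.linear) (intro bounded_linear_sub bounded_linear_compose[OF bounded_linear_snd] bounded_linear_compose[OF that]
          bounded_linear_compose[OF bounded_linear_fst] has_derivative_bounded_linear[OF \<Phi>'(1)])
      have "linear l1" "linear l2" unfolding l1_def l2_def by (rule lin[OF bl(1)[OF x]], rule lin[OF bl(2)[OF x]])
      moreover have "outer_wedge \<Omega> p l1 l2"
        unfolding outer_wedge_def
      proof (intro allI impI)
        fix \<eta> :: real assume \<eta>: "\<eta> > 0"
        obtain d1 where d1: "d1 > 0" "\<And>z. norm (z - p) < d1 \<and> z \<notin> \<Omega> \<Longrightarrow> l1 (z - p) \<le> \<eta> * norm (z - p)"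
          using subgraph_wedge[OF \<Phi>'(1) nf(1) pQ below H(3)[OF pMQ] bl(1)[OF x, unfolded x_def] upper(1)[unfolded x_def] \<eta>]
          unfolding l1_def x_def by blast
        obtain d2 where d2: "d2 > 0" "\<And>z. norm (z - p) < d2 \<and> z \<notin> \<Omega> \<Longrightarrow> l2 (z - p) \<le> \<eta> * norm (z - p)"
          using subgraph_wedge[OF \<Phi>'(1) nf(1) pQ below H(3)[OF pMQ] bl(2)[OF x, unfolded x_def] upper(2)[unfolded x_def] \<eta>]
          unfolding l2_def x_def by blast
        show "\<exists>\<delta>>0. \<forall>z. norm (z - p) < \<delta> \<and> z \<notin> \<Omega> \<longrightarrow> l1 (z - p) \<le> \<eta> * norm (z - p) \<and> l2 (z - p) \<le> \<eta> * norm (z - p)"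
          using d1 d2 by (intro exI[of _ "min d1 d2"]) simp
      qed
      moreover have "\<alpha> = 0 \<and> \<beta> = 0" if 0: "\<forall>v. \<alpha> * l1 v + \<beta> * l2 v = 0" for \<alpha> \<beta>
      proof -
        obtain u where u: "\<Phi>' u = (0, 1)" using \<Phi>'(2) by (metis surjD)
        obtain w where w: "\<Phi>' w = (\<nu>, 0)" using \<Phi>'(2) by (metis surjD)
        have "lp x 0 = 0" "lm x 0 = 0" using bl[OF x] by (simp_all add: linear_0 bounded_linear.linear)
        then have "\<alpha> + \<beta> = 0" using 0[rule_format, of u] by (simp add: l1_def l2_def u)
        moreover have "\<alpha> * lp x \<nu> + \<beta> * lm x \<nu> = 0" using 0[rule_format, of w] by (simp add: l1_def l2_def w)
        ultimately have "\<alpha> * \<delta> x = 0" by (simp add: \<delta>_def right_diff_distrib eq_neg_iff_add_eq_0[symmetric])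
        then show ?thesis using neg \<open>\<alpha> + \<beta> = 0\<close> by simp
      qed
      ultimately show ?thesis by blast
    qed
    then show ?thesis using nf(1,2) P(1) aP by (intro disjI2 exI[of _ "Q \<inter> P"]) blast
  qed
qed

end

section \<open>Complex tangents of the edge\<close>

text \<open>For a real linear form \<open>l\<close> this is the complex linear form with real part \<open>l\<close>.\<close>

definition complexify :: "(complex ^ 'N \<Rightarrow> real) \<Rightarrow> complex ^ 'N \<Rightarrow> complex" where
  "complexify l z = Complex (l z) (- l (\<i> *s z))"

lemma Re_complexify [simp]: "Re (complexify l z) = l z"
  by (simp add: complexify_def)

lemma complex_linear_complexify:
  fixes l :: "complex ^ 'N \<Rightarrow> real"
  assumes l: "linear l"
  shows "complex_linear (complexify l)"
proof -
  have scale: "c *s z = Re c *\<^sub>R z + Im c *\<^sub>R (\<i> *s z)" for c and z :: "complex^'N"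
    by (simp add: vec_eq_iff complex_eq_iff)
  have "complexify l (c *s z) = c * complexify l z" for c z
  proof -
    have 1: "l (c *s z) = Re c * l z + Im c * l (\<i> *s z)"
      by (subst scale) (simp add: linear_add[OF l] linear_scale[OF l])
    have "\<i> *s (c *s z) = (- Im c) *\<^sub>R z + Re c *\<^sub>R (\<i> *s z)" by (simp add: vec_eq_iff complex_eq_iff)
    then have 2: "l (\<i> *s (c *s z)) = - Im c * l z + Re c * l (\<i> *s z)"
      by (simp only: linear_add[OF l] linear_scale[OF l] real_scaleR_def)
    show ?thesis unfolding complexify_def 1 2 by (simp add: complex_eq_iff)
  qed
  moreover have "linear (complexify l)"
  proof (rule linearI)
    show "complexify l (x + y) = complexify l x + complexify l y" for x y
      by (simp add: complexify_def complex_eq_iff linear_add[OF l] vector_add_ldistrib)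
    have "\<i> *s (r *\<^sub>R x) = r *\<^sub>R (\<i> *s x)" for r and x :: "complex^'N" by (simp add: vec_eq_iff)
    then have "l (\<i> *s (r *\<^sub>R x)) = r * l (\<i> *s x)" for r x
      by (simp only: linear_scale[OF l] real_scaleR_def)
    then show "complexify l (r *\<^sub>R x) = r *\<^sub>R complexify l x" for r x
      unfolding complexify_def by (simp only:) (simp add: complex_eq_iff linear_scale[OF l])
  qed
  ultimately show ?thesis by (simp add: complex_linear_def)
qed

text \<open>Independent forms on a complex vector space are part of a dual basis.\<close>

lemma complex_linear_dual_pair:
  assumes f: "complex_linear f1" "complex_linear f2" and nz: "f1 z \<noteq> 0" and indep: "\<nexists>c. \<forall>v. f2 v = c * f1 v"
  obtains e1 e2 where "f1 e1 = 1" "f1 e2 = 0" "f2 e1 = 0" "f2 e2 = 1"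
proof -
  have lin: "f1 (x - y) = f1 x - f1 y" "f1 (c *s x) = c * f1 x" "f2 (x - y) = f2 x - f2 y" "f2 (c *s x) = c * f2 x" for x y c
    using f unfolding complex_linear_def by (auto simp: linear_diff)
  define z0 where "z0 = (1 / f1 z) *s z"
  have z0: "f1 z0 = 1" using nz by (simp add: z0_def lin)
  obtain v where v: "f2 v \<noteq> f2 z0 * f1 v" using indep by blast
  define u where "u = v - f1 v *s z0"
  have u: "f1 u = 0" "f2 u \<noteq> 0" using v by (simp_all add: u_def lin z0 mult.commute)
  define e2 where "e2 = (1 / f2 u) *s u"
  have e2: "f1 e2 = 0" "f2 e2 = 1" using u by (simp_all add: e2_def lin)
  have e1: "f1 (z0 - f2 z0 *s e2) = 1" "f2 (z0 - f2 z0 *s e2) = 0" by (simp_all add: lin z0 e2)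
  show thesis by (rule that[OF e1(1) e2(1) e1(2) e2(2)])
qed

text \<open>The complexified forms of the wedge are proportional, since otherwise \<open>\<Omega>\<close> would not be a domain of
  holomorphy; the factor \<open>c\<close> is not real, so the common kernel of the real forms is the kernel of \<open>f1\<close>.\<close>

lemma complex_tangent_at_concave_edge:
  fixes \<Omega> M :: "(complex^'N) set"
  assumes hol: "domain_of_holomorphy \<Omega>" and \<Omega>: "open \<Omega>" and p: "p \<in> M" and M: "M \<inter> \<Omega> = {}" "Ck_submanifold 1 d M"
    and l: "linear l1" "linear l2" "outer_wedge \<Omega> p l1 l2"
    and indep: "\<And>\<alpha> \<beta>. (\<forall>v. \<alpha> * l1 v + \<beta> * l2 v = 0) \<Longrightarrow> \<alpha> = 0 \<and> \<beta> = 0"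
  shows "\<exists>f. complex_linear f \<and> (\<exists>z. f z \<noteq> 0) \<and> (\<forall>v\<in>tangent_cone M p. f v = 0)"
proof -
  define f1 where "f1 = complexify l1"
  define f2 where "f2 = complexify l2"
  have f: "complex_linear f1" "complex_linear f2"
    unfolding f1_def f2_def using complex_linear_complexify l by blast+
  have Re_f: "Re (f1 z) = l1 z" "Re (f2 z) = l2 z" for z by (simp_all add: f1_def f2_def)
  have "\<exists>z. f1 z \<noteq> 0"
  proof (rule ccontr)
    assume "\<nexists>z. f1 z \<noteq> 0"
    then have "\<forall>v. 1 * l1 v + 0 * l2 v = 0" using Re_f(1) by (metis mult_1 mult_zero_left add_0_right zero_complex.simps(1))
    from indep[OF this] show False by simp
  qed
  then obtain z where z: "f1 z \<noteq> 0" by blast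
  have "\<exists>c. \<forall>v. f2 v = c * f1 v"
  proof (rule ccontr)
    assume nd: "\<nexists>c. \<forall>v. f2 v = c * f1 v"
    obtain e1 e2 where e: "f1 e1 = 1" "f1 e2 = 0" "f2 e1 = 0" "f2 e2 = 1"
      by (rule complex_linear_dual_pair[OF f z nd])
    have "p \<notin> \<Omega>" using p M(1) by blast
    moreover have "outer_wedge \<Omega> p (\<lambda>z. Re (f1 z)) (\<lambda>z. Re (f2 z))" using l(3) by (simp add: Re_f)
    ultimately have "\<not> domain_of_holomorphy \<Omega>"
      by (rule not_domain_of_holomorphy_if_concave_edge[OF \<Omega> _ f e])
    then show False using hol by contradiction
  qed
  then obtain c where c: "\<And>v. f2 v = c * f1 v" by blast
  have Im_c: "Im c \<noteq> 0"
  proof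
    assume "Im c = 0"
    then have "\<forall>v. Re c * l1 v + (- 1) * l2 v = 0" using Re_f(1) Re_f(2)[unfolded c] by simp
    from indep[OF this] show False by simp
  qed
  have "f1 v = 0" if v: "v \<in> tangent_cone M p" for v
  proof -
    have mv: "- v \<in> tangent_cone M p"
      using subspace_neg[OF tangent_cone_submanifold_subspace(1)[OF M(2) p] v] .
    note le = outer_wedge_tangent[OF l(3,1,2) M(1) v] outer_wedge_tangent[OF l(3,1,2) M(1) mv]
    have l0: "l1 v = 0" "l2 v = 0" using le linear_neg[OF l(1), of v] linear_neg[OF l(2), of v] by simp_all
    then have "Re (f1 v) = 0" by (simp add: Re_f)
    moreover have "Re (c * f1 v) = 0" using l0(2) Re_f(2)[of v] c[of v] by simp
    ultimately show "f1 v = 0" using Im_c by (simp add: complex_eq_iff)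
  qed
  then show ?thesis using f(1) z by blast
qed

theorem proposition1p2:
  fixes \<Omega> :: "(complex ^ 'N) set" and a :: "complex ^ 'N" and M :: "(complex ^ 'N) set"
  assumes "is_domain \<Omega>"
    and "class_L2inf \<Omega>"
    and "domain_of_holomorphy \<Omega>"
    and "a \<in> frontier \<Omega>"
    and "edge_point (frontier \<Omega>) a"
    and "edge_at (frontier \<Omega>) a M"
    and "\<not> (\<exists>V. open V \<and> a \<in> V \<and> complex_hypersurface (M \<inter> V))"
  shows "convex (tangent_cone \<Omega> a)"
proof -
  have \<Omega>: "open \<Omega>" using assms(1) by (simp add: is_domain_def)
  obtain N where nb: "open N" "a \<in> N" "closedin (top_of_set (frontier \<Omega> \<inter> N)) M"
    "Ck_submanifold 1 (DIM(complex^'N) - 2) M" "{p \<in> frontier \<Omega> \<inter> N. \<not> regular_point (frontier \<Omega>) p} \<subseteq> M"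
    using assms(6) unfolding edge_at_def by (elim exE conjE) (rule that)
  have aM: "a \<in> M" using nb(2,5) assms(4,5) unfolding edge_point_def by blast
  obtain W U I h and \<phi> :: "complex^'N \<Rightarrow> (real ^ 'N hyp_index) \<times> real" where
    chart: "a \<in> W" "open U" "open I" "Ck_diffeo 2 \<phi> W (U \<times> I)" "L2inf U h"
      "\<phi> ` (\<Omega> \<inter> W) = {(x', xn). x' \<in> U \<and> xn \<in> I \<and> xn > h x'}"
    using bspec[OF assms(2)[unfolded class_L2inf_def] assms(4)] by (elim exE conjE) (rule that)
  obtain V where V: "open V" "V \<subseteq> U" "U \<subseteq> closure V" "Ck_on 2 h V" 
      "\<And>v. bounded ((\<lambda>x. frechet_derivative h (at x) v) ` V)"
      "\<And>v w. bounded ((\<lambda>x. frechet_derivative (\<lambda>y. frechet_derivative h (at y) v) (at x) w) ` V)"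
    and cont: "continuous_on U h"
    using chart(5) unfolding L2inf_def by blast
  have "1 \<le> CARD('N)" by (simp add: Suc_leI)
  then have dims: "DIM(complex^'N) = DIM(real ^ 'N hyp_index) + 1"
    by (simp add: CARD_hyp_index)
  interpret edge_graph \<Omega> a M W U I \<phi> h V N
    by unfold_locales (fact \<Omega> dims chart cont V aM nb)+
  have disj: "M \<inter> \<Omega> = {}" using M_frontier(1) \<Omega> by (auto simp: frontier_def interior_open)
  show ?thesis
    using convex_or_concave_wedges
  proof
    assume "\<exists>Q. open Q \<and> a \<in> Q \<and> (\<forall>p\<in>M \<inter> Q. \<exists>l1 l2. linear l1 \<and> linear l2 \<and> outer_wedge \<Omega> p l1 l2 \<and>
      (\<forall>\<alpha> \<beta>. (\<forall>v. \<alpha> * l1 v + \<beta> * l2 v = 0) \<longrightarrow> \<alpha> = 0 \<and> \<beta> = 0))"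
    then obtain Q where Q: "open Q" "a \<in> Q" "\<And>p. p \<in> M \<inter> Q \<Longrightarrow> \<exists>l1 l2. linear l1 \<and> linear l2 \<and> outer_wedge \<Omega> p l1 l2 \<and>
      (\<forall>\<alpha> \<beta>. (\<forall>v. \<alpha> * l1 v + \<beta> * l2 v = 0) \<longrightarrow> \<alpha> = 0 \<and> \<beta> = 0)" by blast
    have "complex_hypersurface (M \<inter> Q)"
    proof (rule complex_hypersurface_if_tangents_complex[OF nb(4) Q(1)])
      fix p assume p: "p \<in> M \<inter> Q"
      obtain l1 l2 where l: "linear l1" "linear l2" "outer_wedge \<Omega> p l1 l2"
        and indep: "\<And>\<alpha> \<beta>. (\<forall>v. \<alpha> * l1 v + \<beta> * l2 v = 0) \<Longrightarrow> \<alpha> = 0 \<and> \<beta> = 0"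
        using Q(3)[OF p] by blast
      have "p \<in> M" using p by blast
      from complex_tangent_at_concave_edge[OF assms(3) \<Omega> this disj nb(4) l indep]
      show "\<exists>f. complex_linear f \<and> (\<exists>z. f z \<noteq> 0) \<and> (\<forall>v\<in>tangent_cone M p. f v = 0)" .
    qed
    then show ?thesis using assms(7) Q(1,2) by blast
  qed
qed

end
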